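(* Let $X$ be a compact complex manifold of complex dimension $n$. Then $h^{n-1,0}_{BC}=h^{n-1,0}_{\bar\partial}$.
   Context: On smooth complex-valued $(p,q)$-forms on $X$, define $H^{p,q}_{BC}=(\ker(\partial)\cap\ker(\bar\partial))/\operatorname{im}(\partial\bar\partial)$ and $H^{p,q}_{\bar\partial}=\ker(\bar\partial)/\operatorname{im}(\bar\partial)$ (all spaces in bidegree $(p,q)$), with complex dimensions $h^{p,q}_{BC}$ and $h^{p,q}_{\bar\partial}$. *)

theory Defs
  imports
    "HOL-Analysis.Analysis"
    "HOL-Combinatorics.Permutations"
    "HOL-Library.Extended_Nat"
    "HOL-Algebra.AbelCoset"
    "Jordan_Normal_Form.Missing_VectorSpace"
begin

section \<open>Smooth and holomorphic maps\<close>

fun Ck_on ::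
    "nat \<Rightarrow> 'v::real_normed_vector set \<Rightarrow> ('v \<Rightarrow> 'w::real_normed_vector) \<Rightarrow> bool" where
  "Ck_on 0 S f \<longleftrightarrow> continuous_on S f"
| "Ck_on (Suc k) S f \<longleftrightarrow>
     (\<forall>x\<in>S. f differentiable (at x)) \<and>
     (\<forall>v. Ck_on k S (\<lambda>x. frechet_derivative f (at x) v))"

definition smooth_on ::
    "'v::real_normed_vector set \<Rightarrow> ('v \<Rightarrow> 'w::real_normed_vector) \<Rightarrow> bool" where
  "smooth_on S f \<longleftrightarrow> (\<forall>k. Ck_on k S f)"

text \<open>Holomorphy in several variables: complex (Frechet) differentiability at every point
  of an open set.\<close>

definition cholomorphic_on ::
    "(complex^'n) set \<Rightarrow> (complex^'n \<Rightarrow> complex^'m) \<Rightarrow> bool" where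
  "cholomorphic_on S f \<longleftrightarrow>
     (\<forall>x\<in>S. \<exists>D. (f has_derivative D) (at x) \<and> (\<forall>c v. D (c *s v) = c *s D v))"


section \<open>Complex manifolds\<close>

type_synonym ('a, 'n) chart = "'a set \<times> ('a \<Rightarrow> complex^'n)"

definition chart_image :: "('a, 'n::finite) chart \<Rightarrow> (complex^'n) set" where
  "chart_image c = snd c ` fst c"

definition transition ::
    "('a, 'n::finite) chart \<Rightarrow> ('a, 'n) chart \<Rightarrow> complex^'n \<Rightarrow> complex^'n" where
  "transition c d = snd d \<circ> inv_into (fst c) (snd c)"

definition complex_chart :: "('a::topological_space, 'n::finite) chart \<Rightarrow> bool" where
  "complex_chart c \<longleftrightarrow>
     open (fst c) \<and> open (chart_image c) \<and>
     homeomorphism (fst c) (chart_image c) (snd c) (inv_into (fst c) (snd c))"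

text \<open>A complex manifold of dimension \<open>CARD('n)\<close> is the whole of a Hausdorff type \<open>'a\<close>
  together with such an atlas. Second countability is not listed: it is automatic for
  compact spaces covered by charts.\<close>

definition complex_atlas :: "('a::t2_space, 'n::finite) chart set \<Rightarrow> bool" where
  "complex_atlas A \<longleftrightarrow>
     (\<forall>c\<in>A. complex_chart c) \<and>
     (\<Union>c\<in>A. fst c) = UNIV \<and>
     (\<forall>c\<in>A. \<forall>d\<in>A. cholomorphic_on (snd c ` (fst c \<inter> fst d)) (transition c d))"


section \<open>Forms of type \<open>(p,q)\<close>\<close>

text \<open>An alternating \<open>k\<close>-form on \<open>complex^'n\<close> is a function of lists of vectors that vanishes
  on lists whose length is not \<open>k\<close>. \<open>dz_wedge I J\<close> is
  \<open>dz_I\<^sub>1 \<and> \<dots> \<and> dz_I\<^sub>p \<and> dzbar_J\<^sub>1 \<and> \<dots> \<and> dzbar_J\<^sub>q\<close>, with the normalisation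
  \<open>(\<alpha>\<^sub>1 \<and> \<dots> \<and> \<alpha>\<^sub>k)(v\<^sub>1,\<dots>,v\<^sub>k) = det (\<alpha>\<^sub>a(v\<^sub>b))\<close>.\<close>

definition dz_wedge :: "'n list \<Rightarrow> 'n list \<Rightarrow> (complex^'n::finite) list \<Rightarrow> complex" where
  "dz_wedge I J vs =
     (let \<alpha> = map (\<lambda>i v. v $ i) I @ map (\<lambda>j v. cnj (v $ j)) J; k = length \<alpha> in
      if length vs = k
      then \<Sum>\<sigma> | \<sigma> permutes {..<k}. of_int (sign \<sigma>) * (\<Prod>a<k. (\<alpha> ! a) (vs ! \<sigma> a))
      else 0)"

definition pq_covectors :: "nat \<Rightarrow> nat \<Rightarrow> ((complex^'n::finite) list \<Rightarrow> complex) set" where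
  "pq_covectors p q =
     {\<eta>. \<exists>a. \<eta> = (\<lambda>vs. \<Sum>I | length I = p. \<Sum>J | length J = q. a I J * dz_wedge I J vs)}"

text \<open>A differential form is the family of its local expressions in the charts of the atlas,
  compatible under pullback by the transition maps. Off the atlas, and off the image of a
  chart, it is set to zero, so that equality of forms is equality of functions.\<close>

type_synonym ('a, 'n) dform =
  "('a, 'n) chart \<Rightarrow> complex^'n \<Rightarrow> (complex^'n) list \<Rightarrow> complex"

definition zero_form :: "('a, 'n::finite) dform" where
  "zero_form = (\<lambda>c z vs. 0)"

text \<open>Bidegrees are integers, and there are no nonzero forms in negative bidegree.\<close>

definition pq_forms ::
    "('a, 'n::finite) chart set \<Rightarrow> int \<Rightarrow> int \<Rightarrow> ('a, 'n) dform set" where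
  "pq_forms A p q =
     (if p < 0 \<or> q < 0 then {zero_form}
      else {\<omega>.
        (\<forall>c z vs. c \<notin> A \<or> z \<notin> chart_image c \<longrightarrow> \<omega> c z vs = 0) \<and>
        (\<forall>c\<in>A. \<forall>z\<in>chart_image c. \<omega> c z \<in> pq_covectors (nat p) (nat q)) \<and>
        (\<forall>c\<in>A. \<forall>vs. smooth_on (chart_image c) (\<lambda>z. \<omega> c z vs)) \<and>
        (\<forall>c\<in>A. \<forall>d\<in>A. \<forall>x \<in> fst c \<inter> fst d. \<forall>vs.
           \<omega> c (snd c x) vs =
           \<omega> d (snd d x) (map (frechet_derivative (transition c d) (at (snd c x))) vs))})"


section \<open>The operators \<open>\<partial>\<close> and \<open>\<partial>bar\<close>\<close>

text \<open>The complex linear and antilinear parts of the differential of a function: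
  \<open>\<partial>f(v) = \<Sum>\<^sub>j \<partial>f/\<partial>z\<^sub>j v\<^sub>j\<close> and \<open>\<partial>bar f(v) = \<Sum>\<^sub>j \<partial>f/\<partial>zbar\<^sub>j cnj v\<^sub>j\<close>.\<close>

definition del_fun ::
    "(complex^'n::finite \<Rightarrow> complex) \<Rightarrow> complex^'n \<Rightarrow> complex^'n \<Rightarrow> complex" where
  "del_fun f z v =
     (frechet_derivative f (at z) v - \<i> * frechet_derivative f (at z) (\<i> *s v)) / 2"

definition delbar_fun ::
    "(complex^'n::finite \<Rightarrow> complex) \<Rightarrow> complex^'n \<Rightarrow> complex^'n \<Rightarrow> complex" where
  "delbar_fun f z v =
     (frechet_derivative f (at z) v + \<i> * frechet_derivative f (at z) (\<i> *s v)) / 2"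

definition omit_nth :: "nat \<Rightarrow> 'b list \<Rightarrow> 'b list" where
  "omit_nth i xs = take i xs @ drop (Suc i) xs"

text \<open>In a chart, \<open>\<partial>(f \<alpha>) = \<partial>f \<and> \<alpha>\<close> for a constant form \<open>\<alpha> = dz_I \<and> dzbar_J\<close>, and
  \<open>(\<beta> \<and> \<alpha>)(v\<^sub>0,\<dots>,v\<^sub>k) = \<Sum>\<^sub>i (-1)^i \<beta>(v\<^sub>i) \<alpha>(\<dots>, omit v\<^sub>i, \<dots>)\<close> for a 1-form \<open>\<beta>\<close>;
  likewise for \<open>\<partial>bar\<close>.\<close>

definition del :: "('a, 'n::finite) chart set \<Rightarrow> ('a, 'n) dform \<Rightarrow> ('a, 'n) dform" where
  "del A \<omega> = (\<lambda>c z vs.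
     if c \<in> A \<and> z \<in> chart_image c
     then \<Sum>i<length vs. (-1) ^ i * del_fun (\<lambda>w. \<omega> c w (omit_nth i vs)) z (vs ! i)
     else 0)"

definition delbar :: "('a, 'n::finite) chart set \<Rightarrow> ('a, 'n) dform \<Rightarrow> ('a, 'n) dform" where
  "delbar A \<omega> = (\<lambda>c z vs.
     if c \<in> A \<and> z \<in> chart_image c
     then \<Sum>i<length vs. (-1) ^ i * delbar_fun (\<lambda>w. \<omega> c w (omit_nth i vs)) z (vs ! i)
     else 0)"


section \<open>Cohomology and its dimension\<close>

text \<open>The fields \<open>mult\<close> and \<open>one\<close> are present in module records but carry no meaning
  for modules.\<close>

definition form_module :: "('a, 'n::finite) dform set \<Rightarrow> (complex, ('a, 'n) dform) module" where
  "form_module V =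
     \<lparr>carrier = V, mult = undefined, one = undefined,
      zero = zero_form, add = (\<lambda>\<omega> \<eta> c z vs. \<omega> c z vs + \<eta> c z vs),
      smult = (\<lambda>a \<omega> c z vs. a * \<omega> c z vs)\<rparr>"

definition quotient_module ::
    "('r, 'v, 'x) module_scheme \<Rightarrow> 'v set \<Rightarrow> ('r, 'v set) module" where
  "quotient_module M W =
     \<lparr>carrier = a_rcosets\<^bsub>M\<^esub> W, mult = undefined, one = undefined,
      zero = W, add = (\<lambda>S T. S <+>\<^bsub>M\<^esub> T),
      smult = (\<lambda>a S. \<Union>s\<in>S. W +>\<^bsub>M\<^esub> (a \<odot>\<^bsub>M\<^esub> s))\<rparr>"

definition complex_field :: "complex ring" where
  "complex_field = \<lparr>carrier = UNIV, mult = (*), one = 1, zero = 0, add = (+)\<rparr>"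

definition complex_dim :: "(complex, 'v) module \<Rightarrow> enat" where
  "complex_dim V =
     (if vectorspace.fin_dim complex_field V then enat (vectorspace.dim complex_field V) else \<infinity>)"

definition bott_chern ::
    "('a, 'n::finite) chart set \<Rightarrow> int \<Rightarrow> int \<Rightarrow> (complex, ('a, 'n) dform set) module" where
  "bott_chern A p q =
     quotient_module
       (form_module {\<omega> \<in> pq_forms A p q. del A \<omega> = zero_form \<and> delbar A \<omega> = zero_form})
       ((\<lambda>\<eta>. del A (delbar A \<eta>)) ` pq_forms A (p - 1) (q - 1))"

definition dolbeault ::
    "('a, 'n::finite) chart set \<Rightarrow> int \<Rightarrow> int \<Rightarrow> (complex, ('a, 'n) dform set) module" where
  "dolbeault A p q =
     quotient_module
       (form_module {\<omega> \<in> pq_forms A p q. delbar A \<omega> = zero_form})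
       (delbar A ` pq_forms A p (q - 1))"

definition h_BC :: "('a, 'n::finite) chart set \<Rightarrow> int \<Rightarrow> int \<Rightarrow> enat" where
  "h_BC A p q = complex_dim (bott_chern A p q)"

definition h_delbar :: "('a, 'n::finite) chart set \<Rightarrow> int \<Rightarrow> int \<Rightarrow> enat" where
  "h_delbar A p q = complex_dim (dolbeault A p q)"

end

theory Submission
  imports Defs "HOL-Complex_Analysis.Cauchy_Integral_Formula" "Jordan_Normal_Form.Determinant"
begin

text \<open>In bidegree \<open>(n-1,0)\<close> neither quotient has anything to divide out, so the claim is that a
  holomorphic \<open>(n-1)\<close>-form \<open>\<omega>\<close> on a compact manifold satisfies \<open>\<partial>\<omega> = 0\<close>. Write
  \<open>\<partial>\<omega> = f dz\<^sub>1 \<and> \<dots> \<and> dz\<^sub>n\<close> in a chart. As \<open>\<partial>\<omega>\<close> is again holomorphic,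
  \<open>\<partial>\<omega> \<and> cnj (\<partial>\<omega>) = d (\<omega> \<and> cnj (\<partial>\<omega>))\<close>. The left-hand side is, up to a constant, the density
  \<open>|f|\<^sup>2\<close>, and its integral vanishes by Stokes' theorem, which is carried out by hand: with a
  \<open>C\<^sup>1\<close> partition of unity \<open>\<rho>\<^sub>k\<close>, integration by parts in the charts turns the integral
  into that of \<open>- (\<Sum>\<^sub>k \<partial>\<rho>\<^sub>k) \<and> \<omega> \<and> cnj (\<partial>\<omega>)\<close>, which is zero because \<open>\<Sum>\<^sub>k \<rho>\<^sub>k = 1\<close>.
  Moving between charts uses the change of variables formula, with the real Jacobian \<open>|det J|\<^sup>2\<close>
  of a holomorphic map, and the invariance of \<open>\<partial>\<omega>\<close>, which rests on the symmetry of second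
  derivatives.\<close>

section \<open>Covectors of type \<open>(p,0)\<close>\<close>

text \<open>No integral over the manifold is ever defined. A top covector is determined by its value
  on one fixed basis, so \<partial>\<omega> and the wedge of \<partial>\<rho> with \<omega> become
  scalar functions in each chart. Both scale by the complex determinant of a coordinate change;
  multiplied by the conjugate of \<open>f\<close> they scale by the real Jacobian, so Lebesgue
  integrals in different charts can be compared. The cancellation is a finite double sum: write 1 as
  the sum of all cut-offs in the integral of chart k, move the term (k,l) to chart l, and there sum
  over k first. Holomorphy is given only as complex differentiability, so continuity of first
  derivatives and existence and symmetry of second ones come from one-variable theory on complex
  lines. The equation \<open>delbar A \<omega> = zero_form\<close> is an alternating sum over slots
  and is split by comparing linear with antilinear dependence on one vector. Since integration by
  parts differentiates a cut-off only once, C^1 is enough, and the square of the positive part of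
  \<open>r\<^sup>2 - |y - p|\<^sup>2\<close> can serve as bump.\<close>

no_notation vec_index (infixl \<open>$\<close> 100)
no_notation scalar_prod (infix \<open>\<bullet>\<close> 70)
hide_const (open) Matrix.vec
hide_const (open) Determinant.det

lemma length_omit_nth [simp]: "i < length xs \<Longrightarrow> length (omit_nth i xs) = length xs - 1"
  by (simp add: omit_nth_def)

lemma nth_omit_nth:
  assumes "i < length xs" "k < length xs - 1"
  shows "omit_nth i xs ! k = (if k < i then xs ! k else xs ! Suc k)"
  using assms by (auto simp: omit_nth_def nth_append min_def)

lemma map_omit_nth: "map f (omit_nth i xs) = omit_nth i (map f xs)"
  by (simp add: omit_nth_def take_map drop_map)

lemma omit_nth_omit_nth:
  assumes "k < i" "i < length xs"
  shows "omit_nth k (omit_nth i xs) = omit_nth (i - 1) (omit_nth k xs)"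
  using assms by (intro nth_equalityI) (auto simp: nth_omit_nth)

text \<open>The sign argument behind d d = 0: deleting two entries in the opposite order leaves the
  same list, but shifts one of the two positions by one and so changes the parity of
  \<open>i + k\<close>. A kernel \<open>T\<close> that is symmetric in its first two arguments
  therefore contributes zero.\<close>

lemma sum_omit_nth_swap:
  fixes T :: "'b \<Rightarrow> 'b \<Rightarrow> 'b list \<Rightarrow> complex"
  shows "(\<Sum>i<length vs. (-1) ^ i * (\<Sum>k<length vs - 1.
            (-1) ^ k * T (vs ! i) (omit_nth i vs ! k) (omit_nth k (omit_nth i vs)))) =
       - (\<Sum>i<length vs. (-1) ^ i * (\<Sum>k<length vs - 1.
            (-1) ^ k * T (omit_nth i vs ! k) (vs ! i) (omit_nth k (omit_nth i vs))))"
proof -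
  define N where "N = length vs"
  define S where "S = {..<N} \<times> {..<N-1}"
  \<comment> \<open>The involution that exchanges the two orders of deletion. The entry deleted
    second has its position counted in the shortened list, hence \<open>i - 1\<close> in one case
    and \<open>Suc k\<close> in the other.\<close>
  define f where "f = (\<lambda>(i,k). if k < i then (k, i - 1) else (Suc k, i :: nat))"
  have "(\<Sum>(i,k)\<in>S. (-1) ^ i * ((-1) ^ k * T (vs ! i) (omit_nth i vs ! k) (omit_nth k (omit_nth i vs))))
     = (\<Sum>(i,k)\<in>S. - ((-1) ^ i * ((-1) ^ k * T (omit_nth i vs ! k) (vs ! i) (omit_nth k (omit_nth i vs)))))"
  proof (rule sum.reindex_bij_witness[of _ f f])
    fix a assume a: "a \<in> S"
    obtain i k where ik: "a = (i,k)" by force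
    then have l: "i < N" "k < N - 1" using a by (auto simp: S_def)
    show "f (f a) = a" "f (f a) = a" by (auto simp: f_def ik)
    show "f a \<in> S" "f a \<in> S" using l by (auto simp: f_def ik S_def)
    show "(case f a of (i, k) \<Rightarrow> - ((-1) ^ i * ((-1) ^ k * T (omit_nth i vs ! k) (vs ! i) (omit_nth k (omit_nth i vs)))))
       = (case a of (i, k) \<Rightarrow> (-1) ^ i * ((-1) ^ k * T (vs ! i) (omit_nth i vs ! k) (omit_nth k (omit_nth i vs))))"
    proof (cases "k < i")
      case True
      then obtain m where m: "i = Suc m" by (cases i) auto
      have "omit_nth m (omit_nth k vs) = omit_nth k (omit_nth i vs)"
        using omit_nth_omit_nth[of k i vs] True l by (simp add: m N_def)
      then show ?thesis using True l by (simp add: ik f_def m nth_omit_nth N_def)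
    next
      case False
      have "omit_nth i (omit_nth (Suc k) vs) = omit_nth k (omit_nth i vs)"
        using omit_nth_omit_nth[of i "Suc k" vs] False l by (simp add: N_def)
      then show ?thesis using False l by (simp add: ik f_def nth_omit_nth N_def)
    qed
  qed
  then show ?thesis
    by (simp add: S_def sum.cartesian_product[symmetric] sum_distrib_left sum_negf N_def)
qed

lemma dz_wedge_eq_det:
  fixes vs :: "(complex^'n::finite) list"
  assumes "length I = k" "length vs = k"
  shows "dz_wedge I [] vs = Determinant.det (mat k k (\<lambda>(a,b). vs ! b $ (I ! a)))"
proof -
  have "(\<Prod>a<k. (map (\<lambda>i v. v $ i) I ! a) (vs ! \<sigma> a)) =
     (\<Prod>a = 0..<k. mat k k (\<lambda>(a,b). vs ! b $ (I ! a)) $$ (a, \<sigma> a))"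
    if "\<sigma> permutes {..<k}" for \<sigma>
    unfolding atLeast0LessThan
    by (rule prod.cong) (use that assms permutes_in_image[OF that] in auto)
  then show ?thesis
    using assms by (simp add: dz_wedge_def det_def'[of _ k] lessThan_atLeast0)
qed

lemma dz_wedge_length: "length vs \<noteq> length I + length J \<Longrightarrow> dz_wedge I J vs = 0"
  by (simp add: dz_wedge_def)

lemma dz_wedge_Nil: "dz_wedge [] [] vs = (if vs = [] then 1 else 0)"
  by (cases vs) (auto simp: dz_wedge_def)

text \<open>Laplace expansion along the row of \<open>j\<close>. It opens \<open>dz_wedge\<close> to
  induction on the index list, and it has the shape of the formula for the exterior
  derivative.\<close>

lemma dz_wedge_Cons:
  fixes vs :: "(complex^'n::finite) list"
  shows "dz_wedge (j # I) [] vs =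
    (\<Sum>i<length vs. (-1) ^ i * (vs ! i $ j * dz_wedge I [] (omit_nth i vs)))"
proof (cases "length vs = Suc (length I)")
  case True
  define k where "k = length I"
  define M where "M = mat (Suc k) (Suc k) (\<lambda>(a,b). vs ! b $ ((j # I) ! a))"
  have "dz_wedge (j # I) [] vs = Determinant.det M"
    unfolding M_def by (rule dz_wedge_eq_det) (use True k_def in auto)
  also have "\<dots> = (\<Sum>i<Suc k. M $$ (0,i) * cofactor M 0 i)"
    by (rule laplace_expansion_row) (auto simp: M_def)
  also have "\<dots> = (\<Sum>i<Suc k. (-1) ^ i * (vs ! i $ j * dz_wedge I [] (omit_nth i vs)))"
  proof (rule sum.cong[OF refl])
    fix i assume i: "i \<in> {..<Suc k}"
    have "mat_delete M 0 i = mat k k (\<lambda>(a,b). omit_nth i vs ! b $ (I ! a))"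
      by (rule eq_matI) (use i True in \<open>auto simp: mat_delete_def M_def nth_omit_nth k_def\<close>)
    then have "cofactor M 0 i = (-1) ^ i * dz_wedge I [] (omit_nth i vs)"
      using i True by (simp add: cofactor_def dz_wedge_eq_det k_def)
    then show "M $$ (0,i) * cofactor M 0 i = (-1) ^ i * (vs ! i $ j * dz_wedge I [] (omit_nth i vs))"
      using i by (simp add: M_def)
  qed
  finally show ?thesis using True by (simp add: k_def)
next
  case False
  then show ?thesis by (auto simp: dz_wedge_length intro!: sum.neutral[symmetric])
qed

section \<open>Complex multilinear functions of lists of vectors\<close>

definition clinear :: "(complex^'n::finite \<Rightarrow> complex) \<Rightarrow> bool" where
  "clinear L \<longleftrightarrow> (\<forall>v w. L (v + w) = L v + L w) \<and> (\<forall>c v. L (c *s v) = c * L v)"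

text \<open>Splitting the list as \<open>xs @ v # ys\<close> addresses every slot without fixing a
  length, which suits functions that vanish on lists of the wrong length.\<close>

definition multilinear :: "((complex^'n::finite) list \<Rightarrow> complex) \<Rightarrow> bool" where
  "multilinear g \<longleftrightarrow> (\<forall>xs ys. clinear (\<lambda>v. g (xs @ v # ys)))"

lemma multilinear_iff:
  "multilinear g \<longleftrightarrow> (\<forall>xs ys v w. g (xs @ (v + w) # ys) = g (xs @ v # ys) + g (xs @ w # ys)) \<and>
     (\<forall>xs ys c v. g (xs @ (c *s v) # ys) = c * g (xs @ v # ys))"
  by (auto simp: multilinear_def clinear_def)

lemma omit_nth_append_Cons:
  "omit_nth i (xs @ v # ys) =
     (if i < length xs then omit_nth i xs @ v # ys
      else if i = length xs then xs @ ys
      else xs @ v # omit_nth (i - Suc (length xs)) ys)"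
  by (auto simp: omit_nth_def Suc_diff_le Suc_diff_Suc numeral_2_eq_2[symmetric] take_Cons' drop_Cons'
     not_less_iff_gr_or_eq)

lemma nth_append_Cons_eq:
  "(xs @ v # ys) ! i = (if i < length xs then xs ! i else if i = length xs then v
      else ys ! (i - Suc (length xs)))"
  by (auto simp: nth_append nth_Cons')

lemma multilinear_dz_wedge: "multilinear (dz_wedge I [])"
proof (induction I)
  case Nil
  show ?case by (auto simp: multilinear_iff dz_wedge_Nil)
next
  case (Cons j I)
  have *: "dz_wedge I [] (xs @ (v + w) # ys) = dz_wedge I [] (xs @ v # ys) + dz_wedge I [] (xs @ w # ys)"
    "dz_wedge I [] (xs @ (c *s v) # ys) = c * dz_wedge I [] (xs @ v # ys)" for xs ys v w c
    using Cons.IH unfolding multilinear_iff by blast+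
  show ?case
    unfolding multilinear_iff dz_wedge_Cons
    by (auto simp: omit_nth_append_Cons nth_append_Cons_eq * algebra_simps sum.distrib[symmetric]
        sum_distrib_left intro!: sum.cong)
qed

lemma sum_lists_Suc:
  fixes F :: "'n::finite list \<Rightarrow> complex"
  shows "(\<Sum>I | length I = Suc k. F I) = (\<Sum>j\<in>UNIV. \<Sum>I | length I = k. F (j # I))"
proof -
  have "(\<Sum>(j,I)\<in>UNIV \<times> {I. length I = k}. F (j # I)) = (\<Sum>I | length I = Suc k. F I)"
    by (rule sum.reindex_bij_witness[of _ "\<lambda>I. (hd I, tl I)" "\<lambda>(j,I). j # I"])
       (auto simp: length_Suc_conv)
  then show ?thesis by (simp add: sum.cartesian_product)
qed

lemma clinear_sum:
  assumes "clinear L"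
  shows "L (\<Sum>j\<in>S. f j) = (\<Sum>j\<in>S. L (f j))"
proof (induction S rule: infinite_finite_induct)
  case (insert x F)
  then show ?case using assms by (simp add: clinear_def)
next
  case empty
  have "L (0 *s 0) = 0 * L 0" using assms unfolding clinear_def by blast
  then show ?case by simp
next
  case (infinite A)
  have "L (0 *s 0) = 0 * L 0" using assms unfolding clinear_def by blast
  then show ?case using infinite by simp
qed

lemma clinear_sum_axis:
  assumes "clinear L"
  shows "L v = (\<Sum>j\<in>UNIV. v $ j * L (axis j 1))"
proof -
  have "L v = L (\<Sum>j\<in>UNIV. v $ j *s axis j 1)" by (simp add: basis_expansion)
  also have "\<dots> = (\<Sum>j\<in>UNIV. v $ j * L (axis j 1))"
    using assms by (simp add: clinear_sum clinear_def)
  finally show ?thesis .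
qed

text \<open>The prefix \<open>xs\<close> collects the slots that already hold basis vectors; it must
  be arbitrary for the induction on \<open>us\<close>.\<close>

lemma multilinear_expansion:
  assumes "multilinear g"
  shows "g (xs @ us) = (\<Sum>I | length I = length us.
           (\<Prod>b<length us. us ! b $ (I ! b)) * g (xs @ map (\<lambda>i. axis i 1) I))"
proof (induction us arbitrary: xs)
  case Nil
  then show ?case by simp
next
  case (Cons u us)
  have "g (xs @ u # us) = (\<Sum>j\<in>UNIV. u $ j * g ((xs @ [axis j 1]) @ us))"
    using clinear_sum_axis[of "\<lambda>v. g (xs @ v # us)" u] assms by (simp add: multilinear_def)
  also have "\<dots> = (\<Sum>j\<in>UNIV. \<Sum>I | length I = length us. u $ j *
      ((\<Prod>b<length us. us ! b $ (I ! b)) * g (xs @ axis j 1 # map (\<lambda>i. axis i 1) I)))"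
    unfolding Cons.IH[of "xs @ [axis _ 1]"] sum_distrib_left by simp
  also have "\<dots> = (\<Sum>I | length I = length (u # us).
       (\<Prod>b<length (u # us). (u # us) ! b $ (I ! b)) * g (xs @ map (\<lambda>i. axis i 1) I))"
    by (simp add: sum_lists_Suc prod.lessThan_Suc_shift mult.assoc del: prod.lessThan_Suc)
  finally show ?case .
qed

text \<open>The vectors index the columns of the matrix, so \<sigma> permutes columns; the transpose
  turns this into a permutation of rows.\<close>

lemma dz_wedge_permute:
  fixes vs :: "(complex^'n::finite) list"
  assumes "length I = k" "length vs = k" "\<sigma> permutes {..<k}"
  shows "dz_wedge I [] (map (\<lambda>a. vs ! \<sigma> a) [0..<k]) = of_int (sign \<sigma>) * dz_wedge I [] vs"
proof -
  define M where "M = mat k k (\<lambda>(a,b). vs ! b $ (I ! a))"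
  have M: "M \<in> carrier_mat k k" "M\<^sup>T \<in> carrier_mat k k" by (auto simp: M_def)
  have \<sigma>: "\<sigma> a < k" if "a < k" for a using permutes_in_image[OF assms(3)] that by auto
  have "dz_wedge I [] (map (\<lambda>a. vs ! \<sigma> a) [0..<k])
      = Determinant.det (mat k k (\<lambda>(a,b). map (\<lambda>a. vs ! \<sigma> a) [0..<k] ! b $ (I ! a)))"
    by (rule dz_wedge_eq_det) (use assms in auto)
  also have "mat k k (\<lambda>(a,b). map (\<lambda>a. vs ! \<sigma> a) [0..<k] ! b $ (I ! a))
      = (mat k k (\<lambda>(i,j). M\<^sup>T $$ (\<sigma> i, j)))\<^sup>T"
    by (rule eq_matI) (auto simp: M_def \<sigma>)
  also have "Determinant.det \<dots> = Determinant.det (mat k k (\<lambda>(i,j). M\<^sup>T $$ (\<sigma> i, j)))"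
    by (rule det_transpose) auto
  also have "\<dots> = of_int (sign \<sigma>) * Determinant.det (M\<^sup>T)"
    by (rule det_permute_rows[OF M(2)]) (use assms in \<open>simp add: lessThan_atLeast0\<close>)
  also have "Determinant.det (M\<^sup>T) = dz_wedge I [] vs"
    using assms det_transpose[OF M(1)] by (simp add: dz_wedge_eq_det M_def)
  finally show ?thesis .
qed

text \<open>For \<open>q = 0\<close> only the empty list is left for \<open>J\<close>, so there is
  one coefficient per \<open>I\<close>. Unordered and repeating lists \<open>I\<close> are included,
  so the coefficients are in general not unique.\<close>

definition p0_covector :: "nat \<Rightarrow> ((complex^'n::finite) list \<Rightarrow> complex) \<Rightarrow> bool" where
  "p0_covector p g \<longleftrightarrow> (\<exists>a. \<forall>vs. g vs = (\<Sum>I | length I = p. a I * dz_wedge I [] vs))"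

lemma p0_covector_iff: "g \<in> pq_covectors p 0 \<longleftrightarrow> p0_covector p g"
proof -
  have *: "{J :: 'a list. J = []} = {[]}" by auto
  show ?thesis
    unfolding pq_covectors_def p0_covector_def
    by (auto simp: * fun_eq_iff intro: exI[of _ "\<lambda>I J. _ I"])
qed

lemma p0_covector_multilinear:
  assumes "p0_covector p g"
  shows "multilinear g"
proof -
  obtain a where a: "\<And>vs. g vs = (\<Sum>I | length I = p. a I * dz_wedge I [] vs)"
    using assms by (auto simp: p0_covector_def)
  have *: "dz_wedge I [] (xs @ (v + w) # ys) = dz_wedge I [] (xs @ v # ys) + dz_wedge I [] (xs @ w # ys)"
    "dz_wedge I [] (xs @ (c *s v) # ys) = c * dz_wedge I [] (xs @ v # ys)" for I :: "'a list" and xs ys v w c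
    using multilinear_dz_wedge[of I] unfolding multilinear_iff by blast+
  show ?thesis
    unfolding multilinear_iff a
    by (auto simp: * algebra_simps sum.distrib[symmetric] sum_distrib_left intro!: sum.cong)
qed

lemma p0_covector_length: "p0_covector p g \<Longrightarrow> length vs \<noteq> p \<Longrightarrow> g vs = 0"
  by (auto simp: p0_covector_def dz_wedge_length intro!: sum.neutral)

text \<open>A canonical choice of coefficients: being values of \<open>g\<close> on fixed vectors,
  they inherit the regularity of a form in its base point. After expanding the determinants, each
  permutation yields its sign times \<open>g\<close> on the permuted vectors, that is
  \<open>g vs\<close> again; the number of permutations is the factor \<open>fact p\<close>.\<close>

lemma p0_covector_coeffs:
  fixes g :: "(complex^'n::finite) list \<Rightarrow> complex"
  assumes "p0_covector p g"
  shows "g vs = (\<Sum>I | length I = p. (g (map (\<lambda>i. axis i 1) I) / fact p) * dz_wedge I [] vs)"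
proof (cases "length vs = p")
  case False
  then show ?thesis by (simp add: p0_covector_length[OF assms] dz_wedge_length)
next
  case True
  let ?e = "\<lambda>I. map (\<lambda>i. axis i 1) I :: (complex^'n) list"
  have perm: "g (map (\<lambda>a. vs ! \<sigma> a) [0..<p]) = of_int (sign \<sigma>) * g vs" if "\<sigma> permutes {..<p}" for \<sigma>
    using assms that True by (auto simp: p0_covector_def dz_wedge_permute sum_distrib_left intro!: sum.cong)
  have sg: "of_int (sign \<sigma>) * (of_int (sign \<sigma>) * z) = (z :: complex)" for \<sigma> :: "nat \<Rightarrow> nat" and z
    by (auto simp: sign_def)
  have "(\<Sum>I | length I = p. g (?e I) * dz_wedge I [] vs)
     = (\<Sum>I | length I = p. \<Sum>\<sigma> | \<sigma> permutes {..<p}. of_int (sign \<sigma>) *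
         ((\<Prod>a<p. vs ! \<sigma> a $ (I ! a)) * g (?e I)))"
    using True by (auto simp: dz_wedge_def sum_distrib_left intro!: sum.cong)
  also have "\<dots> = (\<Sum>\<sigma> | \<sigma> permutes {..<p}. of_int (sign \<sigma>) *
      (\<Sum>I | length I = p. (\<Prod>a<p. vs ! \<sigma> a $ (I ! a)) * g (?e I)))"
    by (subst sum.swap) (simp add: sum_distrib_left)
  also have "\<dots> = (\<Sum>\<sigma> | \<sigma> permutes {..<p}. of_int (sign \<sigma>) * g (map (\<lambda>a. vs ! \<sigma> a) [0..<p]))"
    using multilinear_expansion[OF p0_covector_multilinear[OF assms], of "[]" "map (\<lambda>a. vs ! _ a) [0..<p]"]
    by (auto intro!: sum.cong)
  also have "\<dots> = (\<Sum>\<sigma> | \<sigma> permutes {..<p}. g vs)"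
    by (rule sum.cong) (auto simp: perm sg)
  also have "\<dots> = fact p * g vs"
    using card_permutations[of "{..<p}" p] by simp
  finally show ?thesis
    by (simp add: sum_divide_distrib[symmetric])
qed

text \<open>The antisymmetrisation common to the two forms of degree \<open>Suc p\<close> in the
  proof: \<open>b I\<close> is the differential of a coefficient for the exterior derivative, and a
  multiple of \<open>partial_fun\<close> for the wedge with a cut-off. Expanding \<open>b I\<close>
  in coordinates prepends an index to \<open>I\<close> through \<open>dz_wedge_Cons\<close>.\<close>

lemma p0_covector_wedge:
  fixes G :: "complex^'n::finite \<Rightarrow> (complex^'n) list \<Rightarrow> complex"
  assumes "\<And>v us. G v us = (\<Sum>I | length I = p. b I v * dz_wedge I [] us)"
    and "\<And>I. length I = p \<Longrightarrow> clinear (b I)"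
  shows "p0_covector (Suc p) (\<lambda>vs. \<Sum>i<length vs. (-1) ^ i * G (vs ! i) (omit_nth i vs))"
proof -
  have "(\<Sum>i<length vs. (-1) ^ i * G (vs ! i) (omit_nth i vs)) =
    (\<Sum>K | length K = Suc p. b (tl K) (axis (hd K) 1) * dz_wedge K [] vs)" for vs
  proof -
    have "(\<Sum>i<length vs. (-1) ^ i * G (vs ! i) (omit_nth i vs)) =
      (\<Sum>i<length vs. \<Sum>I | length I = p. \<Sum>j\<in>UNIV. b I (axis j 1) * ((-1) ^ i * (vs ! i $ j * dz_wedge I [] (omit_nth i vs))))"
      unfolding assms(1) sum_distrib_left
      by (intro sum.cong refl, subst clinear_sum_axis[OF assms(2)])
         (auto simp: sum_distrib_left sum_distrib_right mult_ac)
    also have "\<dots> = (\<Sum>j\<in>UNIV. \<Sum>I | length I = p. b I (axis j 1) * dz_wedge (j # I) [] vs)"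
      unfolding dz_wedge_Cons sum_distrib_left
      by (subst sum.swap, subst (2) sum.swap, subst sum.swap) (rule refl)
    finally show ?thesis by (simp add: sum_lists_Suc)
  qed
  then show ?thesis
    unfolding p0_covector_def by (intro exI[of _ "\<lambda>K. b (tl K) (axis (hd K) 1)"] allI)
qed

section \<open>Top degree: determinants with respect to a fixed ordered basis\<close>

definition index_list :: "'n::finite list" where
  "index_list = (SOME xs. distinct xs \<and> set xs = UNIV)"

lemma index_list: "distinct (index_list :: 'n list)" "set index_list = (UNIV :: 'n::finite set)"
proof -
  have "\<exists>xs. distinct xs \<and> set xs = (UNIV :: 'n set)"
    using finite_distinct_list[of "UNIV :: 'n set"] by auto
  from someI_ex[OF this] show "distinct (index_list :: 'n list)" "set index_list = (UNIV :: 'n set)"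
    unfolding index_list_def by auto
qed

lemma length_index_list [simp]: "length (index_list :: 'n::finite list) = CARD('n)"
  using distinct_card[OF index_list(1)[where 'n='n]] index_list(2)[where 'n='n] by simp

definition basis_list :: "(complex^'n::finite) list" where
  basis_list_eq: "basis_list = map (\<lambda>i. axis i 1) index_list"

lemma length_basis_list [simp]: "length (basis_list :: (complex^'n::finite) list) = CARD('n)"
  by (simp add: basis_list_eq)

lemma sum_index_list: "(\<Sum>j\<in>UNIV. F j) = (\<Sum>a<CARD('n). F (index_list ! a))"
  for F :: "'n::finite \<Rightarrow> 'b::comm_monoid_add"
  using sum.distinct_set_conv_list[OF index_list(1)[where 'n='n], of F]
  by (simp add: index_list(2) sum_list_sum_nth lessThan_atLeast0)

definition cdet :: "(complex^'n::finite \<Rightarrow> complex^'n) \<Rightarrow> complex" where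
  "cdet L = Determinant.det (mat CARD('n) CARD('n) (\<lambda>(a,b). L (axis (index_list ! b) 1) $ (index_list ! a)))"

text \<open>The matrix of values on \<open>map L basis_list\<close> is a product whose second factor
  is the matrix of \<open>L\<close>. Here \<open>L\<close> ranges over all maps: besides Jacobians
  it will be a map that merely sends the basis vectors to prescribed vectors.\<close>

lemma top_covector_scale:
  fixes g :: "(complex^'n::finite) list \<Rightarrow> complex"
  assumes "p0_covector CARD('n) g"
  shows "g (map L basis_list) = cdet L * g basis_list"
proof -
  have "dz_wedge K [] (map L basis_list) = cdet L * dz_wedge K [] basis_list" if "length K = CARD('n)" for K
  proof -
    define n where "n = CARD('n)"
    define M where "M = mat n n (\<lambda>(a,b). (basis_list :: (complex^'n) list) ! b $ (K ! a))"
    define N where "N = mat n n (\<lambda>(a,b). L (axis (index_list ! b) 1) $ (index_list ! a))"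
    have "dz_wedge K [] (map L basis_list) = Determinant.det (mat n n (\<lambda>(a,b). map L basis_list ! b $ (K ! a)))"
      by (rule dz_wedge_eq_det) (use that n_def in auto)
    also have "mat n n (\<lambda>(a,b). map L basis_list ! b $ (K ! a)) = M * N"
    proof (rule eq_matI)
      fix a b assume ab: "a < dim_row (M * N)" "b < dim_col (M * N)"
      then have l: "a < n" "b < n" by (auto simp: M_def N_def)
      define w where "w = L (axis (index_list ! b) 1)"
      have "(M * N) $$ (a,b) = (\<Sum>i<n. axis (index_list ! i) 1 $ (K ! a) * w $ (index_list ! i))"
        using l by (simp add: M_def N_def scalar_prod_def basis_list_eq n_def w_def lessThan_atLeast0)
      also have "\<dots> = (\<Sum>j\<in>UNIV. axis j 1 $ (K ! a) * w $ j)"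
        unfolding sum_index_list n_def by simp
      also have "\<dots> = w $ (K ! a)"
        by (simp add: axis_def if_distrib[of "\<lambda>x. x * _"] cong: if_cong)
      finally show "mat n n (\<lambda>(a,b). map L basis_list ! b $ (K ! a)) $$ (a,b) = (M * N) $$ (a,b)"
        using l by (simp add: w_def basis_list_eq n_def)
    qed (auto simp: M_def N_def)
    also have "Determinant.det (M * N) = Determinant.det M * Determinant.det N"
      by (rule det_mult[of _ n]) (auto simp: M_def N_def)
    also have "Determinant.det M = dz_wedge K [] basis_list"
      unfolding M_def by (rule dz_wedge_eq_det[symmetric]) (use that n_def in auto)
    finally show ?thesis by (simp add: cdet_def N_def n_def mult.commute)
  qed
  then show ?thesis
    using assms by (auto simp: p0_covector_def sum_distrib_left intro!: sum.cong)
qed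

section \<open>Holomorphic functions of several variables\<close>

definition hol_on :: "(complex^'n::finite) set \<Rightarrow> (complex^'n \<Rightarrow> complex) \<Rightarrow> bool" where
  "hol_on S f \<longleftrightarrow> (\<forall>x\<in>S. \<exists>D. (f has_derivative D) (at x) \<and> (\<forall>c v. D (c *s v) = c * D v))"

lemma norm_cmult: "norm (c *s v) = norm c * norm (v :: complex^'n::finite)"
proof -
  have "norm (c *s v) = L2_set (\<lambda>i. norm c * norm (v $ i)) UNIV"
    by (simp add: norm_vec_def norm_mult)
  also have "\<dots> = norm c * L2_set (\<lambda>i. norm (v $ i)) UNIV"
    by (simp add: L2_set_right_distrib)
  finally show ?thesis by (simp add: norm_vec_def)
qed

lemma bounded_linear_cmult: "bounded_linear (\<lambda>c. c *s (v :: complex^'n::finite))"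
proof (rule bounded_linear_intro[where K="norm v"])
  show "(x + y) *s v = x *s v + y *s v" for x y by (simp add: Finite_Cartesian_Product.vec_eq_iff distrib_right)
  show "(r *\<^sub>R x) *s v = r *\<^sub>R (x *s v)" for r x by (simp add: Finite_Cartesian_Product.vec_eq_iff)
qed (simp add: norm_cmult)

lemmas has_derivative_cmult [derivative_intros] = bounded_linear.has_derivative[OF bounded_linear_cmult]
lemmas continuous_on_cmult [continuous_intros] = bounded_linear.continuous_on[OF bounded_linear_cmult]

lemma hol_onD:
  assumes "hol_on S f" "x \<in> S"
  shows "(f has_derivative frechet_derivative f (at x)) (at x)"
    and "frechet_derivative f (at x) (c *s v) = c * frechet_derivative f (at x) v"
proof -
  obtain D where D: "(f has_derivative D) (at x)" "\<And>c v. D (c *s v) = c * D v"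
    using assms by (auto simp: hol_on_def)
  then show "(f has_derivative frechet_derivative f (at x)) (at x)"
    "frechet_derivative f (at x) (c *s v) = c * frechet_derivative f (at x) v"
    using frechet_derivative_at[OF D(1)] by auto
qed

text \<open>The gateway to one variable: the regularity of holomorphic functions below is deduced on
  complex lines.\<close>

lemma hol_on_line:
  assumes "hol_on S f" "z + \<zeta> *s u \<in> S"
  shows "((\<lambda>\<zeta>. f (z + \<zeta> *s u)) has_field_derivative frechet_derivative f (at (z + \<zeta> *s u)) u) (at \<zeta>)"
proof -
  have "((\<lambda>\<zeta>. z + \<zeta> *s u) has_derivative (\<lambda>h. h *s u)) (at \<zeta>)"
    by (auto intro!: derivative_eq_intros)
  from has_derivative_compose[OF this hol_onD(1)[OF assms]]
  have "((\<lambda>\<zeta>. f (z + \<zeta> *s u)) has_derivative (\<lambda>h. frechet_derivative f (at (z + \<zeta> *s u)) (h *s u))) (at \<zeta>)" .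
  then show ?thesis
    unfolding has_field_derivative_def
    by (rule has_derivative_eq_rhs) (simp add: hol_onD(2)[OF assms] fun_eq_iff mult.commute)
qed

lemma hol_on_continuous_on: "hol_on S f \<Longrightarrow> continuous_on S f"
  by (meson continuous_at_imp_continuous_on has_derivative_continuous hol_onD(1))

lemma line_radius:
  fixes z u :: "complex^'n::finite"
  assumes "e > 0"
  obtains r where "r > 0" "\<And>\<zeta>. norm \<zeta> \<le> r \<Longrightarrow> norm (\<zeta> *s u) \<le> e"
proof -
  have "norm \<zeta> * norm u \<le> e" if "norm \<zeta> \<le> e / (1 + norm u)" for \<zeta> :: complex
  proof -
    have "norm \<zeta> * norm u \<le> e / (1 + norm u) * (1 + norm u)"
      using that assms by (intro mult_mono) auto
    also have "\<dots> = e" using norm_ge_zero[of u] by (metis add.commute add_nonneg_eq_0_iff nonzero_eq_divide_eq zero_le_one zero_neq_one)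
    finally show ?thesis .
  qed
  then show ?thesis
    using assms by (intro that[of "e / (1 + norm u)"]) (auto simp: norm_cmult add_pos_nonneg)
qed

text \<open>Cauchy's estimate on a circle in the complex line of direction \<open>v\<close>: the
  derivative of \<open>F\<close> at 0 is the difference to be bounded, and \<open>F\<close> is
  uniformly small once \<open>w\<close> is close to \<open>z\<close>.\<close>

lemma hol_on_derivative_continuous:
  fixes f :: "complex^'n::finite \<Rightarrow> complex"
  assumes "open S" "hol_on S f"
  shows "continuous_on S (\<lambda>z. frechet_derivative f (at z) v)"
  unfolding continuous_on_iff
proof (intro ballI allI impI)
  fix z and e :: real assume z: "z \<in> S" and e: "e > 0"
  obtain \<epsilon> where \<epsilon>: "\<epsilon> > 0" "cball z \<epsilon> \<subseteq> S" using assms(1) z open_contains_cball by blast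
  obtain r where r: "r > 0" "\<And>\<zeta>. norm \<zeta> \<le> r \<Longrightarrow> norm (\<zeta> *s v) \<le> \<epsilon> / 2"
    using line_radius[of "\<epsilon> / 2" v] \<epsilon> by auto
  have "uniformly_continuous_on (cball z \<epsilon>) f"
    using \<epsilon> assms(2) by (intro compact_uniformly_continuous continuous_on_subset[OF hol_on_continuous_on]) auto
  \<comment> \<open>The factor \<open>r\<close> is the radius by which Cauchy's inequality divides;
    what remains is \<open>e / 2\<close>.\<close>
  then obtain d where d: "d > 0"
    "\<And>x y. x \<in> cball z \<epsilon> \<Longrightarrow> y \<in> cball z \<epsilon> \<Longrightarrow> dist y x < d \<Longrightarrow> dist (f y) (f x) < e * r / 2"
    unfolding uniformly_continuous_on_def using e r by (metis mult_pos_pos half_gt_zero)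
  have "dist (frechet_derivative f (at w) v) (frechet_derivative f (at z) v) < e"
    if w: "w \<in> S" "dist w z < min d (\<epsilon> / 2)" for w
  proof -
    have in1: "w + \<zeta> *s v \<in> cball z \<epsilon>" "z + \<zeta> *s v \<in> cball z \<epsilon>" if "norm \<zeta> \<le> r" for \<zeta>
    proof -
      have "norm (w - z) < \<epsilon> / 2" using w by (auto simp: dist_norm)
      then have "norm ((w - z) + \<zeta> *s v) \<le> \<epsilon>"
        using norm_triangle_ineq[of "w - z" "\<zeta> *s v"] r(2)[OF that] by linarith
      then show "w + \<zeta> *s v \<in> cball z \<epsilon>"
        by (simp add: dist_norm norm_minus_commute[of z] algebra_simps)
      show "z + \<zeta> *s v \<in> cball z \<epsilon>"
        using r(2)[OF that] \<epsilon> by (simp add: dist_norm)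
    qed
    define F where "F = (\<lambda>\<zeta>. f (w + \<zeta> *s v) - f (z + \<zeta> *s v))"
    have dF: "(F has_field_derivative (frechet_derivative f (at (w + \<zeta> *s v)) v
        - frechet_derivative f (at (z + \<zeta> *s v)) v)) (at \<zeta>)" if "norm \<zeta> \<le> r" for \<zeta>
      unfolding F_def
      by (intro DERIV_diff hol_on_line[OF assms(2)]) (use in1[OF that] \<epsilon> in auto)
    have "norm ((deriv ^^ 1) F 0) \<le> fact 1 * (e * r / 2) / r ^ 1"
    proof (rule Cauchy_inequality)
      show "F holomorphic_on ball 0 r"
        unfolding holomorphic_on_open[OF open_ball]
      proof (intro ballI)
        fix \<zeta> :: complex assume "\<zeta> \<in> ball 0 r"
        then have "norm \<zeta> \<le> r" by simp
        from dF[OF this] show "\<exists>f'. (F has_field_derivative f') (at \<zeta>)" by blast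
      qed
      show "continuous_on (cball 0 r) F"
        using dF by (auto intro!: continuous_at_imp_continuous_on DERIV_isCont simp: dist_norm)
      show "norm (F x) \<le> e * r / 2" if "norm (0 - x) = r" for x
        using d(2)[of "z + x *s v" "w + x *s v"] in1[of x] that w
        by (auto simp: F_def dist_norm)
    qed (fact r)
    moreover have "deriv F 0 = frechet_derivative f (at w) v - frechet_derivative f (at z) v"
      using DERIV_imp_deriv[OF dF[of 0]] r by simp
    ultimately have "norm (frechet_derivative f (at w) v - frechet_derivative f (at z) v) \<le> e / 2"
      using r by simp
    then show ?thesis using e by (simp add: dist_norm)
  qed
  then show "\<exists>d>0. \<forall>w\<in>S. dist w z < d \<longrightarrow>
      dist (frechet_derivative f (at w) v) (frechet_derivative f (at z) v) < e"
    using d \<epsilon> by (intro exI[of _ "min d (\<epsilon> / 2)"]) auto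
qed

text \<open>Yields second derivatives and prepares their symmetry. The difference quotients
  \<open>F n\<close> in direction \<open>v\<close> are holomorphic along the line of direction
  \<open>u\<close> and converge uniformly to the derivative in direction \<open>v\<close>, so their
  derivatives converge too (Weierstrass). At 0 the latter are difference quotients for the mixed
  derivative in the opposite order.\<close>

lemma hol_on_derivative_line_limit:
  fixes f :: "complex^'n::finite \<Rightarrow> complex"
  assumes "open S" "hol_on S f" "z \<in> S"
  obtains s :: "nat \<Rightarrow> complex" and H where "\<And>n. s n \<noteq> 0" "s \<longlonglongrightarrow> 0"
    "((\<lambda>\<zeta>. frechet_derivative f (at (z + \<zeta> *s u)) v) has_field_derivative H) (at 0)"
    "(\<lambda>n. (frechet_derivative f (at (z + s n *s v)) u - frechet_derivative f (at z) u) / s n) \<longlonglongrightarrow> H"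
proof -
  let ?D = "\<lambda>z v. frechet_derivative f (at z) v"
  obtain \<epsilon> where \<epsilon>: "\<epsilon> > 0" "cball z \<epsilon> \<subseteq> S" using assms(1,3) open_contains_cball by blast
  obtain r where r: "r > 0" "\<And>\<zeta>. norm \<zeta> \<le> r \<Longrightarrow> norm (\<zeta> *s u) \<le> \<epsilon> / 2"
    using line_radius[of "\<epsilon> / 2" u] \<epsilon> by auto
  obtain q where q: "q > 0" "\<And>\<zeta>. norm \<zeta> \<le> q \<Longrightarrow> norm (\<zeta> *s v) \<le> \<epsilon> / 2"
    using line_radius[of "\<epsilon> / 2" v] \<epsilon> by auto
  have inS: "z + \<zeta> *s u + \<xi> *s v \<in> cball z \<epsilon>" if "norm \<zeta> \<le> r" "norm \<xi> \<le> q" for \<zeta> \<xi>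
  proof -
    have "norm (\<zeta> *s u + \<xi> *s v) \<le> \<epsilon>"
      using norm_triangle_ineq[of "\<zeta> *s u" "\<xi> *s v"] r(2)[OF that(1)] q(2)[OF that(2)] by linarith
    moreover have "z + \<zeta> *s u + \<xi> *s v - z = \<zeta> *s u + \<xi> *s v" by simp
    ultimately show ?thesis by (metis dist_commute dist_norm mem_cball)
  qed
  have inS0: "z + \<zeta> *s u \<in> cball z \<epsilon>" if "norm \<zeta> \<le> r" for \<zeta>
    using inS[OF that, of 0] q by simp
  define s :: "nat \<Rightarrow> complex" where "s = (\<lambda>n. of_real (q / (real n + 1)))"
  have s0: "s n \<noteq> 0" and sq: "norm (s n) \<le> q" for n
  proof -
    show "s n \<noteq> 0" using q unfolding s_def of_real_eq_0_iff by auto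
    have "\<bar>q / (real n + 1)\<bar> \<le> q" using q by (simp add: divide_le_eq mult_le_cancel_left1)
    then show "norm (s n) \<le> q" unfolding s_def norm_of_real .
  qed
  have slim: "s \<longlonglongrightarrow> 0"
  proof -
    have "(\<lambda>n. q * (1 / real (Suc n))) \<longlonglongrightarrow> q * 0"
      by (intro tendsto_mult tendsto_const LIMSEQ_Suc lim_1_over_n)
    then have "(\<lambda>n. q / (real n + 1)) \<longlonglongrightarrow> 0" by (simp add: add.commute)
    then have "(\<lambda>n. complex_of_real (q / (real n + 1))) \<longlonglongrightarrow> complex_of_real 0"
      by (rule tendsto_of_real)
    then show ?thesis by (simp only: s_def of_real_0)
  qed
  define F where "F = (\<lambda>n \<zeta>. (f (z + \<zeta> *s u + s n *s v) - f (z + \<zeta> *s u)) / s n)"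
  define F' where "F' = (\<lambda>n \<zeta>. (?D (z + \<zeta> *s u + s n *s v) u - ?D (z + \<zeta> *s u) u) / s n)"
  have dF: "(F n has_field_derivative F' n \<zeta>) (at \<zeta>)" if "\<zeta> \<in> ball 0 r" for n \<zeta>
  proof -
    have "((\<lambda>\<zeta>. f ((z + s n *s v) + \<zeta> *s u)) has_field_derivative ?D ((z + s n *s v) + \<zeta> *s u) u) (at \<zeta>)"
      by (rule hol_on_line[OF assms(2)]) (use inS[of \<zeta> "s n"] that sq \<epsilon> in \<open>auto simp: algebra_simps\<close>)
    moreover have "((\<lambda>\<zeta>. f (z + \<zeta> *s u)) has_field_derivative ?D (z + \<zeta> *s u) u) (at \<zeta>)"
      by (rule hol_on_line[OF assms(2)]) (use inS0[of \<zeta>] that \<epsilon> in auto)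
    ultimately show ?thesis
      unfolding F_def F'_def by (intro DERIV_cdivide DERIV_diff) (simp_all add: add_ac)
  qed
  have cont: "continuous_on (cball z \<epsilon>) (\<lambda>z. ?D z v)"
    using hol_on_derivative_continuous[OF assms(1,2)] \<epsilon>(2) continuous_on_subset by blast
  have unif: "uniform_limit (ball 0 r) F (\<lambda>\<zeta>. ?D (z + \<zeta> *s u) v) sequentially"
  proof (rule uniform_limitI)
    fix e :: real assume e: "e > 0"
    have "uniformly_continuous_on (cball z \<epsilon>) (\<lambda>z. ?D z v)"
      using cont by (intro compact_uniformly_continuous) auto
    then obtain d where d: "d > 0"
      "\<And>x y. x \<in> cball z \<epsilon> \<Longrightarrow> y \<in> cball z \<epsilon> \<Longrightarrow> dist y x < d \<Longrightarrow> dist (?D y v) (?D x v) < e / 2"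
      unfolding uniformly_continuous_on_def using e by (metis half_gt_zero)
    obtain \<delta> where \<delta>: "\<delta> > 0" "\<And>\<zeta>. norm \<zeta> \<le> \<delta> \<Longrightarrow> norm (\<zeta> *s v) \<le> d / 2"
      using line_radius[of "d / 2" v] d by auto
    have "\<forall>\<^sub>F n in sequentially. norm (s n) < min \<delta> q"
      using tendstoD[OF slim, of "min \<delta> q"] \<delta> q by (simp add: dist_norm)
    then show "\<forall>\<^sub>F n in sequentially. \<forall>\<zeta>\<in>ball 0 r. dist (F n \<zeta>) (?D (z + \<zeta> *s u) v) < e"
    proof (rule eventually_mono, intro ballI)
      fix n and \<zeta> :: complex assume n: "norm (s n) < min \<delta> q" and \<zeta>: "\<zeta> \<in> ball 0 r"
      define w where "w = z + \<zeta> *s u"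
      \<comment> \<open>With the linear part subtracted, the derivative of \<open>h\<close> is small
        on the disc of radius \<open>norm (s n)\<close>, and the increment of \<open>h\<close>
        divided by \<open>s n\<close> is the error of \<open>F n\<close> at \<zeta>.\<close>
      define h where "h = (\<lambda>\<xi>. f (w + \<xi> *s v) - \<xi> * ?D w v)"
      have "norm (h (s n) - h 0) \<le> e / 2 * norm (s n - 0)"
      proof (rule field_differentiable_bound[of "cball 0 (norm (s n))"])
        fix \<xi> :: complex assume \<xi>: "\<xi> \<in> cball 0 (norm (s n))"
        have in1: "w + \<xi> *s v \<in> cball z \<epsilon>" "w \<in> cball z \<epsilon>"
          using inS[of \<zeta> \<xi>] inS0[of \<zeta>] \<xi> n \<zeta> by (auto simp: w_def)
        have "(h has_field_derivative ?D (w + \<xi> *s v) v - ?D w v) (at \<xi>)"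
          unfolding h_def
          by (intro DERIV_diff hol_on_line[OF assms(2)]) (use in1 \<epsilon> in \<open>auto intro!: derivative_eq_intros\<close>)
        then show "(h has_field_derivative ?D (w + \<xi> *s v) v - ?D w v) (at \<xi> within cball 0 (norm (s n)))"
          by (rule has_field_derivative_at_within)
        have "norm (\<xi> *s v) \<le> d / 2" using \<xi> n by (intro \<delta>) auto
        then have "dist (w + \<xi> *s v) w < d" using d(1) by (simp add: dist_norm)
        then show "norm (?D (w + \<xi> *s v) v - ?D w v) \<le> e / 2"
          using d(2)[OF in1(2,1)] by (simp add: dist_norm)
      qed auto
      then have "norm ((h (s n) - h 0) / s n) \<le> e / 2"
        using s0[of n] by (simp add: norm_divide field_simps)
      moreover have "(h (s n) - h 0) / s n = F n \<zeta> - ?D w v"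
        using s0[of n] by (simp add: h_def F_def w_def field_simps)
      ultimately show "dist (F n \<zeta>) (?D (z + \<zeta> *s u) v) < e"
        using e by (simp add: dist_norm w_def)
    qed
  qed
  have "\<exists>g'. \<forall>x \<in> ball 0 r. ((\<lambda>\<zeta>. ?D (z + \<zeta> *s u) v) has_field_derivative g' x) (at x) \<and> (\<lambda>n. F' n x) \<longlonglongrightarrow> g' x"
  proof (rule has_complex_derivative_uniform_sequence[OF _ dF])
    fix x assume "x \<in> ball (0::complex) r"
    then obtain d where "d > 0" "cball x d \<subseteq> ball 0 r"
      by (meson open_ball open_contains_cball)
    then show "\<exists>d>0. cball x d \<subseteq> ball 0 r \<and> uniform_limit (cball x d) F (\<lambda>\<zeta>. ?D (z + \<zeta> *s u) v) sequentially"
      using uniform_limit_on_subset[OF unif] by blast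
  qed auto
  then obtain g' where "\<forall>x \<in> ball 0 r. ((\<lambda>\<zeta>. ?D (z + \<zeta> *s u) v) has_field_derivative g' x) (at x) \<and> (\<lambda>n. F' n x) \<longlonglongrightarrow> g' x" ..
  then have "((\<lambda>\<zeta>. ?D (z + \<zeta> *s u) v) has_field_derivative g' 0) (at 0)" "(\<lambda>n. F' n 0) \<longlonglongrightarrow> g' 0"
    using r(1) by auto
  then show ?thesis
    using that[of s "g' 0"] s0 slim by (simp add: F'_def)
qed

definition second_deriv :: "(complex^'n::finite \<Rightarrow> complex) \<Rightarrow> complex^'n \<Rightarrow> complex^'n \<Rightarrow> complex^'n \<Rightarrow> complex" where
  "second_deriv f z u v = deriv (\<lambda>\<zeta>. frechet_derivative f (at (z + \<zeta> *s u)) v) 0"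

lemma has_second_deriv:
  assumes "open S" "hol_on S f" "z \<in> S"
  shows "((\<lambda>\<zeta>. frechet_derivative f (at (z + \<zeta> *s u)) v) has_field_derivative second_deriv f z u v) (at 0)"
  by (rule hol_on_derivative_line_limit[OF assms, of u v])
     (simp add: second_deriv_def DERIV_imp_deriv)

text \<open>The same quotients along the null sequence tend to \<open>H\<close>, the mixed
  derivative in one order, and to the mixed derivative in the other order.\<close>

lemma second_deriv_commute:
  assumes "open S" "hol_on S f" "z \<in> S"
  shows "second_deriv f z u v = second_deriv f z v u"
proof -
  obtain s :: "nat \<Rightarrow> complex" and H where s: "\<And>n. s n \<noteq> 0" "s \<longlonglongrightarrow> 0"
    "((\<lambda>\<zeta>. frechet_derivative f (at (z + \<zeta> *s u)) v) has_field_derivative H) (at 0)"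
    "(\<lambda>n. (frechet_derivative f (at (z + s n *s v)) u - frechet_derivative f (at z) u) / s n) \<longlonglongrightarrow> H"
    using hol_on_derivative_line_limit[OF assms, of u v] by blast
  have "((\<lambda>h. (frechet_derivative f (at (z + h *s v)) u - frechet_derivative f (at z) u) / h)
      \<longlongrightarrow> second_deriv f z v u) (at 0)"
    using has_second_deriv[OF assms, of v u] by (simp add: DERIV_def)
  moreover have "filterlim s (at 0) sequentially"
    using s(1,2) by (auto simp: filterlim_at)
  ultimately have "(\<lambda>n. (frechet_derivative f (at (z + s n *s v)) u - frechet_derivative f (at z) u) / s n)
      \<longlonglongrightarrow> second_deriv f z v u"
    by (rule filterlim_compose)
  with s(4) have "H = second_deriv f z v u" by (rule LIMSEQ_unique)
  with s(3) show ?thesis by (simp add: second_deriv_def DERIV_imp_deriv)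
qed

section \<open>Integration over \<open>complex^'n\<close>\<close>

lemma integrable_continuous_compact_support:
  fixes f :: "'a::euclidean_space \<Rightarrow> 'b::{banach, second_countable_topology}"
  assumes "compact K" "continuous_on UNIV f" "\<And>x. x \<notin> K \<Longrightarrow> f x = 0"
  shows "integrable lborel f"
proof -
  have "integrable lborel (\<lambda>x. indicator K x *\<^sub>R f x)"
    using assms by (intro borel_integrable_compact continuous_on_subset[OF assms(2)]) auto
  moreover have "(\<lambda>x. indicator K x *\<^sub>R f x) = f"
    using assms(3) by (auto simp: fun_eq_iff indicator_def)
  ultimately show ?thesis by simp
qed

text \<open>The one instance of Stokes' theorem in the proof: by translation invariance every
  difference quotient of \<open>g\<close> has integral zero, and dominated convergence passes to the
  derivative.\<close>

lemma integral_derivative_compact_support: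
  fixes g :: "'a::euclidean_space \<Rightarrow> 'b::{banach, second_countable_topology}"
  assumes K: "compact K" and g0: "\<And>x. x \<notin> K \<Longrightarrow> g x = 0"
    and dg: "\<And>x. (g has_derivative g' x) (at x)"
    and cg': "continuous_on UNIV (\<lambda>x. g' x v)"
  shows "integral\<^sup>L lborel (\<lambda>x. g' x v) = 0"
proof -
  have cg: "continuous_on UNIV g"
    by (auto intro!: continuous_at_imp_continuous_on has_derivative_continuous[OF dg])
  have ig: "integrable lborel g" by (rule integrable_continuous_compact_support[OF K cg g0])
  have g'0: "g' x v = 0" if "x \<notin> K" for x
  proof -
    have "(g has_derivative (\<lambda>_. 0)) (at x)"
      using that g0 K
      by (intro has_derivative_transform_within_open[OF has_derivative_const[of 0], of "-K"])
         (auto simp: compact_imp_closed open_Compl)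
    from has_derivative_unique[OF dg this] show ?thesis by simp
  qed
  have "bounded ((\<lambda>x. g' x v) ` K)"
    using K cg' by (intro compact_imp_bounded compact_continuous_image continuous_on_subset[OF cg']) auto
  then obtain M where M: "M > 0" "\<And>x. x \<in> K \<Longrightarrow> norm (g' x v) \<le> M"
    unfolding bounded_pos by blast
  have M': "norm (g' x v) \<le> M" for x using M g'0[of x] by (cases "x \<in> K") auto
  define h where "h = (\<lambda>n. 1 / real (Suc n))"
  have h: "h n > 0" "h n \<le> 1" for n by (auto simp: h_def)
  \<comment> \<open>Contains the support of every difference quotient with step at most 1, so a
    multiple of its indicator dominates them all.\<close>
  define K' where "K' = (\<lambda>(x,t). x - t *\<^sub>R v) ` (K \<times> {0..1::real})"
  have K': "compact K'"
    unfolding K'_def using K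
    by (intro compact_continuous_image compact_Times) (auto intro!: continuous_intros simp: case_prod_unfold)
  define q where "q = (\<lambda>n x. (1 / h n) *\<^sub>R (g (x + h n *\<^sub>R v) - g x))"
  have iq: "integrable lborel (\<lambda>x. g (x + h n *\<^sub>R v))" for n
  proof -
    have "integrable (distr lborel borel ((+) (h n *\<^sub>R v))) g"
      using ig by (simp only: lborel_distr_plus)
    then show ?thesis
      by (subst (asm) integrable_distr_eq)
         (use cg in \<open>auto simp: add.commute intro!: borel_measurable_continuous_onI\<close>)
  qed
  have trans: "integral\<^sup>L lborel (\<lambda>x. g (x + h n *\<^sub>R v)) = integral\<^sup>L lborel g" for n
  proof -
    have "integral\<^sup>L (distr lborel borel ((+) (h n *\<^sub>R v))) g = integral\<^sup>L lborel (\<lambda>x. g (h n *\<^sub>R v + x))"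
      by (rule integral_distr) (use cg in \<open>auto intro!: borel_measurable_continuous_onI\<close>)
    then show ?thesis by (simp only: lborel_distr_plus add.commute)
  qed
  have int0: "integral\<^sup>L lborel (q n) = 0" for n
    using iq[of n] ig trans[of n] by (simp add: q_def)
  have "(\<lambda>n. integral\<^sup>L lborel (q n)) \<longlonglongrightarrow> integral\<^sup>L lborel (\<lambda>x. g' x v)"
  proof (rule integral_dominated_convergence[where w="\<lambda>x. indicator K' x *\<^sub>R M"])
    show "(\<lambda>x. g' x v) \<in> borel_measurable lborel"
      using cg' by (simp add: borel_measurable_continuous_onI)
    show "q n \<in> borel_measurable lborel" for n
      using iq[of n] ig by (auto simp: q_def)
    show "integrable lborel (\<lambda>x. indicator K' x *\<^sub>R M)"
      using K' by (intro borel_integrable_compact) auto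
    show "AE x in lborel. (\<lambda>n. q n x) \<longlonglongrightarrow> g' x v"
    proof (rule AE_I2)
      fix x
      have "((\<lambda>t. g (x + t *\<^sub>R v)) has_vector_derivative g' (x + 0 *\<^sub>R v) v) (at 0)"
      proof -
        have "((\<lambda>t. x + t *\<^sub>R v) has_derivative (\<lambda>t. t *\<^sub>R v)) (at 0)"
          by (auto intro!: derivative_eq_intros)
        from has_derivative_compose[OF this dg]
        have "((\<lambda>t. g (x + t *\<^sub>R v)) has_derivative (\<lambda>t. g' (x + 0 *\<^sub>R v) (t *\<^sub>R v))) (at 0)" .
        then show ?thesis
          unfolding has_vector_derivative_def
          by (simp only: linear_cmul[OF has_derivative_linear[OF dg]])
      qed
      then have "((\<lambda>t. norm (g (x + t *\<^sub>R v) - g x - t *\<^sub>R g' x v) / norm t) \<longlongrightarrow> 0) (at 0)"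
        by (simp add: has_vector_derivative_def has_derivative_at)
      then have "((\<lambda>t. norm ((1 / t) *\<^sub>R (g (x + t *\<^sub>R v) - g x) - g' x v)) \<longlongrightarrow> 0) (at 0)"
      proof (rule Lim_transform_eventually)
        show "\<forall>\<^sub>F t in at 0. norm (g (x + t *\<^sub>R v) - g x - t *\<^sub>R g' x v) / norm t =
            norm ((1 / t) *\<^sub>R (g (x + t *\<^sub>R v) - g x) - g' x v)"
          unfolding eventually_at_filter
        proof (intro always_eventually allI impI)
          fix t :: real assume "t \<noteq> 0"
          then have "(1 / t) *\<^sub>R (g (x + t *\<^sub>R v) - g x) - g' x v =
              (1 / t) *\<^sub>R (g (x + t *\<^sub>R v) - g x - t *\<^sub>R g' x v)"
            by (simp add: scaleR_diff_right)
          then show "norm (g (x + t *\<^sub>R v) - g x - t *\<^sub>R g' x v) / norm t =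
              norm ((1 / t) *\<^sub>R (g (x + t *\<^sub>R v) - g x) - g' x v)"
            by (simp only: norm_scaleR) simp
        qed
      qed
      then have "((\<lambda>t. (1 / t) *\<^sub>R (g (x + t *\<^sub>R v) - g x)) \<longlongrightarrow> g' x v) (at 0)"
        by (subst Lim_null) (simp only: tendsto_norm_zero_iff)
      moreover have "filterlim h (at 0) sequentially"
        unfolding filterlim_at h_def using LIMSEQ_inverse_real_of_nat by (auto simp: inverse_eq_divide)
      ultimately show "(\<lambda>n. q n x) \<longlonglongrightarrow> g' x v"
        unfolding q_def by (rule filterlim_compose)
    qed
    show "AE x in lborel. norm (q n x) \<le> indicator K' x *\<^sub>R M" for n
    proof (rule AE_I2)
      fix x
      show "norm (q n x) \<le> indicator K' x *\<^sub>R M"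
      proof (cases "x \<in> K'")
        case True
        have "norm (g (x + h n *\<^sub>R v) - g (x + 0 *\<^sub>R v)) \<le> M * norm (h n - 0)"
        proof (rule differentiable_bound[of "{0..h n}" "\<lambda>t. g (x + t *\<^sub>R v)" "\<lambda>t s. g' (x + t *\<^sub>R v) (s *\<^sub>R v)"])
          fix t assume "t \<in> {0..h n}"
          have "((\<lambda>t. x + t *\<^sub>R v) has_derivative (\<lambda>t. t *\<^sub>R v)) (at t within {0..h n})"
            by (auto intro!: derivative_eq_intros)
          from has_derivative_compose[OF this dg]
          show "((\<lambda>t. g (x + t *\<^sub>R v)) has_derivative (\<lambda>s. g' (x + t *\<^sub>R v) (s *\<^sub>R v))) (at t within {0..h n})" .
          show "onorm (\<lambda>s. g' (x + t *\<^sub>R v) (s *\<^sub>R v)) \<le> M"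
          proof (rule onorm_bound)
            fix s :: real
            have "norm (g' (x + t *\<^sub>R v) (s *\<^sub>R v)) = \<bar>s\<bar> * norm (g' (x + t *\<^sub>R v) v)"
              by (simp only: linear_cmul[OF has_derivative_linear[OF dg]] norm_scaleR)
            then show "norm (g' (x + t *\<^sub>R v) (s *\<^sub>R v)) \<le> M * norm s"
              using M'[of "x + t *\<^sub>R v"] by (metis abs_ge_zero mult.commute mult_left_mono real_norm_def)
          qed (use M in simp)
        qed (use h[of n] in auto)
        then have "norm (g (x + h n *\<^sub>R v) - g x) / h n \<le> M" using h[of n] by (simp add: field_simps)
        then show ?thesis using True h[of n] by (simp add: q_def)
      next
        case False
        have "x \<notin> K" using False unfolding K'_def by force
        moreover have "x + h n *\<^sub>R v \<notin> K"
        proof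
          assume "x + h n *\<^sub>R v \<in> K"
          then have "(x + h n *\<^sub>R v) - h n *\<^sub>R v \<in> K'"
            unfolding K'_def using h[of n] less_imp_le[OF h(1)[of n]] by (intro image_eqI[of _ _ "(x + h n *\<^sub>R v, h n)"]) auto
          then show False using False by simp
        qed
        ultimately show ?thesis using g0 False by (simp add: q_def)
      qed
    qed
  qed
  then have "(\<lambda>n. 0) \<longlonglongrightarrow> integral\<^sup>L lborel (\<lambda>x. g' x v)" by (simp only: int0)
  from LIMSEQ_unique[OF this tendsto_const] show ?thesis .
qed

section \<open>Real determinants of complex linear maps, and change of variables\<close>

lemma det_eq_Determinant_det:
  fixes A :: "'c::comm_ring_1^'m::finite^'m"
  shows "det A = Determinant.det (mat CARD('m) CARD('m) (\<lambda>(a,b). A $ (index_list ! a) $ (index_list ! b)))"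
proof -
  define N where "N = CARD('m)"
  define h :: "nat \<Rightarrow> 'm" where "h = (\<lambda>a. index_list ! a)"
  have bij: "bij_betw h {..<N} UNIV"
    using bij_betw_nth[OF index_list(1)[where 'n='m], of "{..<N}" UNIV] by (simp add: h_def N_def index_list(2))
  then have inj: "inj_on h {..<N}" by (simp add: bij_betw_def)
  have "map_permutation {..<N} h = (\<lambda>p x. if x \<in> UNIV then h (p (inv_into {..<N} h x)) else x)"
    using bij by (auto simp: fun_eq_iff map_permutation_def restrict_id_def bij_betw_def)
  \<comment> \<open>Transport of permutations along \<open>h\<close> is bijective and preserves
    signs, so the two Leibniz sums agree term by term.\<close>
  then have "bij_betw (map_permutation {..<N} h) {p. p permutes {..<N}} {p. p permutes UNIV}"
    using bij_betw_permutations[OF bij] by simp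
  then have "det A = (\<Sum>p | p permutes {..<N}. of_int (sign (map_permutation {..<N} h p)) *
      (\<Prod>i\<in>UNIV. A $ i $ map_permutation {..<N} h p i))"
    unfolding Determinants.det_def by (rule sum.reindex_bij_betw[symmetric])
  also have "\<dots> = (\<Sum>p | p permutes {..<N}. of_int (sign p) * (\<Prod>a<N. A $ h a $ h (p a)))"
  proof (rule sum.cong[OF refl])
    fix p assume "p \<in> {p. p permutes {..<N}}"
    then have p: "p permutes {..<N}" by simp
    have "(\<Prod>i\<in>UNIV. A $ i $ map_permutation {..<N} h p i) = (\<Prod>a<N. A $ h a $ map_permutation {..<N} h p (h a))"
      by (rule prod.reindex_bij_betw[OF bij, symmetric])
    then show "of_int (sign (map_permutation {..<N} h p)) * (\<Prod>i\<in>UNIV. A $ i $ map_permutation {..<N} h p i) =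
      of_int (sign p) * (\<Prod>a<N. A $ h a $ h (p a))"
      using p inj by (simp add: sign_map_permutation map_permutation_apply)
  qed
  also have "\<dots> = Determinant.det (mat N N (\<lambda>(a,b). A $ h a $ h b))"
    unfolding det_def'[OF mat_carrier] lessThan_atLeast0
    by (intro sum.cong refl arg_cong2[where f="(*)"] prod.cong) (auto simp: permutes_in_image)
  finally show ?thesis by (simp add: N_def h_def)
qed

text \<open>With \<open>C = R + \<i> J\<close>, the real matrix \<open>[[R, -J], [J, R]]\<close>
  becomes over the complex numbers similar to a block triangular one whose diagonal blocks are
  \<open>C\<close> and its conjugate.\<close>

lemma det_realification:
  fixes C :: "complex mat"
  assumes C: "C \<in> carrier_mat n n"
  shows "Determinant.det (four_block_mat (map_mat Re C) (map_mat (\<lambda>x. - Im x) C) (map_mat Im C) (map_mat Re C))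
    = (norm (Determinant.det C))\<^sup>2"
proof -
  define R where "R = map_mat (\<lambda>x. complex_of_real (Re x)) C"
  define J where "J = map_mat (\<lambda>x. complex_of_real (Im x)) C"
  have RJ: "R \<in> carrier_mat n n" "J \<in> carrier_mat n n" using C by (auto simp: R_def J_def)
  define D where "D = four_block_mat (map_mat Re C) (map_mat (\<lambda>x. - Im x) C) (map_mat Im C) (map_mat Re C)"
  define i where "i = \<i> \<cdot>\<^sub>m (1\<^sub>m n :: complex mat)"
  \<comment> \<open>\<open>P\<close> adds \<i> times the lower block row to the upper one,
    \<open>Q\<close> subtracts \<i> times the left block column from the right one; both have
    determinant 1.\<close>
  define P where "P = four_block_mat (1\<^sub>m n) i (0\<^sub>m n n) (1\<^sub>m n)"
  define Q where "Q = four_block_mat (1\<^sub>m n) (- i) (0\<^sub>m n n) (1\<^sub>m n)"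
  have i: "i \<in> carrier_mat n n" by (simp add: i_def)
  have D: "map_mat complex_of_real D = four_block_mat R (-J) J R"
    by (rule eq_matI) (use C in \<open>auto simp: D_def R_def J_def\<close>)
  have Cc: "C = R + \<i> \<cdot>\<^sub>m J" by (rule eq_matI) (use C in \<open>auto simp: R_def J_def complex_eq_iff\<close>)
  have Cb: "map_mat cnj C = R + (-\<i>) \<cdot>\<^sub>m J" by (rule eq_matI) (use C in \<open>auto simp: R_def J_def complex_eq_iff\<close>)
  have iR: "i * M = \<i> \<cdot>\<^sub>m M" "M * i = \<i> \<cdot>\<^sub>m M" if "M \<in> carrier_mat n n" for M
    using that mult_smult_assoc_mat[OF one_carrier_mat that, of \<i>] mult_smult_distrib[OF that one_carrier_mat, of \<i>]
    unfolding i_def by auto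
  have miR: "M * (- i) = (-\<i>) \<cdot>\<^sub>m M" if "M \<in> carrier_mat n n" for M
  proof -
    have "- i = (-\<i>) \<cdot>\<^sub>m (1\<^sub>m n)" by (rule eq_matI) (auto simp: i_def)
    then show ?thesis using that mult_smult_distrib[OF that one_carrier_mat, of "-\<i>"] by simp
  qed
  have 1: "P * four_block_mat R (-J) J R = four_block_mat C (\<i> \<cdot>\<^sub>m C) J R"
    unfolding P_def
    by (subst mult_four_block_mat[of _ n n _ n _ n _ _ n _ n])
       (use RJ i in \<open>auto simp: iR Cc distrib_left intro!: arg_cong2[where f="\<lambda>a b. four_block_mat a b J R"] eq_matI\<close>)
  have 2: "four_block_mat C (\<i> \<cdot>\<^sub>m C) J R * Q = four_block_mat C (0\<^sub>m n n) J (map_mat cnj C)"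
  proof -
    have "four_block_mat C (\<i> \<cdot>\<^sub>m C) J R * Q = four_block_mat (C * 1\<^sub>m n + (\<i> \<cdot>\<^sub>m C) * 0\<^sub>m n n)
       (C * (- i) + (\<i> \<cdot>\<^sub>m C) * 1\<^sub>m n) (J * 1\<^sub>m n + R * 0\<^sub>m n n) (J * (- i) + R * 1\<^sub>m n)"
      unfolding Q_def by (rule mult_four_block_mat) (use RJ C i in auto)
    also have "C * 1\<^sub>m n + (\<i> \<cdot>\<^sub>m C) * 0\<^sub>m n n = C" using C by simp
    also have "C * (- i) + (\<i> \<cdot>\<^sub>m C) * 1\<^sub>m n = 0\<^sub>m n n"
      unfolding miR[OF C] by (rule eq_matI) (use C in auto)
    also have "J * 1\<^sub>m n + R * 0\<^sub>m n n = J" using RJ by simp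
    also have "J * (- i) + R * 1\<^sub>m n = map_mat cnj C"
      unfolding miR[OF RJ(2)] Cb by (rule eq_matI) (use RJ in auto)
    finally show ?thesis .
  qed
  have cP: "P \<in> carrier_mat (n+n) (n+n)" "Q \<in> carrier_mat (n+n) (n+n)"
    "four_block_mat R (-J) J R \<in> carrier_mat (n+n) (n+n)"
    "four_block_mat C (\<i> \<cdot>\<^sub>m C) J R \<in> carrier_mat (n+n) (n+n)"
    using RJ C by (auto simp: P_def Q_def)
  have dP: "Determinant.det P = 1" "Determinant.det Q = 1"
    unfolding P_def Q_def
    by (subst det_four_block_mat_lower_left_zero[OF _ _ refl]; use i in simp)+
  interpret cnj: comm_ring_hom cnj by unfold_locales auto
  have "complex_of_real (Determinant.det D) = Determinant.det (four_block_mat R (-J) J R)"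
    unfolding D[symmetric] by simp
  also have "\<dots> = Determinant.det (P * four_block_mat R (-J) J R * Q)"
    using cP by (simp add: det_mult[of _ "n+n"] dP 1[symmetric])
  also have "\<dots> = Determinant.det C * Determinant.det (map_mat cnj C)"
    unfolding 1 2 by (rule det_four_block_mat_upper_right_zero[OF C refl RJ(2)]) (use C in auto)
  also have "\<dots> = complex_of_real ((norm (Determinant.det C))\<^sup>2)"
    unfolding cnj.hom_det by (rule complex_norm_square[symmetric])
  finally show ?thesis unfolding D_def of_real_eq_iff .
qed

definition list_pos :: "'n::finite \<Rightarrow> nat" where
  "list_pos i = (THE a. a < CARD('n) \<and> index_list ! a = i)"

lemma list_pos:
  fixes i :: "'n::finite"
  shows "list_pos i < CARD('n)" "index_list ! list_pos i = i"
proof -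
  have "\<exists>!a. a < CARD('n) \<and> index_list ! a = i"
    using index_list[where 'n='n] distinct_Ex1[of "index_list :: 'n list" i] by simp
  from theI'[OF this] show "list_pos i < CARD('n)" "index_list ! list_pos i = i"
    unfolding list_pos_def by auto
qed

lemma list_pos_index_list:
  assumes "a < CARD('n::finite)"
  shows "list_pos (index_list ! a :: 'n) = a"
  using list_pos[of "index_list ! a :: 'n"] assms index_list(1)[where 'n='n]
  by (simp add: nth_eq_iff_index_eq)

text \<open>The type \<open>'n bit0\<close> has twice as many elements as \<open>'n\<close>: the
  first half of the coordinates carries the real parts, the second half the imaginary parts. This is
  the block order of \<open>det_realification\<close>, and it moves integrals to
  \<open>real^_\<close>, where the change of variables rule is applied.\<close>

definition complexify :: "real^('n::finite bit0) \<Rightarrow> complex^'n" where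
  "complexify x = (\<chi> i. Complex (x $ (index_list ! list_pos i)) (x $ (index_list ! (CARD('n) + list_pos i))))"

definition realify :: "complex^'n::finite \<Rightarrow> real^('n bit0)" where
  "realify y = (\<chi> m. if list_pos m < CARD('n) then Re (y $ (index_list ! list_pos m))
                else Im (y $ (index_list ! (list_pos m - CARD('n)))))"

lemma linear_complexify: "linear complexify" and linear_realify: "linear realify"
  by (auto intro!: linearI simp: complexify_def realify_def Finite_Cartesian_Product.vec_eq_iff complex_eq_iff)

lemma complexify_realify [simp]: "complexify (realify y) = y"
proof -
  have "list_pos (index_list ! list_pos i :: 'a bit0) = list_pos i"
    "list_pos (index_list ! (CARD('a) + list_pos i) :: 'a bit0) = CARD('a) + list_pos i" for i :: 'a
    using list_pos(1)[of i] by (auto intro!: list_pos_index_list)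
  then show ?thesis
    by (simp add: complexify_def realify_def Finite_Cartesian_Product.vec_eq_iff complex_eq_iff list_pos)
qed

lemma realify_complexify [simp]: "realify (complexify x) = x"
proof -
  have "x $ m = realify (complexify x) $ m" for m :: "'a bit0"
  proof (cases "list_pos m < CARD('a)")
    case True
    then show ?thesis by (simp add: realify_def complexify_def list_pos_index_list list_pos)
  next
    case False
    moreover have "list_pos m - CARD('a) < CARD('a)" using list_pos(1)[of m] False by simp
    ultimately show ?thesis by (simp add: realify_def complexify_def list_pos_index_list list_pos)
  qed
  then show ?thesis by (simp add: Finite_Cartesian_Product.vec_eq_iff)
qed

lemma sum_lessThan_add: "(\<Sum>a<m + n. F a) = (\<Sum>a<m. F a) + (\<Sum>a<n. F (m + a))"
  for F :: "nat \<Rightarrow> 'b::comm_monoid_add" and m n :: nat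
  by (induction n) (auto simp: add.assoc)

text \<open>The inverse of \<open>complexify\<close> is also its adjoint, so both maps are
  isometries; this is what pulls boxes back to boxes.\<close>

lemma realify_inner: "realify y \<bullet> x = y \<bullet> complexify x"
proof -
  let ?n = "CARD('a)"
  have "realify y \<bullet> x = (\<Sum>a<CARD('a bit0). realify y $ (index_list ! a) * x $ (index_list ! a))"
    by (simp add: inner_vec_def sum_index_list)
  also have "\<dots> = (\<Sum>a<?n + ?n. (if a < ?n then Re (y $ (index_list ! a)) else Im (y $ (index_list ! (a - ?n)))) * x $ (index_list ! a))"
    by (rule sum.cong) (auto simp: realify_def list_pos_index_list)
  also have "\<dots> = (\<Sum>a<?n. Re (y $ (index_list ! a)) * x $ (index_list ! a)) + (\<Sum>a<?n. Im (y $ (index_list ! a)) * x $ (index_list ! (?n + a)))"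
    by (simp add: sum_lessThan_add)
  also have "\<dots> = y \<bullet> complexify x"
    by (simp add: inner_vec_def sum_index_list complexify_def list_pos_index_list inner_complex_def sum.distrib)
  finally show ?thesis .
qed

lemma complexify_axis:
  assumes b: "b < CARD('n::finite)"
  shows "complexify (axis (index_list ! b) 1 :: real^('n bit0)) = axis (index_list ! b) 1"
    and "complexify (axis (index_list ! (CARD('n) + b)) 1 :: real^('n bit0)) = axis (index_list ! b) \<i>"
proof -
  have inj: "(index_list ! a = (index_list ! b :: 'n bit0)) = (a = b)" if "a < CARD('n) + CARD('n)" "b < CARD('n) + CARD('n)" for a b
    using that index_list(1)[where 'n="'n bit0"] by (simp add: nth_eq_iff_index_eq)
  have p: "list_pos i < CARD('n) + CARD('n)" "list_pos i \<noteq> CARD('n) + b" "b \<noteq> CARD('n) + list_pos i" for i :: 'n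
    using list_pos(1)[of i] b by auto
  have q: "list_pos i = b \<longleftrightarrow> i = index_list ! b" for i :: 'n
    using list_pos(2)[of i] list_pos_index_list[OF b] by auto
  show "complexify (axis (index_list ! b) 1 :: real^('n bit0)) = axis (index_list ! b) 1"
    "complexify (axis (index_list ! (CARD('n) + b)) 1 :: real^('n bit0)) = axis (index_list ! b) \<i>"
    using b p by (simp_all add: complexify_def axis_def Finite_Cartesian_Product.vec_eq_iff complex_eq_iff inj list_pos(1) q)
qed

lemma complexify_Basis: "complexify ` (Basis :: (real^('n::finite bit0)) set) = Basis"
proof (rule card_subset_eq)
  show "complexify ` (Basis :: (real^('n bit0)) set) \<subseteq> Basis"
  proof
    fix y assume "y \<in> complexify ` (Basis :: (real^('n bit0)) set)"
    then obtain m :: "'n bit0" where y: "y = complexify (axis m 1)" by (auto simp: Basis_vec_def)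
    show "y \<in> Basis"
    proof (cases "list_pos m < CARD('n)")
      case True
      then show ?thesis using complexify_axis(1)[OF True] by (auto simp: y list_pos Basis_vec_def Basis_complex_def)
    next
      case False
      then have k: "list_pos m - CARD('n) < CARD('n)" using list_pos(1)[of m] by auto
      then show ?thesis using complexify_axis(2)[OF k] False by (auto simp: y list_pos Basis_vec_def Basis_complex_def)
    qed
  qed
  have "inj complexify" by (metis injI realify_complexify)
  then show "card (complexify ` (Basis :: (real^('n bit0)) set)) = card (Basis :: (complex^'n) set)"
    by (subst card_image) (auto intro: inj_on_subset)
qed auto

text \<open>Standard basis goes to standard basis, so boxes keep their shape and volume, and
  Lebesgue measure is determined by boxes.\<close>

lemma lborel_complexify: "distr lborel borel complexify = (lborel :: (complex^'n::finite) measure)"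
proof (rule lborel_eqI[symmetric])
  have meas: "(complexify :: real^('n bit0) \<Rightarrow> complex^'n) \<in> borel_measurable borel"
    by (intro borel_measurable_continuous_onI linear_continuous_on linear_conv_bounded_linear[THEN iffD1] linear_complexify)
  fix l u :: "complex^'n" assume le: "\<And>b. b \<in> Basis \<Longrightarrow> l \<bullet> b \<le> u \<bullet> b"
  have "complexify -` box l u = box (realify l) (realify u)"
    by (auto simp: box_def complexify_Basis[symmetric] realify_inner[symmetric])
  then have "emeasure (distr lborel borel complexify) (box l u) = emeasure lborel (box (realify l) (realify u))"
    using meas by (simp add: emeasure_distr)
  also have "\<dots> = (\<Prod>b\<in>Basis. (realify u - realify l) \<bullet> b)"
    by (rule emeasure_lborel_box) (use le in \<open>auto simp: realify_inner complexify_Basis[symmetric]\<close>)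
  also have "(\<Prod>b\<in>Basis. (realify u - realify l) \<bullet> b) = (\<Prod>b\<in>complexify ` Basis. (u - l) \<bullet> b)"
    by (subst prod.reindex) (auto intro!: inj_onI prod.cong simp: inner_diff_left realify_inner dest: arg_cong[of _ _ realify])
  finally show "emeasure (distr lborel borel complexify) (box l u) = (\<Prod>b\<in>Basis. (u - l) \<bullet> b)"
    by (simp add: complexify_Basis)
qed simp

lemma det_realify:
  fixes L :: "complex^'n::finite \<Rightarrow> complex^'n"
  assumes L: "\<And>c v. L (c *s v) = c *s L v"
  shows "det (matrix (realify \<circ> L \<circ> complexify)) = (norm (cdet L))\<^sup>2"
proof -
  let ?n = "CARD('n)"
  define C where "C = mat ?n ?n (\<lambda>(a,b). L (axis (index_list ! b) 1) $ (index_list ! a))"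
  have ax: "complexify (axis (index_list ! b) 1 :: real^('n bit0)) = axis (index_list ! b) 1"
    "complexify (axis (index_list ! (?n + b)) 1 :: real^('n bit0)) = \<i> *s axis (index_list ! b) 1" if "b < ?n" for b
    using complexify_axis[OF that] by (auto simp: axis_def Finite_Cartesian_Product.vec_eq_iff)
  have "mat CARD('n bit0) CARD('n bit0) (\<lambda>(a,b). matrix (realify \<circ> L \<circ> complexify) $ (index_list ! a) $ (index_list ! b))
     = four_block_mat (map_mat Re C) (map_mat (\<lambda>x. - Im x) C) (map_mat Im C) (map_mat Re C)"
  proof (rule eq_matI)
    fix a b
    assume "a < dim_row (four_block_mat (map_mat Re C) (map_mat (\<lambda>x. - Im x) C) (map_mat Im C) (map_mat Re C))"
      "b < dim_col (four_block_mat (map_mat Re C) (map_mat (\<lambda>x. - Im x) C) (map_mat Im C) (map_mat Re C))"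
    then have ab: "a < ?n + ?n" "b < ?n + ?n" by (auto simp: C_def)
    have "b \<ge> ?n \<Longrightarrow> complexify (axis (index_list ! b) 1 :: real^('n bit0)) = \<i> *s axis (index_list ! (b - ?n)) 1"
      using ax(2)[of "b - ?n"] ab by simp
    then show "mat CARD('n bit0) CARD('n bit0) (\<lambda>(a,b). matrix (realify \<circ> L \<circ> complexify) $ (index_list ! a) $ (index_list ! b)) $$ (a,b)
     = four_block_mat (map_mat Re C) (map_mat (\<lambda>x. - Im x) C) (map_mat Im C) (map_mat Re C) $$ (a,b)"
      using ab by (auto simp: C_def matrix_def realify_def list_pos_index_list ax L not_less)
  qed (auto simp: C_def)
  then have "det (matrix (realify \<circ> L \<circ> complexify)) = (norm (Determinant.det C))\<^sup>2"
    unfolding det_eq_Determinant_det by (simp only:) (rule det_realification[of C ?n], simp add: C_def)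
  then show ?thesis by (simp only: cdet_def C_def)
qed

text \<open>By \<open>det_realify\<close> the weight in \<open>eq\<close> is the real Jacobian
  determinant. The integrals run over the whole space, for functions vanishing off the domains,
  which fits the extension by zero of chart expressions.\<close>

lemma integral_change_of_variables_complex:
  fixes \<phi> \<psi> :: "complex^'n::finite \<Rightarrow> complex^'n" and h k :: "complex^'n \<Rightarrow> real"
  assumes S: "open S" "open V"
    and d\<phi>: "\<And>z. z \<in> S \<Longrightarrow> (\<phi> has_derivative J z) (at z)"
    and d\<psi>: "\<And>w. w \<in> V \<Longrightarrow> (\<psi> has_derivative J' w) (at w)"
    and JC: "\<And>z c v. z \<in> S \<Longrightarrow> J z (c *s v) = c *s J z v"
    and \<phi>: "\<And>z. z \<in> S \<Longrightarrow> \<phi> z \<in> V \<and> \<psi> (\<phi> z) = z"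
    and \<psi>: "\<And>w. w \<in> V \<Longrightarrow> \<psi> w \<in> S \<and> \<phi> (\<psi> w) = w"
    and h: "integrable lborel h" "\<And>w. w \<notin> V \<Longrightarrow> h w = 0"
    and k: "integrable lborel k" "\<And>z. z \<notin> S \<Longrightarrow> k z = 0"
    and eq: "\<And>z. z \<in> S \<Longrightarrow> k z = (norm (cdet (J z)))\<^sup>2 * h (\<phi> z)"
  shows "integral\<^sup>L lborel k = integral\<^sup>L lborel h"
proof -
  have bl: "bounded_linear complexify" "bounded_linear realify"
    using linear_complexify linear_realify by (auto simp: linear_conv_bounded_linear)
  note [derivative_intros] = bounded_linear.has_derivative[OF bl(1)] bounded_linear.has_derivative[OF bl(2)]
  have meas: "(complexify :: real^('n bit0) \<Rightarrow> complex^'n) \<in> borel_measurable borel"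
    using bl(1) by (intro borel_measurable_continuous_onI linear_continuous_on)
  have tr: "integrable lborel (\<lambda>x. f (complexify x))" "integral\<^sup>L lborel (\<lambda>x. f (complexify x)) = integral\<^sup>L lborel f"
    if "integrable lborel f" for f :: "complex^'n \<Rightarrow> real"
  proof -
    have fm: "f \<in> borel_measurable borel" using borel_measurable_integrable[OF that] by simp
    show "integrable lborel (\<lambda>x. f (complexify x))"
      using that integrable_distr_eq[of complexify lborel borel f] meas fm unfolding lborel_complexify by simp
    show "integral\<^sup>L lborel (\<lambda>x. f (complexify x)) = integral\<^sup>L lborel f"
      using integral_distr[of complexify lborel borel f] meas fm unfolding lborel_complexify by simp
  qed
  define S' where "S' = complexify -` S"
  define V' where "V' = complexify -` V"
  define g where "g = realify \<circ> \<phi> \<circ> complexify"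
  define g' where "g' = realify \<circ> \<psi> \<circ> complexify"
  have on: "f absolutely_integrable_on W" "integral W f = integral\<^sup>L lborel f"
    if "integrable lborel f" "\<And>x. x \<notin> W \<Longrightarrow> f x = 0" for f :: "real^('n bit0) \<Rightarrow> real" and W
  proof -
    have r: "(\<lambda>x. if x \<in> W then f x else 0) = f" using that(2) by auto
    have "f absolutely_integrable_on UNIV"
      using integrable_completion[of f lborel] that(1) by (simp add: set_integrable_def borel_measurable_integrable)
    then show "f absolutely_integrable_on W"
      using absolutely_integrable_restrict_UNIV[of W f] r by simp
    show "integral W f = integral\<^sup>L lborel f"
      using integral_restrict_UNIV[of W f] integral_lborel[OF that(1)] r by simp
  qed
  let ?k = "\<lambda>x. \<bar>det (matrix (realify \<circ> J (complexify x) \<circ> complexify))\<bar> * h (complexify (g x))"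
  \<comment> \<open>Chain rule for \<psi> after \<phi>, which is the identity on the open set
    \<open>S\<close>.\<close>
  have id: "(realify \<circ> J' (complexify y) \<circ> complexify) \<circ> (realify \<circ> J (complexify (g' y)) \<circ> complexify) = id" if "y \<in> V'" for y
  proof -
    define w where "w = complexify y"
    have w: "w \<in> V" "\<psi> w \<in> S" "\<phi> (\<psi> w) = w" using that \<psi> by (auto simp: V'_def w_def)
    have "(\<psi> \<circ> \<phi> has_derivative J' w \<circ> J (\<psi> w)) (at (\<psi> w))"
      using diff_chain_at[OF d\<phi>[OF w(2)], of \<psi> "J' w"] d\<psi>[OF w(1)] w(3) by simp
    moreover have "(\<psi> \<circ> \<phi> has_derivative id) (at (\<psi> w))"
      by (rule has_derivative_transform_within_open[OF has_derivative_id S(1) w(2)]) (use \<phi> in auto)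
    ultimately have "J' w \<circ> J (\<psi> w) = id" by (rule has_derivative_unique)
    then show ?thesis by (auto simp: fun_eq_iff g'_def w_def)
  qed
  \<comment> \<open>The rule transfers integrability together with the value: the side of
    \<open>V'\<close> is known, the side of \<open>S'\<close> is wanted.\<close>
  have "?k absolutely_integrable_on S' \<and> integral S' ?k = integral\<^sup>L lborel h \<longleftrightarrow>
     (\<lambda>x. h (complexify x)) absolutely_integrable_on V' \<and> integral V' (\<lambda>x. h (complexify x)) = integral\<^sup>L lborel h"
  proof (rule cov_invertible_real[where h=g' and h'="\<lambda>y. realify \<circ> J' (complexify y) \<circ> complexify"])
    show "(g has_derivative realify \<circ> J (complexify x) \<circ> complexify) (at x within S')" if "x \<in> S'" for x
      unfolding g_def o_def
      by (rule has_derivative_at_withinI, rule bounded_linear.has_derivative[OF bl(2)],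
          rule has_derivative_compose[OF bounded_linear_imp_has_derivative[OF bl(1)]])
         (use that d\<phi> in \<open>auto simp: S'_def\<close>)
    show "(g' has_derivative realify \<circ> J' (complexify x) \<circ> complexify) (at x within V')" if "x \<in> V'" for x
      unfolding g'_def o_def
      by (rule has_derivative_at_withinI, rule bounded_linear.has_derivative[OF bl(2)],
          rule has_derivative_compose[OF bounded_linear_imp_has_derivative[OF bl(1)]])
         (use that d\<psi> in \<open>auto simp: V'_def\<close>)
    show "g x \<in> V' \<and> g' (g x) = x" if "x \<in> S'" for x
      using that \<phi> by (auto simp: g_def g'_def S'_def V'_def)
    show "g' x \<in> S' \<and> g (g' x) = x" if "x \<in> V'" for x
      using that \<psi> by (auto simp: g_def g'_def S'_def V'_def)
  qed (fact id)
  moreover have "(\<lambda>x. h (complexify x)) absolutely_integrable_on V'" "integral V' (\<lambda>x. h (complexify x)) = integral\<^sup>L lborel h"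
    using on[of "\<lambda>x. h (complexify x)" V'] tr[OF h(1)] h(2) by (auto simp: V'_def)
  ultimately have "integral S' ?k = integral\<^sup>L lborel h" by blast
  moreover have "integral S' ?k = integral S' (\<lambda>x. k (complexify x))"
    by (rule Henstock_Kurzweil_Integration.integral_cong) (auto simp: S'_def eq det_realify[OF JC] g_def)
  moreover have "integral S' (\<lambda>x. k (complexify x)) = integral\<^sup>L lborel k"
    using on[of "\<lambda>x. k (complexify x)" S'] tr[OF k(1)] k(2) by (auto simp: S'_def)
  ultimately show ?thesis by simp
qed

section \<open>Exterior derivatives of holomorphic forms\<close>

lemma cholomorphic_on_component:
  assumes "cholomorphic_on S \<phi>"
  shows "hol_on S (\<lambda>z. \<phi> z $ j)"
    and "z \<in> S \<Longrightarrow> frechet_derivative (\<lambda>z. \<phi> z $ j) (at z) v = frechet_derivative \<phi> (at z) v $ j"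
    and "z \<in> S \<Longrightarrow> (\<phi> has_derivative frechet_derivative \<phi> (at z)) (at z)"
    and "z \<in> S \<Longrightarrow> frechet_derivative \<phi> (at z) (c *s v) = c *s frechet_derivative \<phi> (at z) v"
proof -
  have ex: "\<exists>D. (\<phi> has_derivative D) (at z) \<and> (\<forall>c v. D (c *s v) = c *s D v)" if "z \<in> S" for z
    using assms that by (auto simp: cholomorphic_on_def)
  show "(\<phi> has_derivative frechet_derivative \<phi> (at z)) (at z)"
    and C: "frechet_derivative \<phi> (at z) (c *s v) = c *s frechet_derivative \<phi> (at z) v" if zS: "z \<in> S" for z c v
  proof -
    obtain D where D: "(\<phi> has_derivative D) (at z)" "\<And>c v. D (c *s v) = c *s D v"
      using ex[OF zS] by blast
    show "(\<phi> has_derivative frechet_derivative \<phi> (at z)) (at z)"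
      "frechet_derivative \<phi> (at z) (c *s v) = c *s frechet_derivative \<phi> (at z) v"
      using D by (simp_all add: frechet_derivative_at[OF D(1), symmetric])
  qed
  then have comp: "((\<lambda>z. \<phi> z $ j) has_derivative (\<lambda>v. frechet_derivative \<phi> (at z) v $ j)) (at z)" if "z \<in> S" for z
    using that by (intro bounded_linear.has_derivative[OF bounded_linear_vec_nth])
  then show "frechet_derivative (\<lambda>z. \<phi> z $ j) (at z) v = frechet_derivative \<phi> (at z) v $ j" if "z \<in> S"
    by (simp add: frechet_derivative_at[OF comp[OF that], symmetric])
  show "hol_on S (\<lambda>z. \<phi> z $ j)"
    unfolding hol_on_def using comp C by (intro ballI exI conjI) auto
qed

lemma eventually_line:
  fixes z :: "complex^'n::finite"
  assumes "open S" "z \<in> S"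
  shows "\<forall>\<^sub>F \<zeta> in nhds 0. z + \<zeta> *s u \<in> S"
proof -
  have "open ((\<lambda>\<zeta>. z + \<zeta> *s u) -` S)"
    using assms(1) by (intro open_vimage continuous_intros) auto
  then show ?thesis using assms(2) by (auto simp: eventually_nhds intro!: exI[of _ "(\<lambda>\<zeta>. z + \<zeta> *s u) -` S"])
qed

text \<open>The exterior derivative of a pulled back monomial \<open>dz\<^sub>I\<close> vanishes: by induction on \<open>I\<close> the new
  terms are contractions of the symmetric second derivative of \<open>\<phi>\<close>.\<close>

lemma dz_wedge_pullback_closed:
  fixes \<phi> :: "complex^'n::finite \<Rightarrow> complex^'m::finite"
  assumes S: "open S" and \<phi>: "cholomorphic_on S \<phi>" and z: "z \<in> S"
  shows "\<exists>X. (\<forall>u vs. ((\<lambda>\<zeta>. dz_wedge I [] (map (frechet_derivative \<phi> (at (z + \<zeta> *s u))) vs))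
                has_field_derivative X u vs) (at 0)) \<and>
             (\<forall>vs. (\<Sum>i<length vs. (-1) ^ i * X (vs ! i) (omit_nth i vs)) = 0)"
proof (induction I)
  case Nil
  show ?case by (rule exI[of _ "\<lambda>_ _. 0"]) (auto simp: dz_wedge_Nil)
next
  case (Cons j I)
  then obtain X where X:
    "\<And>u vs. ((\<lambda>\<zeta>. dz_wedge I [] (map (frechet_derivative \<phi> (at (z + \<zeta> *s u))) vs)) has_field_derivative X u vs) (at 0)"
    "\<And>vs. (\<Sum>i<length vs. (-1) ^ i * X (vs ! i) (omit_nth i vs)) = 0"
    by blast
  let ?J = "frechet_derivative \<phi> (at z)"
  let ?W = "\<lambda>vs. dz_wedge I [] (map ?J vs)"
  define B where "B = second_deriv (\<lambda>z. \<phi> z $ j) z"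
  note hol = cholomorphic_on_component(1)[OF \<phi>, of j]
  have dJ: "((\<lambda>\<zeta>. frechet_derivative \<phi> (at (z + \<zeta> *s u)) v $ j) has_field_derivative B u v) (at 0)" for u v
  proof -
    have "((\<lambda>\<zeta>. frechet_derivative (\<lambda>z. \<phi> z $ j) (at (z + \<zeta> *s u)) v) has_field_derivative B u v) (at 0)"
      unfolding B_def by (rule has_second_deriv[OF S hol z])
    then show ?thesis
    proof (rule DERIV_cong_ev[OF refl _ refl, THEN iffD1, rotated])
      show "\<forall>\<^sub>F \<zeta> in nhds 0. frechet_derivative (\<lambda>z. \<phi> z $ j) (at (z + \<zeta> *s u)) v = frechet_derivative \<phi> (at (z + \<zeta> *s u)) v $ j"
        using eventually_line[OF S z, of u] by eventually_elim (rule cholomorphic_on_component(2)[OF \<phi>])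
    qed
  qed
  have B: "B u v = B v u" for u v unfolding B_def by (rule second_deriv_commute[OF S hol z])
  \<comment> \<open>Product rule on the Laplace expansion: either the new factor is differentiated,
    giving the second derivative \<open>B\<close>, or the remaining minor, giving
    \<open>X\<close>.\<close>
  define Y where "Y = (\<lambda>u vs. \<Sum>k<length vs. (-1) ^ k * (B u (vs ! k) * ?W (omit_nth k vs)
       + ?J (vs ! k) $ j * X u (omit_nth k vs)))"
  have "((\<lambda>\<zeta>. dz_wedge (j # I) [] (map (frechet_derivative \<phi> (at (z + \<zeta> *s u))) vs)) has_field_derivative Y u vs) (at 0)" for u vs
  proof -
    have "((\<lambda>\<zeta>. \<Sum>k<length vs. (-1) ^ k * (frechet_derivative \<phi> (at (z + \<zeta> *s u)) (vs ! k) $ j *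
        dz_wedge I [] (map (frechet_derivative \<phi> (at (z + \<zeta> *s u))) (omit_nth k vs)))) has_field_derivative Y u vs) (at 0)"
      unfolding Y_def
    proof (rule DERIV_sum)
      fix k
      show "((\<lambda>\<zeta>. (-1) ^ k * (frechet_derivative \<phi> (at (z + \<zeta> *s u)) (vs ! k) $ j *
        dz_wedge I [] (map (frechet_derivative \<phi> (at (z + \<zeta> *s u))) (omit_nth k vs)))) has_field_derivative
         (-1) ^ k * (B u (vs ! k) * ?W (omit_nth k vs) + ?J (vs ! k) $ j * X u (omit_nth k vs))) (at 0)"
        using DERIV_cmult[OF DERIV_mult[OF dJ[of u "vs ! k"] X(1)[of u "omit_nth k vs"]], of "(-1) ^ k"]
        by (simp add: algebra_simps)
    qed
    moreover have "dz_wedge (j # I) [] (map F vs) = (\<Sum>k<length vs. (-1) ^ k * (F (vs ! k) $ j *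
        dz_wedge I [] (map F (omit_nth k vs))))" for F :: "complex^'n \<Rightarrow> complex^'m"
      by (simp add: dz_wedge_Cons map_omit_nth)
    ultimately show ?thesis by simp
  qed
  moreover have "(\<Sum>i<length vs. (-1) ^ i * Y (vs ! i) (omit_nth i vs)) = 0" for vs
  proof -
    let ?n = "length vs"
    let ?T = "\<lambda>F. \<Sum>i<?n. (-1) ^ i * (\<Sum>k<?n - 1. (-1) ^ k * F (vs ! i) (omit_nth i vs ! k) (omit_nth k (omit_nth i vs)))"
    have "(\<Sum>i<?n. (-1) ^ i * Y (vs ! i) (omit_nth i vs)) =
       ?T (\<lambda>a b us. B a b * ?W us) + ?T (\<lambda>a b us. ?J b $ j * X a us)"
      by (simp add: Y_def sum.distrib distrib_left)
    \<comment> \<open>Exchanging the two deleted entries changes the sign, and the symmetry of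
      \<open>B\<close> restores the sum, which thus equals its own negative.\<close>
    moreover have "?T (\<lambda>a b us. B a b * ?W us) = 0"
    proof -
      have "?T (\<lambda>a b us. B a b * ?W us) = - ?T (\<lambda>a b us. B b a * ?W us)"
        by (rule sum_omit_nth_swap)
      also have "?T (\<lambda>a b us. B b a * ?W us) = ?T (\<lambda>a b us. B a b * ?W us)"
        unfolding B[of "vs ! _"] ..
      finally show ?thesis by (simp only: complex_eq_iff) simp
    qed
    \<comment> \<open>After the exchange the inner sum is the induction hypothesis for the list
      without its \<open>i\<close>-th entry.\<close>
    moreover have "?T (\<lambda>a b us. ?J b $ j * X a us) = - ?T (\<lambda>a b us. ?J a $ j * X b us)"
      by (rule sum_omit_nth_swap)
    moreover have "?T (\<lambda>a b us. ?J a $ j * X b us) =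
        (\<Sum>i<?n. (-1) ^ i * (?J (vs ! i) $ j * (\<Sum>k<length (omit_nth i vs). (-1) ^ k * X (omit_nth i vs ! k) (omit_nth k (omit_nth i vs)))))"
      by (auto simp: sum_distrib_left mult_ac intro!: sum.cong)
    ultimately show ?thesis by (simp only: X(2) mult_zero_right sum.neutral_const) simp
  qed
  ultimately show ?case by blast
qed

section \<open>Exterior derivative: type, naturality, holomorphy\<close>

definition hol_form :: "(complex^'n::finite) set \<Rightarrow> nat \<Rightarrow> (complex^'n \<Rightarrow> (complex^'n) list \<Rightarrow> complex) \<Rightarrow> bool" where
  "hol_form U p w \<longleftrightarrow> (\<forall>z\<in>U. p0_covector p (w z)) \<and> (\<forall>vs. hol_on U (\<lambda>z. w z vs))"

text \<open>For holomorphic coefficients the whole differential is of type \<open>(1,0)\<close>, so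
  this is \<open>del\<close> in one chart with no part to split off.\<close>

definition ext_deriv :: "(complex^'n::finite \<Rightarrow> (complex^'n) list \<Rightarrow> complex) \<Rightarrow> complex^'n \<Rightarrow> (complex^'n) list \<Rightarrow> complex" where
  "ext_deriv w z vs = (\<Sum>i<length vs. (-1) ^ i * frechet_derivative (\<lambda>z. w z (omit_nth i vs)) (at z) (vs ! i))"

text \<open>The \<open>dz_I\<close> are constant, so the derivative falls on the coefficients. Those
  of \<open>p0_covector_coeffs\<close> are values of \<open>w\<close> on fixed vectors, hence
  differentiable.\<close>

lemma frechet_derivative_hol_form:
  fixes w :: "complex^'n::finite \<Rightarrow> (complex^'n) list \<Rightarrow> complex"
  assumes U: "open U" "z \<in> U" and w: "hol_form U p w"
  shows "frechet_derivative (\<lambda>z. w z us) (at z) v =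
    (\<Sum>I | length I = p. frechet_derivative (\<lambda>z. w z (map (\<lambda>i. axis i 1) I)) (at z) v / fact p * dz_wedge I [] us)"
proof -
  let ?e = "\<lambda>I. map (\<lambda>i. axis i 1) I :: (complex^'n) list"
  have hol: "hol_on U (\<lambda>z. w z us)" for us using w by (auto simp: hol_form_def)
  have "((\<lambda>z. \<Sum>I | length I = p. w z (?e I) / fact p * dz_wedge I [] us) has_derivative
     (\<lambda>v. \<Sum>I | length I = p. frechet_derivative (\<lambda>z. w z (?e I)) (at z) v / fact p * dz_wedge I [] us)) (at z)"
    unfolding divide_inverse mult.assoc
    by (intro has_derivative_sum has_derivative_mult_left hol_onD(1)[OF hol U(2)])
  then have "((\<lambda>z. w z us) has_derivative
     (\<lambda>v. \<Sum>I | length I = p. frechet_derivative (\<lambda>z. w z (?e I)) (at z) v / fact p * dz_wedge I [] us)) (at z)"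
  proof (rule has_derivative_transform_within_open[OF _ U])
    fix x assume "x \<in> U"
    then have "p0_covector p (w x)" using w by (simp add: hol_form_def)
    from p0_covector_coeffs[OF this, of us]
    show "(\<Sum>I | length I = p. w x (?e I) / fact p * dz_wedge I [] us) = w x us" by (rule sym)
  qed
  from frechet_derivative_at[OF this] show ?thesis by (simp add: fun_eq_iff)
qed

lemma hol_on_clinear:
  assumes "hol_on U f" "z \<in> U"
  shows "clinear (frechet_derivative f (at z))"
  using hol_onD[OF assms] linear_add[OF has_derivative_linear[OF hol_onD(1)[OF assms]]]
  by (simp add: clinear_def)

lemma clinear_divide: "clinear L \<Longrightarrow> clinear (\<lambda>v. L v / c)"
  by (simp add: clinear_def add_divide_distrib)

lemma p0_covector_ext_deriv:
  assumes "open U" "z \<in> U" "hol_form U p w"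
  shows "p0_covector (Suc p) (ext_deriv w z)"
  unfolding ext_deriv_def
  by (rule p0_covector_wedge[where G="\<lambda>v us. frechet_derivative (\<lambda>z. w z us) (at z) v",
        OF frechet_derivative_hol_form[OF assms]])
     (use assms in \<open>auto simp: hol_form_def intro!: clinear_divide hol_on_clinear\<close>)

text \<open>Naturality of d. In the expansion of \<open>w\<close> the derivatives of the
  coefficients give the right-hand side; the derivatives of the pulled back \<open>dz_I\<close>
  cancel in the alternating sum by \<open>dz_wedge_pullback_closed\<close>.\<close>

lemma ext_deriv_pullback:
  fixes \<phi> :: "complex^'n::finite \<Rightarrow> complex^'n"
  assumes U: "open U" "z \<in> U" and V: "open V" "\<phi> ` U \<subseteq> V" and \<phi>: "cholomorphic_on U \<phi>"
    and w: "hol_form V p w" and w': "\<And>vs. hol_on U (\<lambda>z. w' z vs)"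
    and eq: "\<And>z vs. z \<in> U \<Longrightarrow> w' z vs = w (\<phi> z) (map (frechet_derivative \<phi> (at z)) vs)"
  shows "ext_deriv w' z vs = ext_deriv w (\<phi> z) (map (frechet_derivative \<phi> (at z)) vs)"
proof -
  let ?J = "\<lambda>z. frechet_derivative \<phi> (at z)"
  let ?e = "\<lambda>I. map (\<lambda>i. axis i 1) I :: (complex^'n) list"
  define a where "a = (\<lambda>I z. w z (?e I) / fact p)"
  have hol: "hol_on V (\<lambda>z. w z us)" for us using w by (auto simp: hol_form_def)
  have \<phi>z: "\<phi> z \<in> V" using U V by auto
  have "\<forall>I. \<exists>X. (\<forall>u vs. ((\<lambda>\<zeta>. dz_wedge I [] (map (?J (z + \<zeta> *s u)) vs)) has_field_derivative X u vs) (at 0)) \<and>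
             (\<forall>vs. (\<Sum>i<length vs. (-1) ^ i * X (vs ! i) (omit_nth i vs)) = 0)"
    using dz_wedge_pullback_closed[OF U(1) \<phi> U(2)] by blast
  then obtain X where X:
    "\<And>I u vs. ((\<lambda>\<zeta>. dz_wedge I [] (map (?J (z + \<zeta> *s u)) vs)) has_field_derivative X I u vs) (at 0)"
    "\<And>I vs. (\<Sum>i<length vs. (-1) ^ i * X I (vs ! i) (omit_nth i vs)) = 0"
    unfolding choice_iff by blast
  have da: "((\<lambda>\<zeta>. a I (\<phi> (z + \<zeta> *s u))) has_field_derivative
      frechet_derivative (\<lambda>z. w z (?e I)) (at (\<phi> z)) (?J z u) / fact p) (at 0)" for I u
  proof -
    have "((\<lambda>\<zeta>. z + \<zeta> *s u) has_derivative (\<lambda>\<zeta>. \<zeta> *s u)) (at 0)"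
      by (auto intro!: derivative_eq_intros)
    moreover have "(\<phi> has_derivative ?J z) (at (z + 0 *s u))"
      using cholomorphic_on_component(3)[OF \<phi> U(2)] by simp
    ultimately have "((\<lambda>\<zeta>. \<phi> (z + \<zeta> *s u)) has_derivative (\<lambda>\<zeta>. ?J z (\<zeta> *s u))) (at 0)"
      by (rule has_derivative_compose)
    moreover have "((\<lambda>z. w z (?e I)) has_derivative frechet_derivative (\<lambda>z. w z (?e I)) (at (\<phi> z))) (at (\<phi> (z + 0 *s u)))"
      using hol_onD(1)[OF hol \<phi>z] by simp
    ultimately have "((\<lambda>\<zeta>. w (\<phi> (z + \<zeta> *s u)) (?e I)) has_derivative
        (\<lambda>\<zeta>. frechet_derivative (\<lambda>z. w z (?e I)) (at (\<phi> z)) (?J z (\<zeta> *s u)))) (at 0)"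
      by (rule has_derivative_compose)
    then have "((\<lambda>\<zeta>. w (\<phi> (z + \<zeta> *s u)) (?e I)) has_field_derivative
        frechet_derivative (\<lambda>z. w z (?e I)) (at (\<phi> z)) (?J z u)) (at 0)"
      unfolding has_field_derivative_def
      by (rule has_derivative_eq_rhs)
         (simp add: fun_eq_iff cholomorphic_on_component(4)[OF \<phi> U(2)] hol_onD(2)[OF hol \<phi>z] mult.commute)
    then show ?thesis unfolding a_def by (rule DERIV_cdivide)
  qed
  have key: "frechet_derivative (\<lambda>z. w' z us) (at z) u =
      frechet_derivative (\<lambda>y. w y (map (?J z) us)) (at (\<phi> z)) (?J z u) +
      (\<Sum>I | length I = p. a I (\<phi> z) * X I u us)" for us u
  proof -
    have "((\<lambda>\<zeta>. w' (z + \<zeta> *s u) us) has_field_derivative frechet_derivative (\<lambda>z. w' z us) (at (z + 0 *s u)) u) (at 0)"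
      using U(2) by (intro hol_on_line[OF w']) simp
    moreover have "((\<lambda>\<zeta>. w' (z + \<zeta> *s u) us) has_field_derivative
      (\<Sum>I | length I = p. frechet_derivative (\<lambda>z. w z (?e I)) (at (\<phi> z)) (?J z u) / fact p *
          dz_wedge I [] (map (?J (z + 0 *s u)) us) + X I u us * a I (\<phi> (z + 0 *s u)))) (at 0)"
    proof (rule DERIV_cong_ev[OF refl _ refl, THEN iffD1, OF _ DERIV_sum[OF DERIV_mult[OF da X(1)]]])
      show "\<forall>\<^sub>F \<zeta> in nhds 0. (\<Sum>I | length I = p. a I (\<phi> (z + \<zeta> *s u)) * dz_wedge I [] (map (?J (z + \<zeta> *s u)) us)) = w' (z + \<zeta> *s u) us"
        using eventually_line[OF U, of u]
      proof eventually_elim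
        case (elim \<zeta>)
        then have "p0_covector p (w (\<phi> (z + \<zeta> *s u)))" using w V by (auto simp: hol_form_def)
        from p0_covector_coeffs[OF this, of "map (?J (z + \<zeta> *s u)) us"]
        show ?case by (simp add: eq[OF elim] a_def)
      qed
    qed
    ultimately have "frechet_derivative (\<lambda>z. w' z us) (at (z + 0 *s u)) u = (\<Sum>I | length I = p. frechet_derivative (\<lambda>z. w z (?e I)) (at (\<phi> z)) (?J z u) / fact p *
          dz_wedge I [] (map (?J (z + 0 *s u)) us) + X I u us * a I (\<phi> (z + 0 *s u)))"
      by (rule DERIV_unique)
    then have "frechet_derivative (\<lambda>z. w' z us) (at z) u = (\<Sum>I | length I = p. frechet_derivative (\<lambda>z. w z (?e I)) (at (\<phi> z)) (?J z u) / fact p *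
          dz_wedge I [] (map (?J z) us) + X I u us * a I (\<phi> z))"
      by simp
    then show ?thesis
      unfolding frechet_derivative_hol_form[OF V(1) \<phi>z w, of "map (?J z) us"]
      by (simp add: sum.distrib mult.commute)
  qed
  have "ext_deriv w' z vs = ext_deriv w (\<phi> z) (map (?J z) vs) +
     (\<Sum>i<length vs. (-1) ^ i * (\<Sum>I | length I = p. a I (\<phi> z) * X I (vs ! i) (omit_nth i vs)))"
    unfolding ext_deriv_def key by (simp add: distrib_left sum.distrib map_omit_nth)
  also have "(\<Sum>i<length vs. (-1) ^ i * (\<Sum>I | length I = p. a I (\<phi> z) * X I (vs ! i) (omit_nth i vs)))
     = (\<Sum>I | length I = p. a I (\<phi> z) * (\<Sum>i<length vs. (-1) ^ i * X I (vs ! i) (omit_nth i vs)))"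
    unfolding sum_distrib_left by (subst sum.swap) (simp add: mult_ac)
  also have "\<dots> = 0" by (simp add: X(2))
  finally show ?thesis by simp
qed

text \<open>This makes \<partial>w holomorphic. On a complex line its coefficient has a complex
  derivative, a combination of \<open>second_deriv\<close> terms, and this must agree with the real
  derivative assumed in \<open>d\<close>.\<close>

lemma ext_deriv_derivative_clinear:
  assumes U: "open U" "z \<in> U" and w: "hol_form U p w"
    and d: "(\<lambda>z. ext_deriv w z vs) differentiable (at z)"
  shows "frechet_derivative (\<lambda>z. ext_deriv w z vs) (at z) (c *s u) =
    c * frechet_derivative (\<lambda>z. ext_deriv w z vs) (at z) u"
proof -
  let ?f = "\<lambda>z. ext_deriv w z vs"
  let ?D = "frechet_derivative ?f (at z)"
  have hol: "hol_on U (\<lambda>z. w z us)" for us using w by (auto simp: hol_form_def)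
  define H where "H = (\<Sum>i<length vs. (-1) ^ i * second_deriv (\<lambda>z. w z (omit_nth i vs)) z u (vs ! i))"
  have "((\<lambda>\<zeta>. ?f (z + \<zeta> *s u)) has_field_derivative H) (at 0)"
    unfolding ext_deriv_def H_def
    by (intro DERIV_sum DERIV_cmult has_second_deriv[OF U(1) hol U(2)])
  moreover have "((\<lambda>\<zeta>. ?f (z + \<zeta> *s u)) has_derivative (\<lambda>\<zeta>. ?D (\<zeta> *s u))) (at 0)"
  proof -
    have "((\<lambda>\<zeta>. z + \<zeta> *s u) has_derivative (\<lambda>\<zeta>. \<zeta> *s u)) (at 0)"
      by (auto intro!: derivative_eq_intros)
    moreover have "(?f has_derivative ?D) (at (z + 0 *s u))"
      using d frechet_derivative_works by auto
    ultimately show ?thesis by (rule has_derivative_compose)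
  qed
  ultimately have "(*) H = (\<lambda>\<zeta>. ?D (\<zeta> *s u))"
    unfolding has_field_derivative_def by (rule has_derivative_unique)
  then have *: "?D (\<zeta> *s u) = H * \<zeta>" for \<zeta> by (simp add: fun_eq_iff)
  from *[of c] *[of 1] show ?thesis by simp
qed

section \<open>Integration by parts\<close>

text \<open>One derivative is all that integration by parts takes from a cut-off. Continuity is
  asked for one direction at a time, as derivatives enter the integrals only in this way.\<close>

definition C1_on :: "'v::real_normed_vector set \<Rightarrow> ('v \<Rightarrow> 'w::real_normed_vector) \<Rightarrow> bool" where
  "C1_on U g \<longleftrightarrow> (\<forall>z\<in>U. g differentiable (at z)) \<and>
     (\<forall>v. continuous_on U (\<lambda>z. frechet_derivative g (at z) v))"

lemma C1_onI:
  assumes "\<And>z. z \<in> U \<Longrightarrow> (g has_derivative g' z) (at z)" "\<And>v. continuous_on U (\<lambda>z. g' z v)"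
  shows "C1_on U g"
proof -
  have "frechet_derivative g (at z) = g' z" if "z \<in> U" for z
    by (rule frechet_derivative_at[OF assms(1)[OF that], symmetric])
  then show ?thesis
    using assms unfolding C1_on_def differentiable_def by (auto cong: continuous_on_cong)
qed

lemma C1_on_has_derivative:
  "C1_on U g \<Longrightarrow> z \<in> U \<Longrightarrow> (g has_derivative frechet_derivative g (at z)) (at z)"
  by (simp add: C1_on_def frechet_derivative_works)

lemma C1_on_derivative_continuous: "C1_on U g \<Longrightarrow> continuous_on U (\<lambda>z. frechet_derivative g (at z) v)"
  by (simp add: C1_on_def)

lemma C1_on_continuous: "C1_on U g \<Longrightarrow> continuous_on U g"
  by (auto intro!: continuous_at_imp_continuous_on has_derivative_continuous dest: C1_on_has_derivative)

lemma C1_on_const: "C1_on U (\<lambda>z. c)"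
  by (rule C1_onI[where g'="\<lambda>_ _. 0"]) auto

lemma C1_on_bounded_linear:
  assumes "bounded_linear L" "C1_on U g"
  shows "C1_on U (\<lambda>z. L (g z))"
  by (rule C1_onI[OF bounded_linear.has_derivative[OF assms(1) C1_on_has_derivative[OF assms(2)]]])
     (auto intro: bounded_linear.continuous_on[OF assms(1)] C1_on_derivative_continuous[OF assms(2)])

lemma C1_on_mult:
  fixes g h :: "'v::real_normed_vector \<Rightarrow> 'w::real_normed_algebra"
  assumes "C1_on U g" "C1_on U h"
  shows "C1_on U (\<lambda>z. g z * h z)"
  by (rule C1_onI[OF has_derivative_mult[OF C1_on_has_derivative[OF assms(1)] C1_on_has_derivative[OF assms(2)]]])
     (auto intro!: continuous_on_add continuous_on_mult C1_on_derivative_continuous[OF assms(1)]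
        C1_on_derivative_continuous[OF assms(2)] C1_on_continuous[OF assms(1)] C1_on_continuous[OF assms(2)])

lemma C1_on_sum:
  assumes "\<And>i. i \<in> I \<Longrightarrow> C1_on U (g i)"
  shows "C1_on U (\<lambda>z. \<Sum>i\<in>I. g i z)"
proof (rule C1_onI)
  show "((\<lambda>z. \<Sum>i\<in>I. g i z) has_derivative (\<lambda>v. \<Sum>i\<in>I. frechet_derivative (g i) (at z) v)) (at z)" if "z \<in> U" for z
    by (intro has_derivative_sum C1_on_has_derivative[OF assms that])
  show "continuous_on U (\<lambda>z. \<Sum>i\<in>I. frechet_derivative (g i) (at z) v)" for v
    by (intro continuous_on_sum C1_on_derivative_continuous assms)
qed

lemma C1_on_inverse:
  fixes g :: "'v::real_normed_vector \<Rightarrow> real"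
  assumes "C1_on U g" "\<And>z. z \<in> U \<Longrightarrow> g z \<noteq> 0"
  shows "C1_on U (\<lambda>z. inverse (g z))"
  by (rule C1_onI[OF Deriv.has_derivative_inverse[OF assms(2) C1_on_has_derivative[OF assms(1)]]])
     (auto intro!: continuous_on_minus continuous_on_mult continuous_on_inverse C1_on_derivative_continuous[OF assms(1)]
        C1_on_continuous[OF assms(1)] simp: assms(2))

lemma C1_on_cong:
  assumes "open U" "\<And>z. z \<in> U \<Longrightarrow> g z = h z" "C1_on U g"
  shows "C1_on U h"
  by (rule C1_onI[OF has_derivative_transform_within_open[OF C1_on_has_derivative[OF assms(3)] assms(1) _ assms(2)]])
     (auto intro: C1_on_derivative_continuous[OF assms(3)])

lemma C1_on_Un:
  assumes "open U" "open V" "C1_on U g" "C1_on V g"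
  shows "C1_on (U \<union> V) g"
  using assms by (auto simp: C1_on_def intro!: continuous_on_open_Un)

lemma frechet_derivative_zero:
  assumes "open U" "z \<in> U" "\<And>z. z \<in> U \<Longrightarrow> g z = 0"
  shows "frechet_derivative g (at z) v = 0"
proof -
  have "(g has_derivative (\<lambda>_. 0)) (at z)"
    by (rule has_derivative_transform_within_open[OF has_derivative_const[of 0] assms(1,2)]) (simp add: assms(3))
  from frechet_derivative_at[OF this] show ?thesis by metis
qed

text \<open>The open sets \<open>U\<close> and \<open>- K\<close> cover the space, and on the second
  one the extension is zero.\<close>

lemma continuous_on_extend_zero:
  fixes g :: "'v::t2_space \<Rightarrow> 'w::real_normed_vector"
  assumes "open U" "compact K" "K \<subseteq> U" "continuous_on U g" "\<And>z. z \<in> U - K \<Longrightarrow> g z = 0"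
  shows "continuous_on UNIV (\<lambda>z. if z \<in> U then g z else 0)"
proof -
  have "open (- K)" using assms(2) by (simp add: compact_imp_closed open_Compl)
  moreover have "continuous_on U (\<lambda>z. if z \<in> U then g z else 0)"
    using assms(4) by (rule continuous_on_eq) simp
  moreover have "continuous_on (- K) (\<lambda>z. if z \<in> U then g z else 0)"
    by (rule continuous_on_eq[OF continuous_on_const[of _ 0]]) (use assms(5) in auto)
  ultimately have "continuous_on (U \<union> - K) (\<lambda>z. if z \<in> U then g z else 0)"
    using assms(1) by (intro continuous_on_open_Un)
  moreover have "U \<union> - K = UNIV" using assms(3) by auto
  ultimately show ?thesis by simp
qed

lemma integrable_extend_zero:
  fixes g :: "'v::euclidean_space \<Rightarrow> 'w::{banach, second_countable_topology}"
  assumes "open U" "compact K" "K \<subseteq> U" "continuous_on U g" "\<And>z. z \<in> U - K \<Longrightarrow> g z = 0"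
  shows "integrable lborel (\<lambda>z. if z \<in> U then g z else 0)"
  by (rule integrable_continuous_compact_support[OF assms(2) continuous_on_extend_zero[OF assms]])
     (use assms(5) in auto)

text \<open>Brings the vanishing integral to functions known only in a chart image: as the support
  lies in \<open>K\<close>, extension by zero stays differentiable across the boundary of
  \<open>U\<close>.\<close>

lemma integral_derivative_extend_zero:
  fixes g :: "'v::euclidean_space \<Rightarrow> 'w::{banach, second_countable_topology}"
  assumes "open U" "compact K" "K \<subseteq> U" "C1_on U g" "\<And>z. z \<in> U - K \<Longrightarrow> g z = 0"
  shows "integrable lborel (\<lambda>z. if z \<in> U then frechet_derivative g (at z) v else 0)"
    and "integral\<^sup>L lborel (\<lambda>z. if z \<in> U then frechet_derivative g (at z) v else 0) = 0"
proof -
  have oK: "open (- K)" using assms(2) by (simp add: compact_imp_closed open_Compl)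
  have oUK: "open (U - K)" using assms(1,2) by (simp add: compact_imp_closed open_Diff)
  have z: "frechet_derivative g (at z) v = 0" if "z \<in> U - K" for z v
    by (rule frechet_derivative_zero[OF oUK that assms(5)])
  note c = assms(1-3) C1_on_derivative_continuous[OF assms(4), of v] z
  show "integrable lborel (\<lambda>z. if z \<in> U then frechet_derivative g (at z) v else 0)"
    by (rule integrable_extend_zero[OF c])
  define g' where "g' = (\<lambda>z v. if z \<in> U then frechet_derivative g (at z) v else 0)"
  have "((\<lambda>z. if z \<in> U then g z else 0) has_derivative g' z) (at z)" for z
  proof (cases "z \<in> U")
    case True
    then have "g' z = frechet_derivative g (at z)" by (simp add: g'_def)
    then show ?thesis
      using has_derivative_transform_within_open[OF C1_on_has_derivative[OF assms(4) True] assms(1) True]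
      by simp
  next
    case False
    then have "g' z = (\<lambda>_. 0)" by (simp add: g'_def)
    moreover have "z \<in> - K" using False assms(3) by auto
    ultimately show ?thesis
      by (simp only:) (rule has_derivative_transform_within_open[OF has_derivative_const[of 0] oK],
          use assms(5) in auto)
  qed
  then have "integral\<^sup>L lborel (\<lambda>z. g' z v) = 0"
    by (rule integral_derivative_compact_support[OF assms(2), rotated])
       (use continuous_on_extend_zero[OF c] assms(5) in \<open>auto simp: g'_def\<close>)
  then show "integral\<^sup>L lborel (\<lambda>z. if z \<in> U then frechet_derivative g (at z) v else 0) = 0"
    by (simp add: g'_def)
qed

section \<open>Wedge with the \<open>(1,0)\<close>-part of the differential of a real
  cut-off\<close>

definition partial_fun :: "(complex^'n::finite \<Rightarrow> real) \<Rightarrow> complex^'n \<Rightarrow> complex^'n \<Rightarrow> complex" where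
  "partial_fun g z v = (of_real (frechet_derivative g (at z) v) - \<i> * of_real (frechet_derivative g (at z) (\<i> *s v))) / 2"

definition partial_wedge ::
    "(complex^'n::finite \<Rightarrow> real) \<Rightarrow> (complex^'n \<Rightarrow> (complex^'n) list \<Rightarrow> complex) \<Rightarrow> complex^'n \<Rightarrow> (complex^'n) list \<Rightarrow> complex" where
  "partial_wedge g w z vs = (\<Sum>i<length vs. (-1) ^ i * (partial_fun g z (vs ! i) * w z (omit_nth i vs)))"

lemma hol_on_C1_on: "open U \<Longrightarrow> hol_on U f \<Longrightarrow> C1_on U f"
  unfolding C1_on_def
  by (auto simp: differentiable_def intro: hol_onD(1) hol_on_derivative_continuous)

lemma continuous_on_partial_wedge:
  assumes "open U" "C1_on U g" "hol_form U p w"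
  shows "continuous_on U (\<lambda>z. partial_wedge g w z vs)"
  unfolding partial_wedge_def partial_fun_def
  by (intro continuous_intros C1_on_derivative_continuous[OF assms(2)] hol_on_continuous_on)
     (use assms(3) in \<open>auto simp: hol_form_def\<close>)

lemma partial_wedge_zero:
  assumes "open U" "z \<in> U" "\<And>z. z \<in> U \<Longrightarrow> g z = 0"
  shows "partial_wedge g w z vs = 0"
  by (simp add: partial_wedge_def partial_fun_def frechet_derivative_zero[OF assms])

text \<open>The factor \<open>cnj (\<partial>w)\<close> is antiholomorphic, so \<open>\<partial>\<close> does not act on it.\<close>

lemma integral_ext_deriv_by_parts:
  fixes w :: "complex^'n::finite \<Rightarrow> (complex^'n) list \<Rightarrow> complex" and \<rho> :: "complex^'n \<Rightarrow> real"
  assumes U: "open U" and K: "compact K" "K \<subseteq> U" and \<rho>: "C1_on U \<rho>" "\<And>z. z \<in> U - K \<Longrightarrow> \<rho> z = 0"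
    and w: "hol_form U p w" and f: "C1_on U (\<lambda>z. ext_deriv w z es)"
  shows "integral\<^sup>L lborel (\<lambda>z. if z \<in> U then \<rho> z * (norm (ext_deriv w z es))\<^sup>2 else 0) =
       - integral\<^sup>L lborel (\<lambda>z. if z \<in> U then Re (partial_wedge \<rho> w z es * cnj (ext_deriv w z es)) else 0)"
proof -
  let ?f = "\<lambda>z. ext_deriv w z es"
  define W where "W = (\<lambda>i z. w z (omit_nth i es))"
  define G where "G = (\<lambda>i z. (complex_of_real (\<rho> z) * W i z) * cnj (?f z))"
  have hol: "hol_on U (W i)" for i using w by (auto simp: hol_form_def W_def)
  have C\<rho>: "C1_on U (\<lambda>z. complex_of_real (\<rho> z))" by (rule C1_on_bounded_linear[OF bounded_linear_of_real \<rho>(1)])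
  have Cf: "C1_on U (\<lambda>z. cnj (?f z))" by (rule C1_on_bounded_linear[OF bounded_linear_cnj f])
  have CG: "C1_on U (G i)" for i
    unfolding G_def by (intro C1_on_mult C\<rho> hol_on_C1_on[OF U hol] Cf)
  have G0: "G i z = 0" if "z \<in> U - K" for i z using \<rho>(2)[OF that] by (simp add: G_def)
  note intG = integral_derivative_extend_zero[OF U K CG G0]
  define DG where "DG = (\<lambda>i v z. if z \<in> U then frechet_derivative (G i) (at z) v else 0)"
  have iDG1: "integrable lborel (DG i v)" for i v unfolding DG_def by (rule intG(1))
  have iDG2: "integral\<^sup>L lborel (DG i v) = 0" for i v unfolding DG_def using intG(2) .
  note iDG = iDG1 iDG2
  \<comment> \<open>Antisymmetrised \<open>(1,0)\<close>-derivatives of the \<open>G i\<close>. Once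
    the conjugate factor is seen to drop out, this is the coefficient of
    \<open>\<partial>(\<rho> w)\<close> times the conjugate of that of \<open>\<partial>w\<close>,
    and its integral is zero.\<close>
  define T where "T = (\<lambda>z. \<Sum>i<length es. (-1) ^ i * ((DG i (es ! i) z - \<i> * DG i (\<i> *s es ! i) z) / 2))"
  have iTi: "integrable lborel (\<lambda>z. (-1) ^ i * ((DG i (es ! i) z - \<i> * DG i (\<i> *s es ! i) z) / 2))" for i
    by (intro integrable_mult_right integrable_divide Bochner_Integration.integrable_diff iDG1)
  have iT: "integrable lborel T" unfolding T_def by (intro Bochner_Integration.integrable_sum iTi)
  have "integral\<^sup>L lborel T = (\<Sum>i<length es. integral\<^sup>L lborel (\<lambda>z. (-1) ^ i * ((DG i (es ! i) z - \<i> * DG i (\<i> *s es ! i) z) / 2)))"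
    unfolding T_def by (rule Bochner_Integration.integral_sum) (rule iTi)
  also have "\<dots> = 0" by (rule sum.neutral) (simp add: iDG)
  finally have T0: "integral\<^sup>L lborel T = 0" .
  define a where "a = (\<lambda>z. if z \<in> U then \<rho> z * (norm (?f z))\<^sup>2 else 0)"
  define b where "b = (\<lambda>z. if z \<in> U then Re (partial_wedge \<rho> w z es * cnj (?f z)) else 0)"
  have oUK: "open (U - K)" using U K by (simp add: compact_imp_closed open_Diff)
  have pw0: "partial_wedge \<rho> w z es = 0" if "z \<in> U" "z \<notin> K" for z
    by (rule partial_wedge_zero[OF oUK _ \<rho>(2)]) (use that in auto)
  have ia: "integrable lborel a"
    unfolding a_def
    by (rule integrable_extend_zero[OF U K])
       (auto intro!: continuous_on_mult continuous_on_power continuous_on_norm C1_on_continuous[OF \<rho>(1)]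
          C1_on_continuous[OF f] simp: \<rho>(2))
  have ib: "integrable lborel b"
    unfolding b_def
    by (rule integrable_extend_zero[OF U K])
       (auto intro!: continuous_on_Re continuous_on_mult continuous_on_cnj
          continuous_on_partial_wedge[OF U \<rho>(1) w] C1_on_continuous[OF f]
          simp: pw0 simp del: times_complex.sel)
  have "Re (T z) = a z + b z" for z
  proof (cases "z \<in> U")
    case True
    have D: "frechet_derivative (G i) (at z) v = complex_of_real (\<rho> z) * W i z * cnj (frechet_derivative ?f (at z) v)
      + (complex_of_real (\<rho> z) * frechet_derivative (W i) (at z) v +
         complex_of_real (frechet_derivative \<rho> (at z) v) * W i z) * cnj (?f z)" for i v
    proof -
      have "(G i has_derivative (\<lambda>v. complex_of_real (\<rho> z) * W i z * cnj (frechet_derivative ?f (at z) v)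
        + (complex_of_real (\<rho> z) * frechet_derivative (W i) (at z) v +
         complex_of_real (frechet_derivative \<rho> (at z) v) * W i z) * cnj (?f z))) (at z)"
        unfolding G_def
        by (intro has_derivative_mult hol_onD(1)[OF hol True]
             bounded_linear.has_derivative[OF bounded_linear_of_real C1_on_has_derivative[OF \<rho>(1) True]]
             bounded_linear.has_derivative[OF bounded_linear_cnj C1_on_has_derivative[OF f True]])
      from fun_cong[OF frechet_derivative_at[OF this], of v] show ?thesis by (rule sym)
    qed
    have fi: "frechet_derivative ?f (at z) (\<i> *s v) = \<i> * frechet_derivative ?f (at z) v" for v
      using f True by (intro ext_deriv_derivative_clinear[OF U True w]) (auto simp: C1_on_def)
    have "(DG i v z - \<i> * DG i (\<i> *s v) z) / 2 = (partial_fun \<rho> z v * W i z + complex_of_real (\<rho> z) * frechet_derivative (W i) (at z) v) * cnj (?f z)" for i v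
    proof -
      \<comment> \<open>Stated for a variable \<open>j\<close> in place of \<i>, so that only
        \<open>j * j = -1\<close> enters. The terms in \<open>d\<close>, the derivative of the
        conjugate factor, cancel; those in \<open>e\<close>, from the holomorphic factor,
        double.\<close>
      have alg: "(c * x * d + (c * e + r * x) * f) - j * (c * x * (- j * d) + (c * (j * e) + r' * x) * f) =
          ((r - j * r') * x + 2 * (c * e)) * f"
        if "j * j = -1" for c x d e r r' f j :: complex
      proof -
        have "(c * x * d + (c * e + r * x) * f) - j * (c * x * (- j * d) + (c * (j * e) + r' * x) * f) =
          ((r - j * r') * x + 2 * (c * e)) * f + (j * j + 1) * (c * x * d - c * e * f)"
          by (simp add: algebra_simps)
        then show ?thesis by (simp add: that)
      qed
      let ?c = "complex_of_real (\<rho> z)" and ?d = "cnj (frechet_derivative ?f (at z) v)"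
        and ?e = "frechet_derivative (W i) (at z) v" and ?F = "cnj (?f z)"
        and ?r = "complex_of_real (frechet_derivative \<rho> (at z) v)"
        and ?r' = "complex_of_real (frechet_derivative \<rho> (at z) (\<i> *s v))"
      have 1: "DG i v z = ?c * W i z * ?d + (?c * ?e + ?r * W i z) * ?F"
        using True by (simp add: DG_def D)
      have 2: "DG i (\<i> *s v) z = ?c * W i z * (- \<i> * ?d) + (?c * (\<i> * ?e) + ?r' * W i z) * ?F"
        using True by (simp add: DG_def D fi hol_onD(2)[OF hol True])
      have 3: "DG i v z - \<i> * DG i (\<i> *s v) z = ((?r - \<i> * ?r') * W i z + 2 * (?c * ?e)) * ?F"
        unfolding 1 2 by (rule alg) simp
      show ?thesis unfolding 3 partial_fun_def by (simp add: field_simps)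
    qed
    then have "T z = (\<Sum>i<length es. (-1) ^ i * ((partial_fun \<rho> z (es ! i) * W i z + complex_of_real (\<rho> z) * frechet_derivative (W i) (at z) (es ! i)) * cnj (?f z)))"
      by (simp add: T_def)
    also have "\<dots> = (\<Sum>i<length es. (-1) ^ i * (partial_fun \<rho> z (es ! i) * W i z)) * cnj (?f z)
       + complex_of_real (\<rho> z) * (\<Sum>i<length es. (-1) ^ i * frechet_derivative (W i) (at z) (es ! i)) * cnj (?f z)"
      by (simp add: sum_distrib_left sum_distrib_right sum.distrib[symmetric] algebra_simps)
    also have "\<dots> = partial_wedge \<rho> w z es * cnj (?f z) + complex_of_real (\<rho> z) * ?f z * cnj (?f z)"
      by (simp add: partial_wedge_def W_def ext_deriv_def)
    also have "complex_of_real (\<rho> z) * ?f z * cnj (?f z) = complex_of_real (\<rho> z * (norm (?f z))\<^sup>2)"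
      unfolding of_real_mult complex_norm_square by simp
    finally show ?thesis using True by (simp add: a_def b_def)
  qed (simp add: T_def DG_def a_def b_def)
  then have "integral\<^sup>L lborel a + integral\<^sup>L lborel b = integral\<^sup>L lborel (\<lambda>z. Re (T z))"
    using Bochner_Integration.integral_add[OF ia ib] by simp
  also have "\<dots> = 0" using integral_Re[OF iT] T0 by simp
  finally show ?thesis by (simp add: a_def b_def)
qed

text \<open>The derivative of \<open>g\<close> itself is only real linear; combining its values at
  \<open>v\<close> and at \<i> times \<open>v\<close> extracts a complex linear part.\<close>

lemma clinear_partial_fun:
  assumes "g differentiable (at z)"
  shows "clinear (partial_fun g z)"
proof -
  note lin = linear_frechet_derivative[OF assms]
  let ?D = "frechet_derivative g (at z)"
  have split: "c *s v = Re c *\<^sub>R v + Im c *\<^sub>R (\<i> *s v)" for c and v :: "complex^'a"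
    by (simp add: Finite_Cartesian_Product.vec_eq_iff complex_eq_iff)
  have e1: "?D (c *s v) = Re c * ?D v + Im c * ?D (\<i> *s v)" for c v
    by (subst split) (simp add: linear_add[OF lin] linear_cmul[OF lin])
  have e2: "?D (\<i> *s (c *s v)) = Re c * ?D (\<i> *s v) - Im c * ?D v" for c v
  proof -
    have "\<i> *s (c *s v) = Re c *\<^sub>R (\<i> *s v) + (- Im c) *\<^sub>R v"
      by (simp add: Finite_Cartesian_Product.vec_eq_iff complex_eq_iff)
    then show ?thesis by (simp only: linear_add[OF lin] linear_cmul[OF lin]) simp
  qed
  have "partial_fun g z (c *s v) = c * partial_fun g z v" for c v
    unfolding partial_fun_def e1[of c v] e2[of c v] by (simp only: complex_eq_iff) (simp add: field_simps)
  moreover have "partial_fun g z (v + u) = partial_fun g z v + partial_fun g z u" for u v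
    unfolding partial_fun_def vector_add_ldistrib linear_add[OF lin] of_real_add
    by (simp only: complex_eq_iff) (simp add: field_simps)
  ultimately show ?thesis unfolding clinear_def by blast
qed

lemma p0_covector_partial_wedge:
  assumes "g differentiable (at z)" "p0_covector p (w z)"
  shows "p0_covector (Suc p) (partial_wedge g w z)"
proof -
  obtain a where a: "\<And>vs. w z vs = (\<Sum>I | length I = p. a I * dz_wedge I [] vs)"
    using assms(2) by (auto simp: p0_covector_def)
  have "clinear (\<lambda>v. partial_fun g z v * a I)" for I
    using clinear_partial_fun[OF assms(1)] by (simp add: clinear_def algebra_simps)
  then show ?thesis
    unfolding partial_wedge_def
    by (intro p0_covector_wedge[where b="\<lambda>I v. partial_fun g z v * a I" and G="\<lambda>v us. partial_fun g z v * w z us"])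
       (auto simp: a sum_distrib_left mult.assoc)
qed

text \<open>Squaring removes the kink at 0. This is the profile of the C^1 bump.\<close>

lemma has_real_derivative_max_power2:
  "((\<lambda>s::real. (max 0 s)\<^sup>2) has_real_derivative 2 * max 0 s) (at s)"
proof -
  consider "s > 0" | "s < 0" | "s = 0" by linarith
  then show ?thesis
  proof cases
    case 1
    have "((\<lambda>s::real. s\<^sup>2) has_real_derivative 2 * max 0 s) (at s)"
      using 1 by (auto intro!: derivative_eq_intros)
    then show ?thesis
      by (rule DERIV_cong_ev[OF refl _ refl, THEN iffD1, rotated])
         (use 1 eventually_nhds_in_open[of "{0<..}" s] in \<open>auto elim!: eventually_mono\<close>)
  next
    case 2
    have "((\<lambda>s::real. 0) has_real_derivative 2 * max 0 s) (at s)"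
      using 2 by (auto intro!: derivative_eq_intros)
    then show ?thesis
      by (rule DERIV_cong_ev[OF refl _ refl, THEN iffD1, rotated])
         (use 2 eventually_nhds_in_open[of "{..<0}" s] in \<open>auto elim!: eventually_mono\<close>)
  next
    case 3
    have "((\<lambda>h::real. (max 0 h)\<^sup>2 / h) \<longlongrightarrow> 0) (at 0)"
    proof (rule Lim_null_comparison)
      show "\<forall>\<^sub>F h in at 0. norm ((max 0 h)\<^sup>2 / h) \<le> \<bar>h\<bar>"
        by (rule always_eventually) (auto simp: max_def power2_eq_square)
      show "((\<lambda>h::real. \<bar>h\<bar>) \<longlongrightarrow> 0) (at 0)" by (intro tendsto_eq_intros) auto
    qed
    then show ?thesis by (simp add: 3 DERIV_def)
  qed
qed

lemma cholomorphic_derivative_continuous: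
  assumes "open S" "cholomorphic_on S \<phi>"
  shows "continuous_on S (\<lambda>z. frechet_derivative \<phi> (at z) v)"
proof -
  have "continuous_on S (\<lambda>z. frechet_derivative \<phi> (at z) v $ j)" for j
    by (rule continuous_on_eq[OF hol_on_derivative_continuous[OF assms(1) cholomorphic_on_component(1)[OF assms(2), of j], of v]])
       (rule cholomorphic_on_component(2)[OF assms(2)])
  then have "continuous_on S (\<lambda>z. \<chi> j. frechet_derivative \<phi> (at z) v $ j)"
    by (rule continuous_on_vec_lambda)
  then show ?thesis by simp
qed

section \<open>Holomorphic forms on complex manifolds\<close>

locale catlas =
  fixes A :: "('a::t2_space, 'n::finite) chart set"
  assumes atlas: "complex_atlas A"
begin

abbreviation chart_inv :: "('a, 'n) chart \<Rightarrow> complex^'n \<Rightarrow> 'a" where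
  "chart_inv c \<equiv> inv_into (fst c) (snd c)"

definition overlap :: "('a, 'n) chart \<Rightarrow> ('a, 'n) chart \<Rightarrow> (complex^'n) set" where
  "overlap c d = snd c ` (fst c \<inter> fst d)"

lemma chart:
  assumes "c \<in> A"
  shows "open (fst c)" "open (chart_image c)" "continuous_on (chart_image c) (chart_inv c)" "continuous_on (fst c) (snd c)"
    "x \<in> fst c \<Longrightarrow> snd c x \<in> chart_image c" "x \<in> fst c \<Longrightarrow> chart_inv c (snd c x) = x"
    "z \<in> chart_image c \<Longrightarrow> chart_inv c z \<in> fst c" "z \<in> chart_image c \<Longrightarrow> snd c (chart_inv c z) = z"
proof -
  have "complex_chart c" using atlas assms by (auto simp: complex_atlas_def)
  then have o: "open (fst c)" "open (chart_image c)"
    and h: "homeomorphism (fst c) (chart_image c) (snd c) (chart_inv c)"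
    by (auto simp: complex_chart_def)
  show "open (fst c)" "open (chart_image c)" by (fact o)+
  show "continuous_on (chart_image c) (chart_inv c)" "continuous_on (fst c) (snd c)"
    using h by (auto simp: homeomorphism_def)
  show "x \<in> fst c \<Longrightarrow> snd c x \<in> chart_image c" "x \<in> fst c \<Longrightarrow> chart_inv c (snd c x) = x"
    "z \<in> chart_image c \<Longrightarrow> chart_inv c z \<in> fst c" "z \<in> chart_image c \<Longrightarrow> snd c (chart_inv c z) = z"
    using h by (auto simp: homeomorphism_def)
qed

lemma overlap_iff: "c \<in> A \<Longrightarrow> z \<in> overlap c d \<longleftrightarrow> z \<in> chart_image c \<and> chart_inv c z \<in> fst d"
  unfolding overlap_def by (auto simp: chart intro!: image_eqI[of z "snd c" "chart_inv c z"])

lemma open_preimage: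
  assumes "c \<in> A" "open W"
  shows "open {z \<in> chart_image c. chart_inv c z \<in> W}"
proof -
  have "open (chart_image c \<inter> chart_inv c -` W)"
    using chart(2,3)[OF assms(1)] assms(2) by (simp add: continuous_open_preimage)
  then show ?thesis by (simp add: vimage_def Int_def)
qed

lemma open_overlap:
  assumes "c \<in> A" "d \<in> A"
  shows "open (overlap c d)"
proof -
  have "overlap c d = {z \<in> chart_image c. chart_inv c z \<in> fst d}"
    using overlap_iff[OF assms(1)] by blast
  then show ?thesis using open_preimage[OF assms(1) chart(1)[OF assms(2)]] by simp
qed

lemma transition_hol: "c \<in> A \<Longrightarrow> d \<in> A \<Longrightarrow> cholomorphic_on (overlap c d) (transition c d)"
  using atlas by (auto simp: complex_atlas_def overlap_def)

lemma transition:
  assumes "c \<in> A" "d \<in> A" "z \<in> overlap c d"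
  shows "transition c d z \<in> overlap d c" "transition d c (transition c d z) = z"
    "chart_inv d (transition c d z) = chart_inv c z"
  using assms by (auto simp: overlap_iff transition_def chart)

section \<open>Cut-off functions and partitions of unity\<close>

definition C1_fun :: "('a \<Rightarrow> real) \<Rightarrow> bool" where
  "C1_fun g \<longleftrightarrow> (\<forall>c\<in>A. C1_on (chart_image c) (\<lambda>z. g (chart_inv c z)))"

lemma C1_funD: "C1_fun g \<Longrightarrow> c \<in> A \<Longrightarrow> C1_on (chart_image c) (\<lambda>z. g (chart_inv c z))"
  by (simp add: C1_fun_def)

text \<open>Chain rule; the Jacobian of a transition map commutes with multiplication by \<i> and so
  respects \<open>(1,0)\<close>-parts.\<close>

lemma partial_fun_transition:
  assumes "C1_fun g" "c \<in> A" "d \<in> A" "z \<in> overlap c d"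
  shows "partial_fun (\<lambda>z. g (chart_inv c z)) z v =
    partial_fun (\<lambda>z. g (chart_inv d z)) (transition c d z) (frechet_derivative (transition c d) (at z) v)"
proof -
  let ?\<phi> = "transition c d"
  note hol = transition_hol[OF assms(2,3)]
  have "?\<phi> z \<in> chart_image d" using transition(1)[OF assms(2-4)] assms(3) by (simp add: overlap_iff)
  from has_derivative_compose[OF cholomorphic_on_component(3)[OF hol assms(4)]
      C1_on_has_derivative[OF C1_funD[OF assms(1,3)] this]]
  have "((\<lambda>z. g (chart_inv d (?\<phi> z))) has_derivative (\<lambda>v. frechet_derivative (\<lambda>z. g (chart_inv d z)) (at (?\<phi> z))
      (frechet_derivative ?\<phi> (at z) v))) (at z)" .
  then have "((\<lambda>z. g (chart_inv c z)) has_derivative (\<lambda>v. frechet_derivative (\<lambda>z. g (chart_inv d z)) (at (?\<phi> z))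
      (frechet_derivative ?\<phi> (at z) v))) (at z)"
    by (rule has_derivative_transform_within_open[OF _ open_overlap[OF assms(2,3)] assms(4)])
       (simp add: transition(3)[OF assms(2,3)])
  from fun_cong[OF frechet_derivative_at[OF this]]
  show ?thesis
    by (simp only: partial_fun_def cholomorphic_on_component(4)[OF hol assms(4), symmetric])
qed

text \<open>The squared positive part of \<open>r\<^sup>2 - |y - p|\<^sup>2\<close> in a chart
  around \<open>x\<close>, extended by zero. The space is Hausdorff, so the compact \<open>K\<close>
  is closed, and in any other chart \<open>g\<close> is glued from its C^1 expression on the overlap
  and from zero off \<open>K\<close>.\<close>

lemma bump:
  obtains c K W and g :: "'a \<Rightarrow> real"
  where "c \<in> A" "compact K" "K \<subseteq> fst c" "open W" "x \<in> W" "\<And>y. y \<in> W \<Longrightarrow> g y > 0"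
    "\<And>y. g y \<ge> 0" "\<And>y. y \<notin> K \<Longrightarrow> g y = 0" "C1_fun g"
proof -
  obtain c where c: "c \<in> A" "x \<in> fst c" using atlas unfolding complex_atlas_def by blast
  define p where "p = snd c x"
  have "p \<in> chart_image c" using c by (simp add: p_def chart)
  then obtain r where r: "r > 0" "cball p r \<subseteq> chart_image c"
    using chart(2)[OF c(1)] open_contains_cball by blast
  define B where "B = (\<lambda>y. (max 0 (r\<^sup>2 - (y - p) \<bullet> (y - p)))\<^sup>2)"
  define B' where "B' = (\<lambda>y v. (2 * max 0 (r\<^sup>2 - (y - p) \<bullet> (y - p))) * (- 2 * ((y - p) \<bullet> v)))"
  have dB: "(B has_derivative B' y) (at y)" for y
  proof -
    have "((\<lambda>y. r\<^sup>2 - (y - p) \<bullet> (y - p)) has_derivative (\<lambda>v. - 2 * ((y - p) \<bullet> v))) (at y)"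
      by (auto intro!: derivative_eq_intros simp: inner_commute)
    from has_derivative_compose[OF this has_real_derivative_max_power2[unfolded has_field_derivative_def]]
    show ?thesis unfolding B_def B'_def by simp
  qed
  have Bnz: "B y > 0 \<longleftrightarrow> y \<in> ball p r" for y
  proof -
    have "dist p y = norm (y - p)" by (metis dist_commute dist_norm)
    then have 1: "(y - p) \<bullet> (y - p) = (dist p y)\<^sup>2" by (simp only: power2_norm_eq_inner)
    have 2: "(dist p y)\<^sup>2 < r\<^sup>2 \<longleftrightarrow> dist p y < r"
    proof
      show "(dist p y)\<^sup>2 < r\<^sup>2 \<Longrightarrow> dist p y < r" using r(1) by (auto intro: power2_less_imp_less)
      show "dist p y < r \<Longrightarrow> (dist p y)\<^sup>2 < r\<^sup>2" by (rule power_strict_mono) auto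
    qed
    have 3: "(max 0 s)\<^sup>2 > 0 \<longleftrightarrow> s > 0" for s :: real by (auto simp: max_def)
    show ?thesis unfolding B_def 3 1 mem_ball diff_gt_0_iff_gt by (rule 2)
  qed
  define K where "K = chart_inv c ` cball p r"
  have K: "compact K" unfolding K_def
    by (intro compact_continuous_image continuous_on_subset[OF chart(3)[OF c(1)] r(2)] compact_cball)
  have Kc: "K \<subseteq> fst c" using r(2) chart(7)[OF c(1)] by (auto simp: K_def)
  define g where "g = (\<lambda>y. if y \<in> fst c then B (snd c y) else 0)"
  have g0: "g y = 0" if "y \<notin> K" for y
  proof (cases "y \<in> fst c")
    case True
    have "snd c y \<notin> cball p r"
    proof
      assume "snd c y \<in> cball p r"
      then have "chart_inv c (snd c y) \<in> K" unfolding K_def by blast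
      then show False using True that chart(6)[OF c(1)] by simp
    qed
    then have "\<not> B (snd c y) > 0" unfolding Bnz by auto
    moreover have "B (snd c y) \<ge> 0" by (simp add: B_def)
    ultimately show ?thesis using True by (simp add: g_def)
  qed (simp add: g_def)
  have "C1_fun g"
    unfolding C1_fun_def
  proof
    fix d assume d: "d \<in> A"
    let ?\<phi> = "transition d c"
    note hol = transition_hol[OF d c(1)] and op = open_overlap[OF d c(1)]
    have "continuous_on (overlap d c) ?\<phi>"
      by (auto intro!: continuous_at_imp_continuous_on has_derivative_continuous[OF cholomorphic_on_component(3)[OF hol]])
    then have "C1_on (overlap d c) (\<lambda>z. B (?\<phi> z))"
      by (intro C1_onI[OF has_derivative_compose[OF cholomorphic_on_component(3)[OF hol] dB]])
         (auto simp: B'_def intro!: continuous_intros cholomorphic_derivative_continuous[OF op hol])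
    then have 1: "C1_on (overlap d c) (\<lambda>z. g (chart_inv d z))"
      by (rule C1_on_cong[OF op, rotated]) (simp add: overlap_iff[OF d] g_def transition_def)
    define N where "N = {z \<in> chart_image d. chart_inv d z \<in> - K}"
    have oN: "open N" unfolding N_def
      using K by (intro open_preimage[OF d]) (simp add: compact_imp_closed open_Compl)
    have 2: "C1_on N (\<lambda>z. g (chart_inv d z))"
      by (rule C1_on_cong[OF oN _ C1_on_const[of _ 0]]) (simp add: N_def g0)
    have "overlap d c \<union> N = chart_image d"
      using Kc by (auto simp: overlap_iff[OF d] N_def)
    then show "C1_on (chart_image d) (\<lambda>z. g (chart_inv d z))"
      using C1_on_Un[OF op oN 1 2] by simp
  qed
  moreover define W where "W = {y \<in> fst c. snd c y \<in> ball p r}"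
  have "open (fst c \<inter> snd c -` ball p r)"
    using chart(1,4)[OF c(1)] by (simp add: continuous_open_preimage)
  then have "open W" by (simp add: W_def vimage_def Int_def)
  moreover have "x \<in> W" using c r by (simp add: W_def p_def)
  moreover have "g y > 0" if "y \<in> W" for y using that Bnz[of "snd c y"] by (simp add: W_def g_def)
  moreover have "g y \<ge> 0" for y by (simp add: g_def B_def)
  ultimately show ?thesis using that[of c K W g] c(1) K Kc g0 by blast
qed

text \<open>By compactness finitely many positivity sets of bumps cover the space; dividing by the
  sum, which is then positive everywhere, keeps supports and regularity. The index set consists of
  points, so a chart may occur several times.\<close>

lemma partition_of_unity:
  assumes "compact (UNIV :: 'a set)"
  obtains P :: "'a set" and C K and g :: "'a \<Rightarrow> 'a \<Rightarrow> real"
  where "finite P" "\<And>k. k \<in> P \<Longrightarrow> C k \<in> A" "\<And>k. k \<in> P \<Longrightarrow> compact (K k)" "\<And>k. k \<in> P \<Longrightarrow> K k \<subseteq> fst (C k)"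
    "\<And>k. k \<in> P \<Longrightarrow> C1_fun (g k)" "\<And>k x. k \<in> P \<Longrightarrow> g k x \<ge> 0" "\<And>k x. k \<in> P \<Longrightarrow> x \<notin> K k \<Longrightarrow> g k x = 0"
    "\<And>x. (\<Sum>k\<in>P. g k x) = 1"
proof -
  have "\<forall>x. \<exists>c K W (g :: 'a \<Rightarrow> real). c \<in> A \<and> compact K \<and> K \<subseteq> fst c \<and> open W \<and> x \<in> W \<and> (\<forall>y\<in>W. g y > 0) \<and>
     (\<forall>y. g y \<ge> 0) \<and> (\<forall>y. y \<notin> K \<longrightarrow> g y = 0) \<and> C1_fun g"
    by (rule allI, rule_tac x=x in bump) blast
  then obtain C K W g where b: "\<And>x. C x \<in> A" "\<And>x. compact (K x)" "\<And>x. K x \<subseteq> fst (C x)" "\<And>x. open (W x)"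
    "\<And>x. x \<in> W x" "\<And>x y. y \<in> W x \<Longrightarrow> g x y > (0::real)" "\<And>x y. g x y \<ge> 0"
    "\<And>x y. y \<notin> K x \<Longrightarrow> g x y = 0" "\<And>x. C1_fun (g x)"
    unfolding choice_iff by blast
  have "UNIV \<subseteq> (\<Union>x\<in>UNIV. W x)" using b(5) by blast
  then obtain P where P: "finite P" "UNIV \<subseteq> (\<Union>x\<in>P. W x)"
    using compactE_image[OF assms, of UNIV W] b(4) by metis
  define S where "S = (\<lambda>y. \<Sum>k\<in>P. g k y)"
  have S: "S y > 0" for y
  proof -
    obtain k where "k \<in> P" "y \<in> W k" using P(2) by blast
    then show ?thesis unfolding S_def using P(1) b(6,7) by (intro sum_pos2[of P k]) auto
  qed
  have C1: "C1_fun (\<lambda>y. g k y * inverse (S y))" for k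
    unfolding C1_fun_def
  proof
    fix c assume "c \<in> A"
    then have "C1_on (chart_image c) (\<lambda>z. g k (chart_inv c z))" for k using b(9) by (simp add: C1_funD)
    then show "C1_on (chart_image c) (\<lambda>z. g k (chart_inv c z) * inverse (S (chart_inv c z)))"
      using S by (intro C1_on_mult C1_on_inverse) (auto simp: S_def intro!: C1_on_sum simp: less_imp_neq[symmetric])
  qed
  show ?thesis
  proof (rule that[of P C K "\<lambda>k y. g k y * inverse (S y)"])
    show "(\<Sum>k\<in>P. g k x * inverse (S x)) = 1" for x
      using S[of x] by (simp add: sum_distrib_right[symmetric] S_def)
    show "g k x * inverse (S x) \<ge> 0" for k x using b(7)[of k x] S[of x] by (simp add: less_imp_le)
  qed (use b P C1 in auto)
qed

end

text \<open>The set where \<open>f\<close> is nonzero is open, and a nonempty open set is never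
  Lebesgue null.\<close>

lemma continuous_AE_zero:
  fixes f :: "'v::euclidean_space \<Rightarrow> real"
  assumes "continuous_on UNIV f" "AE z in lborel. f z = 0"
  shows "f z = 0"
proof (rule ccontr)
  assume "f z \<noteq> 0"
  define S where "S = f -` (- {0})"
  have "open S" unfolding S_def using assms(1) by (intro open_vimage) auto
  moreover have "z \<in> S" using \<open>f z \<noteq> 0\<close> by (simp add: S_def)
  ultimately have "\<not> negligible S" using open_not_negligible by blast
  have "S \<in> null_sets lborel"
    using assms(2) \<open>open S\<close> by (subst AE_iff_null_sets) (auto simp: S_def elim!: eventually_mono)
  then have "negligible S"
    by (simp add: negligible_iff_null_sets null_sets_completionI)
  with \<open>\<not> negligible S\<close> show False by blast
qed

context catlas
begin

section \<open>From \<open>delbar\<close>-closed forms to holomorphic ones\<close>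

lemma pq_formsD:
  assumes "\<omega> \<in> pq_forms A (int p) 0"
  shows "c \<notin> A \<or> z \<notin> chart_image c \<Longrightarrow> \<omega> c z vs = 0"
    and "c \<in> A \<Longrightarrow> z \<in> chart_image c \<Longrightarrow> p0_covector p (\<omega> c z)"
    and "c \<in> A \<Longrightarrow> smooth_on (chart_image c) (\<lambda>z. \<omega> c z vs)"
    and "c \<in> A \<Longrightarrow> d \<in> A \<Longrightarrow> x \<in> fst c \<inter> fst d \<Longrightarrow> \<omega> c (snd c x) vs =
           \<omega> d (snd d x) (map (frechet_derivative (transition c d) (at (snd c x))) vs)"
proof -
  have eq: "pq_forms A (int p) 0 = {\<omega>. (\<forall>c z vs. c \<notin> A \<or> z \<notin> chart_image c \<longrightarrow> \<omega> c z vs = 0) \<and>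
        (\<forall>c\<in>A. \<forall>z\<in>chart_image c. \<omega> c z \<in> pq_covectors p 0) \<and>
        (\<forall>c\<in>A. \<forall>vs. smooth_on (chart_image c) (\<lambda>z. \<omega> c z vs)) \<and>
        (\<forall>c\<in>A. \<forall>d\<in>A. \<forall>x \<in> fst c \<inter> fst d. \<forall>vs. \<omega> c (snd c x) vs =
           \<omega> d (snd d x) (map (frechet_derivative (transition c d) (at (snd c x))) vs))}"
    by (simp only: pq_forms_def of_nat_less_0_iff less_irrefl simp_thms if_False nat_int nat_0)
  note * = assms[unfolded eq mem_Collect_eq]
  show "c \<notin> A \<or> z \<notin> chart_image c \<Longrightarrow> \<omega> c z vs = 0" using * by blast
  show "c \<in> A \<Longrightarrow> z \<in> chart_image c \<Longrightarrow> p0_covector p (\<omega> c z)"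
    using * unfolding p0_covector_iff by blast
  show "c \<in> A \<Longrightarrow> smooth_on (chart_image c) (\<lambda>z. \<omega> c z vs)" using * by blast
  show "c \<in> A \<Longrightarrow> d \<in> A \<Longrightarrow> x \<in> fst c \<inter> fst d \<Longrightarrow> \<omega> c (snd c x) vs =
           \<omega> d (snd d x) (map (frechet_derivative (transition c d) (at (snd c x))) vs)"
    using * by blast
qed

text \<open>The vanishing of \<open>delbar\<close>, an alternating sum over slots, does not at once
  concern single coefficients. Putting \<open>v\<close> in front of \<open>us\<close> separates
  them: the term that differentiates along \<open>v\<close> is antilinear in \<open>v\<close>, the
  others contain \<open>v\<close> as an argument of the form and are linear in it, so both parts
  vanish.\<close>

lemma delbar_zero_imp_hol_form:
  assumes \<omega>: "\<omega> \<in> pq_forms A (int p) 0" and delbar: "delbar A \<omega> = zero_form" and c: "c \<in> A"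
  shows "hol_form (chart_image c) p (\<omega> c)"
proof -
  let ?U = "chart_image c"
  have off: "\<omega> c z vs = 0" if "z \<notin> ?U" for z vs using that by (intro pq_formsD(1)[OF \<omega>]) simp
  have cov: "p0_covector p (\<omega> c z)" if "z \<in> ?U" for z
    by (rule pq_formsD(2)[OF \<omega> c that])
  have diff: "(\<lambda>z. \<omega> c z vs) differentiable (at z)" if "z \<in> ?U" for z vs
  proof -
    have "Ck_on (Suc 0) ?U (\<lambda>z. \<omega> c z vs)" using pq_formsD(3)[OF \<omega> c, of vs] unfolding smooth_on_def by blast
    then show ?thesis using that by simp
  qed
  have "hol_on ?U (\<lambda>z. \<omega> c z us)" for us
    unfolding hol_on_def
  proof
    fix z assume z: "z \<in> ?U"
    let ?D = "\<lambda>us v. frechet_derivative (\<lambda>z. \<omega> c z us) (at z) v"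
    let ?B = "\<lambda>us v. delbar_fun (\<lambda>z. \<omega> c z us) z v"
    note lin = linear_frechet_derivative[OF diff[OF z]]
    \<comment> \<open>The terms in which \<open>v\<close> remains an argument of the form. With
      \<open>v\<close> in front the entries of \<open>us\<close> move up by one position, hence the
      sign with \<open>Suc i\<close>.\<close>
    define R where "R = (\<lambda>v. \<Sum>i<length us. (-1) ^ Suc i * ?B (v # omit_nth i us) (us ! i))"
    have sum0: "?B us v + R v = 0" for v
    proof -
      have "delbar A \<omega> c z (v # us) = 0" using delbar by (simp add: zero_form_def)
      then have "(\<Sum>i<Suc (length us). (-1) ^ i * ?B (omit_nth i (v # us)) ((v # us) ! i)) = 0"
        using c z by (simp add: delbar_def)
      then show ?thesis
        unfolding sum.lessThan_Suc_shift by (simp add: R_def omit_nth_def)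
    qed
    have BI: "?B us (\<i> *s v) = - \<i> * ?B us v" for v
    proof -
      have "\<i> *s (\<i> *s v) = - v" by (simp add: Finite_Cartesian_Product.vec_eq_iff)
      then show ?thesis
        unfolding delbar_fun_def by (simp add: linear_neg[OF lin] field_simps)
    qed
    have RI: "R (\<i> *s v) = \<i> * R v" for v
    proof -
      have "?B ((\<i> *s v) # ws) u = \<i> * ?B (v # ws) u" for ws u
      proof -
        have "\<omega> c y ((\<i> *s v) # ws) = \<i> * \<omega> c y (v # ws)" for y
        proof (cases "y \<in> ?U")
          case True
          from p0_covector_multilinear[OF cov[OF this]]
          have "\<omega> c y ([] @ (\<i> *s v) # ws) = \<i> * \<omega> c y ([] @ v # ws)" unfolding multilinear_iff by blast
          then show ?thesis by simp
        qed (simp add: off)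
        then have eq: "(\<lambda>y. \<omega> c y ((\<i> *s v) # ws)) = (\<lambda>y. \<i> * \<omega> c y (v # ws))" by (rule ext)
        have "((\<lambda>y. \<i> * \<omega> c y (v # ws)) has_derivative (\<lambda>u. \<i> * ?D (v # ws) u)) (at z)"
          using diff[OF z, of "v # ws"] by (intro has_derivative_mult_right) (simp add: frechet_derivative_works)
        from fun_cong[OF frechet_derivative_at[OF this]]
        have "frechet_derivative (\<lambda>y. \<i> * \<omega> c y (v # ws)) (at z) u = \<i> * ?D (v # ws) u" for u by (rule sym)
        then show ?thesis unfolding eq delbar_fun_def by (simp add: algebra_simps)
      qed
      then show ?thesis by (simp only: R_def sum_distrib_left) (simp add: mult.left_commute)
    qed
    have D\<i>: "?D us (\<i> *s v) = \<i> * ?D us v" for v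
    proof -
      \<comment> \<open>The identity at \<i> times \<open>v\<close>, compared with the one at
        \<open>v\<close>, forces the antilinear part to be zero.\<close>
      have "- \<i> * ?B us v + \<i> * R v = 0" using sum0[of "\<i> *s v"] unfolding BI RI .
      moreover have "R v = - ?B us v" using sum0[of v] by (simp add: eq_neg_iff_add_eq_0 add.commute)
      ultimately have "?B us v = 0" by simp
      then have "?D us v + \<i> * ?D us (\<i> *s v) = 0" by (simp add: delbar_fun_def)
      then have "\<i> * (?D us v + \<i> * ?D us (\<i> *s v)) = 0" by simp
      then show ?thesis by (simp add: distrib_left)
    qed
    have "?D us (k *s v) = k * ?D us v" for k v
    proof -
      have "k *s v = Re k *\<^sub>R v + Im k *\<^sub>R (\<i> *s v)"
        by (simp add: Finite_Cartesian_Product.vec_eq_iff complex_eq_iff)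
      then have "?D us (k *s v) = Re k *\<^sub>R ?D us v + Im k *\<^sub>R (\<i> * ?D us v)"
        by (simp only: linear_add[OF lin] linear_cmul[OF lin] D\<i>)
      then show ?thesis by (simp add: complex_eq_iff)
    qed
    then show "\<exists>D. ((\<lambda>z. \<omega> c z us) has_derivative D) (at z) \<and> (\<forall>k v. D (k *s v) = k * D v)"
      using diff[OF z] by (intro exI[of _ "?D us"]) (simp add: frechet_derivative_works)
  qed
  then show ?thesis using cov by (simp add: hol_form_def)
qed

lemma del_eq_ext_deriv:
  assumes "hol_form (chart_image c) p (\<omega> c)" "c \<in> A" "z \<in> chart_image c"
  shows "del A \<omega> c z vs = ext_deriv (\<omega> c) z vs"
proof -
  have "hol_on (chart_image c) (\<lambda>z. \<omega> c z us)" for us using assms(1) by (simp add: hol_form_def)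
  from hol_onD(2)[OF this assms(3)]
  have "del_fun (\<lambda>z. \<omega> c z us) z v = frechet_derivative (\<lambda>z. \<omega> c z us) (at z) v" for us v
    by (simp add: del_fun_def)
  then show ?thesis using assms by (simp add: del_def ext_deriv_def)
qed

text \<open>Two derivatives of the smooth coefficients are used: one is spent in
  \<open>ext_deriv\<close>, the other here.\<close>

lemma C1_on_ext_deriv:
  assumes "\<omega> \<in> pq_forms A (int p) 0" "c \<in> A"
  shows "C1_on (chart_image c) (\<lambda>z. ext_deriv (\<omega> c) z vs)"
  unfolding ext_deriv_def
proof (intro C1_on_sum C1_on_mult C1_on_const)
  fix i
  have "Ck_on (Suc (Suc 0)) (chart_image c) (\<lambda>z. \<omega> c z (omit_nth i vs))"
    using pq_formsD(3)[OF assms] unfolding smooth_on_def by blast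
  then show "C1_on (chart_image c) (\<lambda>z. frechet_derivative (\<lambda>z. \<omega> c z (omit_nth i vs)) (at z) (vs ! i))"
    by (simp add: C1_on_def)
qed

lemma form_transition:
  assumes "\<omega> \<in> pq_forms A (int p) 0" "c \<in> A" "d \<in> A" "z \<in> overlap c d"
  shows "\<omega> c z vs = \<omega> d (transition c d z) (map (frechet_derivative (transition c d) (at z)) vs)"
proof -
  have z: "z \<in> chart_image c" "chart_inv c z \<in> fst c" "chart_inv c z \<in> fst d" "snd c (chart_inv c z) = z"
    using assms by (auto simp: overlap_iff chart)
  from pq_formsD(4)[OF assms(1-3), of "chart_inv c z" vs]
  have "\<omega> c (snd c (chart_inv c z)) vs =
     \<omega> d (snd d (chart_inv c z)) (map (frechet_derivative (transition c d) (at (snd c (chart_inv c z)))) vs)"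
    using z(2,3) by blast
  then show ?thesis by (simp add: z(4) transition_def)
qed

lemma hol_form_subset: "hol_form U p w \<Longrightarrow> V \<subseteq> U \<Longrightarrow> hol_form V p w"
  by (auto simp: hol_form_def hol_on_def)

text \<open>The Stokes argument. Evaluating on one basis turns all top covectors into scalar
  functions of the chart coordinates.\<close>

lemma ext_deriv_basis_zero:
  assumes cpt: "compact (UNIV :: 'a set)" and p: "Suc p = CARD('n)"
    and \<omega>: "\<omega> \<in> pq_forms A (int p) 0" and delbar: "delbar A \<omega> = zero_form"
    and c: "c \<in> A" and z: "z \<in> chart_image c"
  shows "ext_deriv (\<omega> c) z basis_list = 0"
proof -
  let ?es = "basis_list :: (complex^'n) list"
  let ?U = "chart_image"
  let ?J = "\<lambda>c d z. frechet_derivative (transition c d) (at z)"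
  note hf = delbar_zero_imp_hol_form[OF \<omega> delbar]
  define f where "f = (\<lambda>c z. ext_deriv (\<omega> c) z ?es)"
  have Cf: "C1_on (?U c) (f c)" if "c \<in> A" for c
    unfolding f_def by (rule C1_on_ext_deriv[OF \<omega> that])
  \<comment> \<open>Naturality of d, followed by the scaling of a top covector under the
    Jacobian.\<close>
  have ftrans: "f c z = cdet (?J c d z) * f d (transition c d z)"
    if "c \<in> A" "d \<in> A" "z \<in> overlap c d" for c d z
  proof -
    have sub: "overlap c d \<subseteq> ?U c" "overlap d c \<subseteq> ?U d" using that by (auto simp: overlap_iff)
    have w: "hol_form (overlap d c) p (\<omega> d)" by (rule hol_form_subset[OF hf[OF that(2)] sub(2)])
    have w': "hol_on (overlap c d) (\<lambda>z. \<omega> c z vs)" for vs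
      using hol_form_subset[OF hf[OF that(1)] sub(1)] by (simp add: hol_form_def)
    have "f c z = ext_deriv (\<omega> d) (transition c d z) (map (?J c d z) ?es)"
      unfolding f_def
      by (rule ext_deriv_pullback[OF open_overlap[OF that(1,2)] that(3) open_overlap[OF that(2,1)] _
            transition_hol[OF that(1,2)] w w' form_transition[OF \<omega> that(1,2)]])
         (use transition(1)[OF that(1,2)] in auto)
    also have "\<dots> = cdet (?J c d z) * f d (transition c d z)"
      unfolding f_def
      by (rule top_covector_scale)
         (use p0_covector_ext_deriv[OF open_overlap[OF that(2,1)] transition(1)[OF that] w] p in simp)
    finally show ?thesis .
  qed
  obtain P :: "'a set" and C K and g :: "'a \<Rightarrow> 'a \<Rightarrow> real" where
    P: "finite P" "\<And>k. k \<in> P \<Longrightarrow> C k \<in> A" "\<And>k. k \<in> P \<Longrightarrow> compact (K k)" "\<And>k. k \<in> P \<Longrightarrow> K k \<subseteq> fst (C k)"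
    "\<And>k. k \<in> P \<Longrightarrow> C1_fun (g k)" "\<And>k x. k \<in> P \<Longrightarrow> g k x \<ge> 0" "\<And>k x. k \<in> P \<Longrightarrow> x \<notin> K k \<Longrightarrow> g k x = 0"
    "\<And>x. (\<Sum>k\<in>P. g k x) = 1"
  proof (rule partition_of_unity[OF cpt], goal_cases)
    case (1 P C K g)
    show ?case by (rule 1(1)[OF 1(2-9)])
  qed
  \<comment> \<open>The coefficient of \<open>\<partial>g_k \<and> \<omega>\<close> in chart
    \<open>c\<close>. It transforms like \<open>f\<close>, so its product with the conjugate of
    \<open>f\<close> picks up the real Jacobian.\<close>
  define \<theta> where "\<theta> = (\<lambda>k c z. partial_wedge (\<lambda>z. g k (chart_inv c z)) (\<omega> c) z ?es)"
  have \<theta>trans: "\<theta> k c z = cdet (?J c d z) * \<theta> k d (transition c d z)"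
    if "k \<in> P" "c \<in> A" "d \<in> A" "z \<in> overlap c d" for k c d z
  proof -
    have td: "transition c d z \<in> ?U d" using transition(1)[OF that(2-4)] that(3) by (simp add: overlap_iff)
    have "\<theta> k c z = partial_wedge (\<lambda>z. g k (chart_inv d z)) (\<omega> d) (transition c d z) (map (?J c d z) ?es)"
      unfolding \<theta>_def partial_wedge_def
      by (simp add: partial_fun_transition[OF P(5)[OF that(1)] that(2-4)] form_transition[OF \<omega> that(2-4)] map_omit_nth)
    also have "\<dots> = cdet (?J c d z) * \<theta> k d (transition c d z)"
      unfolding \<theta>_def
    proof (rule top_covector_scale)
      have "(\<lambda>z. g k (chart_inv d z)) differentiable (at (transition c d z))"
        using C1_funD[OF P(5)[OF that(1)] that(3)] td by (simp add: C1_on_def)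
      moreover have "p0_covector p (\<omega> d (transition c d z))"
        using hf[OF that(3)] td by (simp add: hol_form_def)
      ultimately show "p0_covector CARD('n) (partial_wedge (\<lambda>z. g k (chart_inv d z)) (\<omega> d) (transition c d z))"
        unfolding p[symmetric] by (rule p0_covector_partial_wedge)
    qed
    finally show ?thesis .
  qed
  define KK where "KK = (\<lambda>k. snd (C k) ` K k)"
  have KK: "compact (KK k)" "KK k \<subseteq> ?U (C k)" if "k \<in> P" for k
  proof -
    show "compact (KK k)" unfolding KK_def
      by (intro compact_continuous_image continuous_on_subset[OF chart(4)[OF P(2)[OF that]] P(4)[OF that]] P(3)[OF that])
    show "KK k \<subseteq> ?U (C k)" using P(4)[OF that] by (auto simp: KK_def chart_image_def)
  qed
  have ptK: "chart_inv (C k) z \<notin> K k" if "k \<in> P" "z \<in> ?U (C k) - KK k" for k z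
  proof
    assume "chart_inv (C k) z \<in> K k"
    then have "snd (C k) (chart_inv (C k) z) \<in> KK k" unfolding KK_def by (rule imageI)
    then show False using that(2) chart(8)[OF P(2)[OF that(1)], of z] by simp
  qed
  have gK: "g k (chart_inv (C k) z) = 0" if "k \<in> P" "z \<in> ?U (C k) - KK k" for k z
    by (rule P(7)[OF that(1) ptK[OF that]])
  have \<theta>0: "\<theta> k c z = 0" if "k \<in> P" "c \<in> A" "z \<in> ?U c" "chart_inv c z \<notin> K k" for k c z
  proof -
    have "open {z \<in> ?U c. chart_inv c z \<in> - K k}"
      using P(3)[OF that(1)] by (intro open_preimage[OF that(2)]) (simp add: compact_imp_closed open_Compl)
    then show ?thesis unfolding \<theta>_def
      by (rule partial_wedge_zero) (use that P(7) in auto)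
  qed
  \<comment> \<open>The density of \<open>g_l \<partial>g_k \<and> \<omega> \<and> cnj
    (\<partial>\<omega>)\<close> in chart \<open>c\<close>. It vanishes off \<open>K k\<close> and
    off \<open>K l\<close>, so it can be integrated in the chart of either index.\<close>
  define H where "H = (\<lambda>k l c z. if z \<in> ?U c then g l (chart_inv c z) * Re (\<theta> k c z * cnj (f c z)) else 0)"
  have contH: "continuous_on (?U c) (\<lambda>z. g l (chart_inv c z) * Re (\<theta> k c z * cnj (f c z)))"
    if "k \<in> P" "l \<in> P" "c \<in> A" for k l c
    unfolding \<theta>_def
    by (intro continuous_on_mult continuous_on_Re continuous_on_cnj C1_on_continuous[OF Cf[OF that(3)]]
         C1_on_continuous[OF C1_funD[OF P(5)[OF that(2)] that(3)]]
         continuous_on_partial_wedge[OF chart(2)[OF that(3)] C1_funD[OF P(5)[OF that(1)] that(3)] hf[OF that(3)]])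
  have intH1: "integrable lborel (H k l (C k))" if "k \<in> P" "l \<in> P" for k l
    unfolding H_def
    by (rule integrable_extend_zero[OF chart(2)[OF P(2)[OF that(1)]] KK[OF that(1)] contH[OF that P(2)[OF that(1)]]])
       (simp add: \<theta>0[OF that(1) P(2)[OF that(1)]] ptK[OF that(1)])
  have intH2: "integrable lborel (H k l (C l))" if "k \<in> P" "l \<in> P" for k l
    unfolding H_def
    by (rule integrable_extend_zero[OF chart(2)[OF P(2)[OF that(2)]] KK[OF that(2)] contH[OF that P(2)[OF that(2)]]])
       (simp add: gK[OF that(2)])
  \<comment> \<open>In each of the two charts the density vanishes off the overlap, so the change of
    variables along the transition map captures the whole integral.\<close>
  have Heq: "integral\<^sup>L lborel (H k l (C k)) = integral\<^sup>L lborel (H k l (C l))" if "k \<in> P" "l \<in> P" for k l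
  proof -
    note a = P(2)[OF that(1)] P(2)[OF that(2)]
    let ?c = "C k" and ?d = "C l"
    show ?thesis
    proof (rule integral_change_of_variables_complex[where \<phi>="transition ?c ?d" and \<psi>="transition ?d ?c"
          and J="?J ?c ?d" and J'="?J ?d ?c" and S="overlap ?c ?d" and V="overlap ?d ?c"])
      show "H k l ?d w = 0" if "w \<notin> overlap ?d ?c" for w
      proof (cases "w \<in> ?U ?d")
        case True
        then have "chart_inv ?d w \<notin> K k" using that P(4)[OF \<open>k \<in> P\<close>] by (auto simp: overlap_iff[OF a(2)])
        from \<theta>0[OF \<open>k \<in> P\<close> a(2) True this] show ?thesis by (simp add: H_def)
      qed (simp add: H_def)
      show "H k l ?c w = 0" if "w \<notin> overlap ?c ?d" for w
      proof (cases "w \<in> ?U ?c")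
        case True
        then have "chart_inv ?c w \<notin> K l" using that P(4)[OF \<open>l \<in> P\<close>] by (auto simp: overlap_iff[OF a(1)])
        from P(7)[OF \<open>l \<in> P\<close> this] show ?thesis by (simp add: H_def)
      qed (simp add: H_def)
      show "H k l ?c w = (norm (cdet (?J ?c ?d w)))\<^sup>2 * H k l ?d (transition ?c ?d w)" if w: "w \<in> overlap ?c ?d" for w
      proof -
        let ?t = "transition ?c ?d w" and ?D = "cdet (?J ?c ?d w)"
        have in1: "w \<in> ?U ?c" "?t \<in> ?U ?d"
          using w transition(1)[OF a w] by (simp_all add: overlap_iff a)
        have "\<theta> k ?c w * cnj (f ?c w) = (?D * cnj ?D) * (\<theta> k ?d ?t * cnj (f ?d ?t))"
          by (simp add: \<theta>trans[OF \<open>k \<in> P\<close> a w] ftrans[OF a w] mult_ac)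
        also have "?D * cnj ?D = complex_of_real ((norm ?D)\<^sup>2)" by (rule complex_norm_square[symmetric])
        finally have "Re (\<theta> k ?c w * cnj (f ?c w)) = (norm ?D)\<^sup>2 * Re (\<theta> k ?d ?t * cnj (f ?d ?t))"
          by (simp only: Re_complex_of_real Im_complex_of_real times_complex.sel mult_zero_left diff_zero)
        then show ?thesis using in1 transition(3)[OF a w] by (simp add: H_def del: times_complex.sel)
      qed
    qed (use open_overlap[OF a] open_overlap[OF a(2,1)] cholomorphic_on_component(3,4)[OF transition_hol[OF a]]
          cholomorphic_on_component(3)[OF transition_hol[OF a(2,1)]] transition[OF a] transition[OF a(2,1)]
          intH1[OF that] intH2[OF that] in auto)
  qed
  define E where "E = (\<lambda>k z. if z \<in> ?U (C k) then g k (chart_inv (C k) z) * (norm (f (C k) z))\<^sup>2 else 0)"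
  have contE: "continuous_on (?U (C k)) (\<lambda>z. g k (chart_inv (C k) z) * (norm (f (C k) z))\<^sup>2)" if "k \<in> P" for k
    by (intro continuous_on_mult continuous_on_power continuous_on_norm C1_on_continuous[OF Cf[OF P(2)[OF that]]]
         C1_on_continuous[OF C1_funD[OF P(5)[OF that] P(2)[OF that]]])
  have contE': "continuous_on UNIV (E k)" if "k \<in> P" for k
    unfolding E_def
    by (rule continuous_on_extend_zero[OF chart(2)[OF P(2)[OF that]] KK[OF that] contE[OF that]]) (simp add: gK[OF that])
  have intE: "integrable lborel (E k)" if "k \<in> P" for k
    unfolding E_def
    by (rule integrable_extend_zero[OF chart(2)[OF P(2)[OF that]] KK[OF that] contE[OF that]]) (simp add: gK[OF that])
  have E0: "E k z \<ge> 0" if "k \<in> P" for k z using P(6)[OF that] by (simp add: E_def)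
  have parts: "integral\<^sup>L lborel (E k) = - (\<Sum>l\<in>P. integral\<^sup>L lborel (H k l (C k)))" if "k \<in> P" for k
  proof -
    have "integral\<^sup>L lborel (E k) = - integral\<^sup>L lborel (\<lambda>z. if z \<in> ?U (C k) then Re (\<theta> k (C k) z * cnj (f (C k) z)) else 0)"
      unfolding E_def f_def \<theta>_def
      by (rule integral_ext_deriv_by_parts[OF chart(2)[OF P(2)[OF that]] KK[OF that] C1_funD[OF P(5)[OF that] P(2)[OF that]]
            gK[OF that] hf[OF P(2)[OF that]] C1_on_ext_deriv[OF \<omega> P(2)[OF that]]])
    \<comment> \<open>Here 1 is written as the sum of all \<open>g l\<close>, so that each summand
      can move to its own chart \<open>C l\<close>.\<close>
    also have "(\<lambda>z. if z \<in> ?U (C k) then Re (\<theta> k (C k) z * cnj (f (C k) z)) else 0) = (\<lambda>z. \<Sum>l\<in>P. H k l (C k) z)"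
      by (auto simp: H_def fun_eq_iff sum_distrib_right[symmetric] P(8) simp del: times_complex.sel)
    also have "integral\<^sup>L lborel \<dots> = (\<Sum>l\<in>P. integral\<^sup>L lborel (H k l (C k)))"
      by (rule Bochner_Integration.integral_sum) (rule intH1[OF that])
    finally show ?thesis .
  qed
  \<comment> \<open>Derivative of the constant sum of the \<open>g k\<close>. All summands must be
    expressed in the same chart \<open>c\<close>, which is why the terms change charts before they
    are added over \<open>k\<close>.\<close>
  have \<theta>sum: "(\<Sum>k\<in>P. \<theta> k c z) = 0" if "c \<in> A" "z \<in> ?U c" for c z
  proof -
    have "(\<Sum>k\<in>P. frechet_derivative (\<lambda>z. g k (chart_inv c z)) (at z) v) = 0" for v
    proof -
      have "((\<lambda>z. \<Sum>k\<in>P. g k (chart_inv c z)) has_derivative (\<lambda>v. \<Sum>k\<in>P. frechet_derivative (\<lambda>z. g k (chart_inv c z)) (at z) v)) (at z)"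
        by (intro has_derivative_sum C1_on_has_derivative[OF C1_funD[OF P(5) that(1)] that(2)])
      then have "((\<lambda>z. 1) has_derivative (\<lambda>v. \<Sum>k\<in>P. frechet_derivative (\<lambda>z. g k (chart_inv c z)) (at z) v)) (at z)"
        by (simp only: P(8))
      from fun_cong[OF has_derivative_unique[OF this has_derivative_const], of v] show ?thesis by simp
    qed
    then have "(\<Sum>k\<in>P. partial_fun (\<lambda>z. g k (chart_inv c z)) z v) = 0" for v
      unfolding partial_fun_def
      by (simp add: sum_divide_distrib[symmetric] sum_subtractf sum_distrib_left[symmetric] of_real_sum[symmetric]
          del: of_real_sum)
    moreover have "(\<Sum>k\<in>P. \<theta> k c z) = (\<Sum>i<length ?es. (-1) ^ i *
        ((\<Sum>k\<in>P. partial_fun (\<lambda>z. g k (chart_inv c z)) z (?es ! i)) * \<omega> c z (omit_nth i ?es)))"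
      unfolding \<theta>_def partial_wedge_def sum_distrib_left sum_distrib_right by (rule sum.swap)
    ultimately show ?thesis by simp
  qed
  have "(\<Sum>k\<in>P. integral\<^sup>L lborel (E k)) = - (\<Sum>k\<in>P. \<Sum>l\<in>P. integral\<^sup>L lborel (H k l (C l)))"
  proof -
    have "(\<Sum>l\<in>P. integral\<^sup>L lborel (H k l (C k))) = (\<Sum>l\<in>P. integral\<^sup>L lborel (H k l (C l)))" if "k \<in> P" for k
      by (rule sum.cong[OF refl Heq[OF that]])
    then show ?thesis unfolding sum_negf[symmetric] by (intro sum.cong refl) (simp add: parts sum_negf)
  qed
  \<comment> \<open>For fixed \<open>l\<close> all terms now live in the chart \<open>C l\<close>,
    so the sum over \<open>k\<close> can be taken under the integral.\<close>
  also have "(\<Sum>k\<in>P. \<Sum>l\<in>P. integral\<^sup>L lborel (H k l (C l))) = (\<Sum>l\<in>P. \<Sum>k\<in>P. integral\<^sup>L lborel (H k l (C l)))"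
    by (rule sum.swap)
  also have "\<dots> = 0"
  proof (rule sum.neutral, rule ballI)
    fix l assume l: "l \<in> P"
    have "(\<Sum>k\<in>P. integral\<^sup>L lborel (H k l (C l))) = integral\<^sup>L lborel (\<lambda>z. \<Sum>k\<in>P. H k l (C l) z)"
      by (rule Bochner_Integration.integral_sum[symmetric]) (rule intH2[OF _ l])
    also have "(\<lambda>z. \<Sum>k\<in>P. H k l (C l) z) = (\<lambda>z. 0)"
    proof
      fix z
      show "(\<Sum>k\<in>P. H k l (C l) z) = 0"
      proof (cases "z \<in> ?U (C l)")
        case True
        then have "(\<Sum>k\<in>P. H k l (C l) z) = g l (chart_inv (C l) z) * Re ((\<Sum>k\<in>P. \<theta> k (C l) z) * cnj (f (C l) z))"
          by (simp only: H_def if_True sum_distrib_left sum_distrib_right Re_sum)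
        then show ?thesis by (simp add: \<theta>sum[OF P(2)[OF l] True])
      qed (simp add: H_def)
    qed
    finally show "(\<Sum>k\<in>P. integral\<^sup>L lborel (H k l (C l))) = 0" by simp
  qed
  finally have "(\<Sum>k\<in>P. integral\<^sup>L lborel (E k)) = 0" by simp
  then have Eint: "integral\<^sup>L lborel (E k) = 0" if "k \<in> P" for k
    using sum_nonneg_eq_0_iff[OF P(1), of "\<lambda>k. integral\<^sup>L lborel (E k)"] E0 that
    by (auto intro: Bochner_Integration.integral_nonneg)
  have Ez: "E k z = 0" if "k \<in> P" for k z
  proof -
    have "AE z in lborel. E k z = 0"
      using integral_nonneg_eq_0_iff_AE[OF intE[OF that]] E0[OF that] Eint[OF that] by auto
    then show ?thesis
      by (rule continuous_AE_zero[OF contE'[OF that]])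
  qed
  \<comment> \<open>The \<open>g k\<close> sum to 1, so one of them is nonzero at the point. This
    forces \<open>f\<close> to vanish there in the chart \<open>C k\<close>, and
    \<open>ftrans\<close> carries the zero back to \<open>c\<close>.\<close>
  obtain k where k: "k \<in> P" "g k (chart_inv c z) \<noteq> 0"
    using P(8)[of "chart_inv c z"] by (metis sum.neutral zero_neq_one)
  then have "chart_inv c z \<in> fst (C k)" using P(7)[OF k(1)] P(4)[OF k(1)] by blast
  then have ov: "z \<in> overlap c (C k)" using z c by (simp add: overlap_iff)
  note a = c P(2)[OF k(1)]
  let ?t = "transition c (C k) z"
  have "?t \<in> ?U (C k)" using transition(1)[OF a ov] by (simp add: overlap_iff[OF a(2)])
  then have "g k (chart_inv (C k) ?t) * (norm (f (C k) ?t))\<^sup>2 = 0" using Ez[OF k(1), of ?t] by (simp add: E_def)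
  then have "f (C k) ?t = 0" using k(2) transition(3)[OF a ov] by simp
  then show ?thesis using ftrans[OF a ov] by (simp add: f_def)
qed

end

context catlas
begin

lemma delbar_zero_imp_del_zero:
  assumes "compact (UNIV :: 'a set)" "Suc p = CARD('n)"
    and \<omega>: "\<omega> \<in> pq_forms A (int p) 0" and delbar: "delbar A \<omega> = zero_form"
  shows "del A \<omega> = zero_form"
proof (intro ext)
  fix c z and vs :: "(complex^'n) list"
  show "del A \<omega> c z vs = zero_form c z vs"
  proof (cases "c \<in> A \<and> z \<in> chart_image c")
    case True
    then have c: "c \<in> A" and z: "z \<in> chart_image c" by auto
    note hf = delbar_zero_imp_hol_form[OF \<omega> delbar c]
    have cov: "p0_covector CARD('n) (ext_deriv (\<omega> c) z)"
      using p0_covector_ext_deriv[OF chart(2)[OF c] z hf] assms(2) by simp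
    have "ext_deriv (\<omega> c) z vs = 0"
    proof (cases "length vs = CARD('n)")
      case True
      \<comment> \<open>The choice operator recovers the index of an axis vector, so
        \<open>L\<close> sends the basis list to \<open>vs\<close>. This \<open>L\<close> is in
        general not linear.\<close>
      define L where "L = (\<lambda>v :: complex^'n. vs ! list_pos (SOME i. v $ i \<noteq> 0))"
      have "(SOME i. axis j (1::complex) $ i \<noteq> 0) = j" for j :: 'n
        by (rule some_equality) (auto simp: axis_def split: if_splits)
      then have "map L basis_list = vs"
        by (intro nth_equalityI) (auto simp: True L_def basis_list_eq list_pos_index_list)
      then show ?thesis
        using top_covector_scale[OF cov, of L] ext_deriv_basis_zero[OF assms(1,2) \<omega> delbar c z] by simp
    next
      case False
      then show ?thesis by (rule p0_covector_length[OF cov])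
    qed
    then show ?thesis by (simp add: del_eq_ext_deriv[where \<omega>=\<omega>, OF hf c z] zero_form_def)
  qed (auto simp: del_def zero_form_def)
qed

end

lemma delbar_zero_form: "delbar A zero_form = zero_form"
  by (auto simp: delbar_def zero_form_def delbar_fun_def fun_eq_iff)

lemma del_zero_form: "del A zero_form = zero_form"
  by (auto simp: del_def zero_form_def del_fun_def fun_eq_iff)

theorem proposition3p3:
  fixes A :: "('a::t2_space, 'n::finite) chart set"
  assumes "compact (UNIV :: 'a set)"
    and "complex_atlas A"
  shows "h_BC A (int CARD('n) - 1) 0 = h_delbar A (int CARD('n) - 1) 0"
proof -
  interpret catlas A by unfold_locales (fact assms(2))
  \<comment> \<open>\<open>CARD('n)\<close> is at least 1, so the subtraction of natural numbers
    agrees with the integer bidegree.\<close>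
  define p where "p = CARD('n) - 1"
  have p: "Suc p = CARD('n)" "int CARD('n) - 1 = int p" by (auto simp: p_def of_nat_diff)
  have neg: "pq_forms A q (0 - 1) = {zero_form}" for q by (simp add: pq_forms_def)
  have "{\<omega> \<in> pq_forms A (int p) 0. del A \<omega> = zero_form \<and> delbar A \<omega> = zero_form} =
      {\<omega> \<in> pq_forms A (int p) 0. delbar A \<omega> = zero_form}"
    using delbar_zero_imp_del_zero[OF assms(1) p(1)] by blast
  \<comment> \<open>The two quotient modules are equal as records, not merely isomorphic, so
    \<open>complex_dim\<close> takes the same value on both.\<close>
  then have "bott_chern A (int p) 0 = dolbeault A (int p) 0"
    unfolding bott_chern_def dolbeault_def neg by (simp add: delbar_zero_form del_zero_form)
  then show ?thesis by (simp add: h_BC_def h_delbar_def p(2))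
qed

end
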